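(* Let $(X_n)$ be a sequence of elementary processes satisfying (G0), (G1), (S2)–(S4) for some $\delta_0>0$, and let $\delta_1:=\min\{3,\delta_0/\sqrt{\lambda_{\max}(\Sigma)}\}$. Then there are constants $n_c,\kappa_1,\kappa_2$ belonging to $\mathcal K$ such that, with $\kappa_0:=1536$, for any $B\subset\mathbb Z^d$ and any $\delta\le\delta_1/3$, the solution $h_B$ of the Stein equation $\mathcal A_n^\delta h_B(X)=\mathbf 1_B(X)-\Pi_n^\delta\{B\}$ satisfies $$|h_B(X)|\le\alpha_1^{-1}\kappa_0\log n,\quad\|\Delta h_B(X)\|_\infty\le\alpha_1^{-1}\kappa_1d^{1/4}n^{-1/2}\log n,\quad\|\Delta^2h_B(X)\|_\infty\le\alpha_1^{-1}\kappa_2d^{1/2}n^{-1}\log n,$$ for all $X$ with $|X-nc|_\Sigma\le n\delta/4$ and all $n\ge\max\{n_c,\psi^{-1}(\delta/2)\}$.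
   Context: Fix integers $d\ge1$, $n\ge d^4$ (standing assumption). A sequence $(X_n)$: finite $\mathcal J\subset\mathbb Z^d$, $g^J:\mathbb R^d\to[0,\infty)$, $X_n$ jumps $X\to X+J$ at rate $ng^J(n^{-1}X)$; $F(\xi):=\sum_JJg^J(\xi)$, $\sigma^2:=\sum_JJJ^Tg^J(c)$. With $c\in\mathbb R^d$, $\delta_0>0$, $B_{\delta_0}(c):=\{x:|x-c|\le\delta_0\}$: (G0) $F(c)=0$; (G1) all eigenvalues of $A:=DF(c)$ have negative real part; (S2) $\pm e^{(j)}\in\mathcal J$ for all $j$; (S3) $g^J$ is constant on $B_{\delta_0}(c)$ for $J\notin\{e^{(1)},\dots,e^{(d)}\}$; (S4) each $g^{e^{(j)}}$ is linear (affine) on $B_{\delta_0}(c)$ with $g^{e^{(j)}}\ge\frac12g^{e^{(j)}}(c)$ there; such a sequence is called elementary. $\Sigma$: positive definite symmetric solution of $A\Sigma+\Sigma A^T+\sigma^2=0$; $|Y|_\Sigma:=(Y^T\Sigma^{-1}Y)^{1/2}$; $\widetilde B_{n,\delta}(c):=\{X\in\mathbb Z^d:|X-nc|_\Sigma\le n\delta\}$. Restricted process $X_n^\delta$: jumps $X\to X+J$ at rate $ng^J(n^{-1}X)$ if $X,X+J\in\widetilde B_{n,\delta}(c)$, rate $0$ otherwise; generator $\mathcal A_n^\delta$; $\Pi_n^\delta$ its equilibrium distribution. The solution used is $h_B(X):=-\int_0^\infty(\mathbb P[X_n^\delta(t)\in B\mid X_n^\delta(0)=X]-\Pi_n^\delta\{B\})\,dt$.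 Differences: $\Delta_jh(X):=h(X+e^{(j)})-h(X)$, $\Delta_{jk}h:=\Delta_j(\Delta_kh)$, $\|\Delta h(X)\|_\infty:=\max_j|\Delta_jh(X)|$, $\|\Delta^2h(X)\|_\infty:=\max_{j,k}|\Delta_{jk}h(X)|$. Notation: $\lambda_{\min},\lambda_{\max}$ extreme eigenvalues; $\rho(M):=\lambda_{\max}(M)/\lambda_{\min}(M)$; $\bar\lambda(M):=d^{-1}\mathrm{Tr}M$; $\mathrm{Sp}'(M):=(\bar\lambda(M),\lambda_{\min}(M),\lambda_{\max}(M))$; $L_0,L_1,L_2$ are $\max_J\sup_{B_{\delta_0}(c)}$ of $g^J,|Dg^J|,\|D^2g^J\|$ divided by $g^J(c)$; $\bar\Lambda:=\bar\lambda(\sigma^2)$; $J_{\max}:=\max_J|J|$; $J^\Sigma_{\max}:=\max_J|\Sigma^{-1/2}J|$; $\alpha_1:=\frac12\lambda_{\min}(\Sigma^{-1/2}\sigma^2\Sigma^{-1/2})$; $\varepsilon_0:=1/2$; $\mu_*:=\min_J\varepsilon_0g^J(c)$. A quantity belongs to $\mathcal K$ if it is a continuous function of $L_0,L_1,L_2,\varepsilon_0,\mathrm{Sp}'(\sigma^2/\bar\Lambda),\mathrm{Sp}'(\Sigma),d^{-1}J_{\max},\|A\|/\bar\Lambda,\bar\Lambda/\mu_*,\delta_0$. $\delta_*:=\delta_0/\sqrt{\lambda_{\max}(\Sigma)}$; $\theta_1:=d^{-1}\min\{1/(3d^{-1}J^\Sigma_{\max}\delta_* ),1/(64L_0\rho(\sigma^2)\rho(\Sigma)),1/(4(d^{-1}J^\Sigma_{\max})^2)\}$;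 $\psi(m):=4\sqrt{\log m/((d\theta_1)m^{3/4})}$, $\psi^{-1}(\eta):=\min\{m\ge4:\psi(m)\le\eta\}$. *)

theory Defs
  imports "HOL-Analysis.Analysis"
begin

text \<open>Vectors of R^d / Z^d are functions on nat, vanishing at indices \<ge> d;
 d x d matrices are functions nat \<Rightarrow> nat \<Rightarrow> real vanishing outside {..<d}^2.
 This lets the dimension d be quantified inside the statement.\<close>

definition Rd :: "nat \<Rightarrow> (nat \<Rightarrow> real) set" where
  "Rd d = {x. \<forall>i\<ge>d. x i = 0}"

definition Zd :: "nat \<Rightarrow> (nat \<Rightarrow> int) set" where
  "Zd d = {x. \<forall>i\<ge>d. x i = 0}"

definition Md :: "nat \<Rightarrow> (nat \<Rightarrow> nat \<Rightarrow> real) set" where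
  "Md d = {M. \<forall>i k. (d \<le> i \<or> d \<le> k) \<longrightarrow> M i k = 0}"

definition unitv :: "nat \<Rightarrow> nat \<Rightarrow> 'a::zero_neq_one" where
  "unitv j = (\<lambda>i. if i = j then 1 else 0)"

definition rv :: "(nat \<Rightarrow> int) \<Rightarrow> nat \<Rightarrow> real" where
  "rv X = (\<lambda>i. real_of_int (X i))"

definition vnorm :: "nat \<Rightarrow> (nat \<Rightarrow> real) \<Rightarrow> real" where
  "vnorm d x = sqrt (\<Sum>i<d. (x i)\<^sup>2)"

definition mv :: "nat \<Rightarrow> (nat \<Rightarrow> nat \<Rightarrow> real) \<Rightarrow> (nat \<Rightarrow> real) \<Rightarrow> nat \<Rightarrow> real" where
  "mv d M x = (\<lambda>i. if i < d then (\<Sum>k<d. M i k * x k) else 0)"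

definition mmul :: "nat \<Rightarrow> (nat \<Rightarrow> nat \<Rightarrow> real) \<Rightarrow> (nat \<Rightarrow> nat \<Rightarrow> real) \<Rightarrow> nat \<Rightarrow> nat \<Rightarrow> real" where
  "mmul d M N = (\<lambda>i k. if i < d \<and> k < d then (\<Sum>l<d. M i l * N l k) else 0)"

definition mtr :: "(nat \<Rightarrow> nat \<Rightarrow> real) \<Rightarrow> nat \<Rightarrow> nat \<Rightarrow> real" where
  "mtr M = (\<lambda>i k. M k i)"

definition idm :: "nat \<Rightarrow> nat \<Rightarrow> nat \<Rightarrow> real" where
  "idm d = (\<lambda>i k. if i < d \<and> i = k then 1 else 0)"

definition msym :: "nat \<Rightarrow> (nat \<Rightarrow> nat \<Rightarrow> real) \<Rightarrow> bool" where
  "msym d M \<longleftrightarrow> (\<forall>i<d. \<forall>k<d. M i k = M k i)"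

definition qform :: "nat \<Rightarrow> (nat \<Rightarrow> nat \<Rightarrow> real) \<Rightarrow> (nat \<Rightarrow> real) \<Rightarrow> real" where
  "qform d M x = (\<Sum>i<d. \<Sum>k<d. x i * M i k * x k)"

definition posdef :: "nat \<Rightarrow> (nat \<Rightarrow> nat \<Rightarrow> real) \<Rightarrow> bool" where
  "posdef d M \<longleftrightarrow> msym d M \<and> (\<forall>x\<in>Rd d. (\<exists>i<d. x i \<noteq> 0) \<longrightarrow> qform d M x > 0)"

definition minv :: "nat \<Rightarrow> (nat \<Rightarrow> nat \<Rightarrow> real) \<Rightarrow> nat \<Rightarrow> nat \<Rightarrow> real" where
  "minv d M = (THE N. N \<in> Md d \<and> mmul d M N = idm d)"

definition msqrt :: "nat \<Rightarrow> (nat \<Rightarrow> nat \<Rightarrow> real) \<Rightarrow> nat \<Rightarrow> nat \<Rightarrow> real" where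
  "msqrt d M = (THE S. S \<in> Md d \<and> posdef d S \<and> mmul d S S = M)"

definition mscale :: "real \<Rightarrow> (nat \<Rightarrow> nat \<Rightarrow> real) \<Rightarrow> nat \<Rightarrow> nat \<Rightarrow> real" where
  "mscale a M = (\<lambda>i k. a * M i k)"

text \<open>real eigenvalues (all eigenvalues, for symmetric matrices)\<close>
definition reigs :: "nat \<Rightarrow> (nat \<Rightarrow> nat \<Rightarrow> real) \<Rightarrow> real set" where
  "reigs d M = {l. \<exists>x\<in>Rd d. (\<exists>i<d. x i \<noteq> 0) \<and> mv d M x = (\<lambda>i. l * x i)}"

definition ceigs :: "nat \<Rightarrow> (nat \<Rightarrow> nat \<Rightarrow> real) \<Rightarrow> complex set" where
  "ceigs d M = {l. \<exists>v::nat \<Rightarrow> complex. (\<exists>i<d. v i \<noteq> 0) \<and>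
       (\<forall>i<d. (\<Sum>k<d. complex_of_real (M i k) * v k) = l * v i)}"

definition lmin :: "nat \<Rightarrow> (nat \<Rightarrow> nat \<Rightarrow> real) \<Rightarrow> real" where
  "lmin d M = Min (reigs d M)"

definition lmax :: "nat \<Rightarrow> (nat \<Rightarrow> nat \<Rightarrow> real) \<Rightarrow> real" where
  "lmax d M = Max (reigs d M)"

definition rho :: "nat \<Rightarrow> (nat \<Rightarrow> nat \<Rightarrow> real) \<Rightarrow> real" where
  "rho d M = lmax d M / lmin d M"

definition mtrace :: "nat \<Rightarrow> (nat \<Rightarrow> nat \<Rightarrow> real) \<Rightarrow> real" where
  "mtrace d M = (\<Sum>i<d. M i i)"

definition lbar :: "nat \<Rightarrow> (nat \<Rightarrow> nat \<Rightarrow> real) \<Rightarrow> real" where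
  "lbar d M = mtrace d M / real d"

definition opnorm :: "nat \<Rightarrow> (nat \<Rightarrow> nat \<Rightarrow> real) \<Rightarrow> real" where
  "opnorm d M = Sup {vnorm d (mv d M x) | x. x \<in> Rd d \<and> vnorm d x \<le> 1}"

definition pderiv_at :: "((nat \<Rightarrow> real) \<Rightarrow> real) \<Rightarrow> (nat \<Rightarrow> real) \<Rightarrow> nat \<Rightarrow> real" where
  "pderiv_at f \<xi> k = deriv (\<lambda>t. f (\<lambda>i. \<xi> i + t * unitv k i)) 0"

definition grad :: "nat \<Rightarrow> ((nat \<Rightarrow> real) \<Rightarrow> real) \<Rightarrow> (nat \<Rightarrow> real) \<Rightarrow> nat \<Rightarrow> real" where
  "grad d f \<xi> = (\<lambda>k. if k < d then pderiv_at f \<xi> k else 0)"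

definition hess :: "nat \<Rightarrow> ((nat \<Rightarrow> real) \<Rightarrow> real) \<Rightarrow> (nat \<Rightarrow> real) \<Rightarrow> nat \<Rightarrow> nat \<Rightarrow> real" where
  "hess d f \<xi> = (\<lambda>i k. if i < d \<and> k < d then pderiv_at (\<lambda>\<eta>. pderiv_at f \<eta> k) \<xi> i else 0)"

definition cballd :: "nat \<Rightarrow> (nat \<Rightarrow> real) \<Rightarrow> real \<Rightarrow> (nat \<Rightarrow> real) set" where
  "cballd d c r = {\<xi> \<in> Rd d. vnorm d (\<lambda>i. \<xi> i - c i) \<le> r}"

definition oballd :: "nat \<Rightarrow> (nat \<Rightarrow> real) \<Rightarrow> real \<Rightarrow> (nat \<Rightarrow> real) set" where
  "oballd d c r = {\<xi> \<in> Rd d. vnorm d (\<lambda>i. \<xi> i - c i) < r}"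

definition driftF :: "nat \<Rightarrow> (nat \<Rightarrow> int) set \<Rightarrow> ((nat \<Rightarrow> int) \<Rightarrow> (nat \<Rightarrow> real) \<Rightarrow> real)
    \<Rightarrow> (nat \<Rightarrow> real) \<Rightarrow> nat \<Rightarrow> real" where
  "driftF d Jset g \<xi> = (\<lambda>i. if i < d then (\<Sum>J\<in>Jset. real_of_int (J i) * g J \<xi>) else 0)"

definition Amat :: "nat \<Rightarrow> (nat \<Rightarrow> int) set \<Rightarrow> ((nat \<Rightarrow> int) \<Rightarrow> (nat \<Rightarrow> real) \<Rightarrow> real)
    \<Rightarrow> (nat \<Rightarrow> real) \<Rightarrow> nat \<Rightarrow> nat \<Rightarrow> real" where
  "Amat d Jset g c = (\<lambda>i k. if i < d \<and> k < d then pderiv_at (\<lambda>\<xi>. driftF d Jset g \<xi> i) c k else 0)"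

definition sigma2 :: "nat \<Rightarrow> (nat \<Rightarrow> int) set \<Rightarrow> ((nat \<Rightarrow> int) \<Rightarrow> (nat \<Rightarrow> real) \<Rightarrow> real)
    \<Rightarrow> (nat \<Rightarrow> real) \<Rightarrow> nat \<Rightarrow> nat \<Rightarrow> real" where
  "sigma2 d Jset g c = (\<lambda>i k. if i < d \<and> k < d then
      (\<Sum>J\<in>Jset. real_of_int (J i) * real_of_int (J k) * g J c) else 0)"

definition affine_on_set :: "((nat \<Rightarrow> real) \<Rightarrow> real) \<Rightarrow> nat \<Rightarrow> (nat \<Rightarrow> real) set \<Rightarrow> bool" where
  "affine_on_set f d S \<longleftrightarrow> (\<exists>a b. \<forall>\<xi>\<in>S. f \<xi> = (\<Sum>i<d. a i * \<xi> i) + b)"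

text \<open>(G0),(G1),(S2)--(S4), plus the standing facts used implicitly in the definitions
 of L_0, L_1, L_2, mu_*: d \<ge> 1, g^J \<ge> 0 and g^J(c) > 0.\<close>
definition elementary :: "nat \<Rightarrow> (nat \<Rightarrow> int) set \<Rightarrow> ((nat \<Rightarrow> int) \<Rightarrow> (nat \<Rightarrow> real) \<Rightarrow> real)
    \<Rightarrow> (nat \<Rightarrow> real) \<Rightarrow> real \<Rightarrow> bool" where
  "elementary d Jset g c \<delta>0 \<longleftrightarrow>
     1 \<le> d \<and> finite Jset \<and> Jset \<subseteq> Zd d \<and> c \<in> Rd d \<and> \<delta>0 > 0 \<and>
     (\<forall>J\<in>Jset. \<forall>\<xi>\<in>Rd d. g J \<xi> \<ge> 0) \<and> (\<forall>J\<in>Jset. g J c > 0) \<and>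
     driftF d Jset g c = (\<lambda>i. 0) \<and>
     (\<forall>l\<in>ceigs d (Amat d Jset g c). Re l < 0) \<and>
     (\<forall>j<d. unitv j \<in> Jset \<and> (\<lambda>i. - unitv j i) \<in> Jset) \<and>
     (\<forall>J\<in>Jset. J \<notin> unitv ` {..<d} \<longrightarrow> (\<forall>\<xi>\<in>cballd d c \<delta>0. g J \<xi> = g J c)) \<and>
     (\<forall>j<d. affine_on_set (g (unitv j)) d (cballd d c \<delta>0) \<and>
        (\<forall>\<xi>\<in>cballd d c \<delta>0. g (unitv j) \<xi> \<ge> g (unitv j) c / 2))"

definition lyap_sol :: "nat \<Rightarrow> (nat \<Rightarrow> int) set \<Rightarrow> ((nat \<Rightarrow> int) \<Rightarrow> (nat \<Rightarrow> real) \<Rightarrow> real)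
    \<Rightarrow> (nat \<Rightarrow> real) \<Rightarrow> (nat \<Rightarrow> nat \<Rightarrow> real) \<Rightarrow> bool" where
  "lyap_sol d Jset g c Sig \<longleftrightarrow> Sig \<in> Md d \<and> posdef d Sig \<and>
     (\<forall>i<d. \<forall>k<d. mmul d (Amat d Jset g c) Sig i k + mmul d Sig (mtr (Amat d Jset g c)) i k
         + sigma2 d Jset g c i k = 0)"

definition snorm :: "nat \<Rightarrow> (nat \<Rightarrow> nat \<Rightarrow> real) \<Rightarrow> (nat \<Rightarrow> real) \<Rightarrow> real" where
  "snorm d Sig Y = sqrt (qform d (minv d Sig) Y)"

definition eps0 :: real where "eps0 = 1/2"

definition L0 where
  "L0 d Jset g c \<delta>0 = (MAX J\<in>Jset. (SUP \<xi>\<in>cballd d c \<delta>0. g J \<xi>) / g J c)"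

definition L1 where
  "L1 d Jset g c \<delta>0 = (MAX J\<in>Jset. (SUP \<xi>\<in>oballd d c \<delta>0. vnorm d (grad d (g J) \<xi>)) / g J c)"

definition L2 where
  "L2 d Jset g c \<delta>0 = (MAX J\<in>Jset. (SUP \<xi>\<in>oballd d c \<delta>0. opnorm d (hess d (g J) \<xi>)) / g J c)"

definition Lambar where
  "Lambar d Jset g c = lbar d (sigma2 d Jset g c)"

definition Jmax :: "nat \<Rightarrow> (nat \<Rightarrow> int) set \<Rightarrow> real" where
  "Jmax d Jset = (MAX J\<in>Jset. vnorm d (rv J))"

definition JSmax :: "nat \<Rightarrow> (nat \<Rightarrow> int) set \<Rightarrow> (nat \<Rightarrow> nat \<Rightarrow> real) \<Rightarrow> real" where
  "JSmax d Jset Sig = (MAX J\<in>Jset. vnorm d (mv d (minv d (msqrt d Sig)) (rv J)))"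

definition alpha1 where
  "alpha1 d Jset g c Sig = lmin d (mmul d (mmul d (minv d (msqrt d Sig)) (sigma2 d Jset g c))
                                       (minv d (msqrt d Sig))) / 2"

definition mustar where
  "mustar Jset g c = (MIN J\<in>Jset. eps0 * g J c)"

definition Spp :: "nat \<Rightarrow> (nat \<Rightarrow> nat \<Rightarrow> real) \<Rightarrow> real list" where
  "Spp d M = [lbar d M, lmin d M, lmax d M]"

text \<open>The 14 real parameters on which members of the class K depend:
 L0, L1, L2, eps0, Sp'(sigma^2/Lambar), Sp'(Sigma), Jmax/d, ||A||/Lambar, Lambar/mu_*, delta0.\<close>
definition params :: "nat \<Rightarrow> (nat \<Rightarrow> int) set \<Rightarrow> ((nat \<Rightarrow> int) \<Rightarrow> (nat \<Rightarrow> real) \<Rightarrow> real)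
    \<Rightarrow> (nat \<Rightarrow> real) \<Rightarrow> real \<Rightarrow> (nat \<Rightarrow> nat \<Rightarrow> real) \<Rightarrow> real ^ 14" where
  "params d Jset g c \<delta>0 Sig = vector
     ([L0 d Jset g c \<delta>0, L1 d Jset g c \<delta>0, L2 d Jset g c \<delta>0, eps0]
      @ Spp d (mscale (1 / Lambar d Jset g c) (sigma2 d Jset g c))
      @ Spp d Sig
      @ [Jmax d Jset / real d, opnorm d (Amat d Jset g c) / Lambar d Jset g c,
         Lambar d Jset g c / mustar Jset g c, \<delta>0])"

text \<open>Natural domain of these parameters: L1, L2 \<ge> 0, all others > 0.\<close>
definition param_dom :: "(real ^ 14) set" where
  "param_dom = vector ` {l. length l = 14 \<and> (\<forall>k<14. 0 \<le> l ! k) \<and>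
                            (\<forall>k<14. k \<noteq> 1 \<and> k \<noteq> 2 \<longrightarrow> 0 < l ! k)}"

definition in_K :: "(real ^ 14 \<Rightarrow> real) \<Rightarrow> bool" where
  "in_K f \<longleftrightarrow> continuous_on param_dom f"

definition deltastar where
  "deltastar d Sig \<delta>0 = \<delta>0 / sqrt (lmax d Sig)"

definition theta1 where
  "theta1 d Jset g c \<delta>0 Sig = (1 / real d) * min (1 / (3 * (JSmax d Jset Sig / real d) * deltastar d Sig \<delta>0))
     (min (1 / (64 * L0 d Jset g c \<delta>0 * rho d (sigma2 d Jset g c) * rho d Sig))
          (1 / (4 * (JSmax d Jset Sig / real d)\<^sup>2)))"

definition psi where
  "psi d Jset g c \<delta>0 Sig (m::nat) = 4 * sqrt (ln (real m) / ((real d * theta1 d Jset g c \<delta>0 Sig) * real m powr (3/4)))"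

definition psi_inv where
  "psi_inv d Jset g c \<delta>0 Sig \<eta> = (LEAST m::nat. 4 \<le> m \<and> psi d Jset g c \<delta>0 Sig m \<le> \<eta>)"

definition Bt where
  "Bt d c Sig (n::nat) \<delta> = {X \<in> Zd d. snorm d Sig (\<lambda>i. rv X i - real n * c i) \<le> real n * \<delta>}"

definition qrate where
  "qrate d Jset g c Sig n \<delta> X Y =
     (if X \<in> Bt d c Sig n \<delta> \<and> Y \<in> Bt d c Sig n \<delta> \<and> X \<noteq> Y
      then (\<Sum>J\<in>{J\<in>Jset. (\<lambda>i. X i + J i) = Y}. real n * g J (\<lambda>i. rv X i / real n)) else 0)"

definition genQ :: "'s set \<Rightarrow> ('s \<Rightarrow> 's \<Rightarrow> real) \<Rightarrow> 's \<Rightarrow> 's \<Rightarrow> real" where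
  "genQ S q X Y = (if X = Y then - (\<Sum>Z\<in>S - {X}. q X Z) else q X Y)"

fun Qpow :: "'s set \<Rightarrow> ('s \<Rightarrow> 's \<Rightarrow> real) \<Rightarrow> nat \<Rightarrow> 's \<Rightarrow> 's \<Rightarrow> real" where
  "Qpow S q 0 X Y = (if X = Y then 1 else 0)"
| "Qpow S q (Suc k) X Y = (\<Sum>Z\<in>S. (if X \<in> S then genQ S q X Z else 0) * Qpow S q k Z Y)"

text \<open>transition probabilities P_t(X,Y) = exp(tQ)(X,Y); states outside S are absorbing\<close>
definition transP :: "'s set \<Rightarrow> ('s \<Rightarrow> 's \<Rightarrow> real) \<Rightarrow> real \<Rightarrow> 's \<Rightarrow> 's \<Rightarrow> real" where
  "transP S q t X Y = (\<Sum>k. t ^ k / fact k * Qpow S q k X Y)"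

definition equil :: "'s set \<Rightarrow> ('s \<Rightarrow> 's \<Rightarrow> real) \<Rightarrow> 's \<Rightarrow> real" where
  "equil S q = (THE \<pi>. (\<forall>X. X \<notin> S \<longrightarrow> \<pi> X = 0) \<and> (\<forall>X\<in>S. \<pi> X \<ge> 0) \<and> (\<Sum>X\<in>S. \<pi> X) = 1 \<and>
                        (\<forall>Y\<in>S. (\<Sum>X\<in>S. \<pi> X * genQ S q X Y) = 0))"

definition PiB where
  "PiB d Jset g c Sig n \<delta> B =
     (\<Sum>Y\<in>B \<inter> Bt d c Sig n \<delta>. equil (Bt d c Sig n \<delta>) (qrate d Jset g c Sig n \<delta>) Y)"

definition probB where
  "probB d Jset g c Sig n \<delta> B t X =
     (\<Sum>Y\<in>B \<inter> insert X (Bt d c Sig n \<delta>). transP (Bt d c Sig n \<delta>) (qrate d Jset g c Sig n \<delta>) t X Y)"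

definition hB where
  "hB d Jset g c Sig n \<delta> B X =
     - integral {0..} (\<lambda>t. probB d Jset g c Sig n \<delta> B t X - PiB d Jset g c Sig n \<delta> B)"

definition Dj :: "nat \<Rightarrow> ((nat \<Rightarrow> int) \<Rightarrow> real) \<Rightarrow> (nat \<Rightarrow> int) \<Rightarrow> real" where
  "Dj j h X = h (\<lambda>i. X i + unitv j i) - h X"

end

theory Submission
  imports Defs "HOL-Real_Asymp.Real_Asymp"
begin

text \<open>Write \<open>P\<^sub>t\<close> for the semigroup of the restricted chain and \<open>u = P\<^sub>t f\<close> with \<open>\<bar>f\<bar> \<le> 1\<close>. On the ball all
  rates are affine, so the lattice gradient \<open>\<nabla>u\<close> solves the backward equation with the additional
  linear term \<open>A\<^sup>T\<nabla>u\<close>, up to an error controlled by second differences. The Lyapunov equation for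
  \<open>\<Sigma>\<close> makes \<open>\<nabla>u\<^sup>T \<Sigma> \<nabla>u\<close> a subsolution decaying at rate \<open>\<alpha>\<^sub>1\<close>, and Bernstein's trick (the combination
  \<open>u\<^sup>2 + c\<^sub>1 t \<nabla>u\<^sup>T \<Sigma> \<nabla>u + c\<^sub>2 t\<^sup>2 \<bar>\<nabla>\<^sup>2u\<bar>\<^sup>2\<close> is a subsolution for short times) gives first and second differences
  of orders \<open>(n t)\<^sup>-\<^sup>1\<^sup>/\<^sup>2\<close> and \<open>(n t)\<^sup>-\<^sup>1\<close>. Both hold only away from the boundary of the ball; the maximum
  principle with the barrier \<open>exp (\<theta>\<^sub>1 \<bar>X - nc\<bar>\<^sub>\<Sigma>\<^sup>2 / n)\<close>, which the condition on \<open>\<psi>\<^sup>-\<^sup>1\<close> makes larger at the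
  boundary than near the centre by a factor \<open>n\<^sup>1\<^sup>2\<close>, localises them. The gradient decay, summed along
  lattice paths, and the inward drift show that \<open>P\<^sub>T\<close> halves oscillations for \<open>T = 6 log n / \<alpha>\<^sub>1\<close>; hence \<open>h\<close> is
  bounded by \<open>3 T\<close>. For the differences of \<open>h\<close>, the smoothing estimates are integrated up to a fixed
  time \<open>T\<^sub>0\<close> of order \<open>1 / \<alpha>\<^sub>1\<close> and the semigroup property is used after it.\<close>

section \<open>Spectral theory of symmetric matrices\<close>

text \<open>Near the boundary jumps are suppressed and differences no longer commute with the
  generator up to a linear term, so only trivial bounds hold there. Each interior estimate must
  therefore survive an error equal to such a bound times the barrier ratio. That ratio starts at
  \<open>n^-12\<close>; the growth of the barrier up to time \<open>5 log n / \<alpha>\<close> costs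
  two powers, and \<open>n^-10\<close> still beats the weight \<open>n^5\<close> of the gradient
  decay and the polynomial bounds for short times. The mixing time \<open>6 log n / \<alpha>\<close>
  is a sum \<open>1 + 5\<close>: one part lets the drift bring the process close to the centre, five
  make the squared gradient of order \<open>n^-5\<close>, small enough to be summed along paths of
  order \<open>d n\<close> steps. Smoothing is used from time \<open>T0 / n\<close> on; before it
  trivial bounds suffice. For first differences the integral of \<open>t^(-1/2)\<close> is harmless
  and the logarithm comes from the mixing after \<open>T0\<close>; for second differences the
  integral of \<open>1/t\<close> gives a logarithm as well. The constants depend on the parameters
  alone because all rates are measured in units of \<open>\<alpha>\<close>, and the factor
  \<open>1/d\<close> in \<open>theta1\<close> cancels the dimension in the trace of the
  noise.\<close>

definition ip :: "nat \<Rightarrow> (nat \<Rightarrow> real) \<Rightarrow> (nat \<Rightarrow> real) \<Rightarrow> real" where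
  "ip d x y = (\<Sum>i<d. x i * y i)"

lemma ip_commute: "ip d x y = ip d y x"
  unfolding ip_def by (simp add: mult.commute)

lemma ip_self_nonneg: "0 \<le> ip d x x"
  unfolding ip_def by (intro sum_nonneg) simp

lemma ip_add_right: "ip d x (\<lambda>i. y i + z i) = ip d x y + ip d x z"
  unfolding ip_def by (simp add: algebra_simps sum.distrib)

lemma ip_diff_right: "ip d x (\<lambda>i. y i - z i) = ip d x y - ip d x z"
  unfolding ip_def by (simp add: algebra_simps sum_subtractf)

lemma ip_scale_right: "ip d x (\<lambda>i. a * y i) = a * ip d x y"
  unfolding ip_def by (simp add: sum_distrib_left mult_ac)

lemma ip_scale_left: "ip d (\<lambda>i. a * x i) y = a * ip d x y"
  unfolding ip_def by (simp add: sum_distrib_left mult_ac)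

lemma ip_sum_right: "ip d x (\<lambda>i. \<Sum>k\<in>K. c k * w k i) = (\<Sum>k\<in>K. c k * ip d x (w k))"
  unfolding ip_def by (subst sum_distrib_left)
     (auto simp: sum_distrib_left mult_ac intro!: sum.swap[THEN trans] sum.cong)

lemma ip_eq_0_iff: "ip d x x = 0 \<longleftrightarrow> (\<forall>i<d. x i = 0)"
  unfolding ip_def by (subst sum_nonneg_eq_0_iff) auto

lemma vnorm_ip: "vnorm d x = sqrt (ip d x x)"
  unfolding vnorm_def ip_def by (simp add: power2_eq_square)

lemma ip_unitv: "j < d \<Longrightarrow> ip d x (unitv j) = x j"
  unfolding ip_def unitv_def by (simp add: if_distrib[of "\<lambda>z. _ * z"] cong: if_cong)

lemma mv_unitv: "i < d \<Longrightarrow> j < d \<Longrightarrow> mv d M (unitv j) i = M i j"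
  unfolding mv_def unitv_def by (simp add: if_distrib[of "\<lambda>z. _ * z"] cong: if_cong)

lemma ip_mv: "ip d x (mv d M y) = (\<Sum>i<d. \<Sum>k<d. x i * M i k * y k)"
  unfolding ip_def mv_def by (simp add: sum_distrib_left mult_ac)

lemma qform_ip: "qform d M x = ip d x (mv d M x)"
  unfolding ip_mv qform_def ..

lemma ip_mv_sym: "msym d M \<Longrightarrow> ip d x (mv d M y) = ip d y (mv d M x)"
  unfolding ip_mv msym_def
  by (subst sum.swap) (auto intro!: sum.cong simp: mult_ac)

lemma ip_cauchy: "(ip d x y)\<^sup>2 \<le> ip d x x * ip d y y"
  using Cauchy_Schwarz_ineq_sum[of x y "{..<d}"] unfolding ip_def by (simp add: power2_eq_square)

text \<open>Project the unit vectors off the span of \<open>w\<close>: the squared lengths of the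
  residuals \<open>r j\<close> add up to \<open>d - k > 0\<close>, so some residual is nonzero and
  can be normalised.\<close>

lemma exists_orthogonal_unit:
  assumes "k < d" "\<And>i. i < k \<Longrightarrow> w i \<in> Rd d"
    and on: "\<And>i j. i < k \<Longrightarrow> j < k \<Longrightarrow> ip d (w i) (w j) = (if i = j then 1 else 0)"
  shows "\<exists>x\<in>Rd d. ip d x x = 1 \<and> (\<forall>i<k. ip d (w i) x = 0)"
proof -
  define r where "r j = (\<lambda>i. unitv j i - (\<Sum>l<k. w l j * w l i))" for j
  note u = ip_unitv
  have orth: "ip d (w m) (r j) = 0" if "m < k" "j < d" for m j
  proof -
    have "ip d (w m) (r j) = w m j - (\<Sum>l<k. w l j * ip d (w m) (w l))"
      unfolding r_def by (simp add: ip_diff_right ip_sum_right u that)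
    also have "\<dots> = w m j - (\<Sum>l<k. if l = m then w l j else 0)"
      using on that by (intro arg_cong2[where f="(-)"] sum.cong) auto
    finally show ?thesis using that by simp
  qed
  have rr: "ip d (r j) (r j) = 1 - (\<Sum>l<k. w l j * w l j)" if "j < d" for j
  proof -
    have "ip d (r j) (r j) = ip d (r j) (unitv j) - (\<Sum>l<k. w l j * ip d (r j) (w l))"
      unfolding r_def by (simp add: ip_diff_right ip_sum_right)
    also have "(\<Sum>l<k. w l j * ip d (r j) (w l)) = 0"
      using orth that by (intro sum.neutral) (auto simp: ip_commute)
    finally show ?thesis unfolding u[OF that] by (simp add: r_def unitv_def)
  qed
  have "(\<Sum>j<d. ip d (r j) (r j)) = real d - (\<Sum>l<k. ip d (w l) (w l))"
    by (simp add: rr sum_subtractf) (subst sum.swap, simp add: ip_def)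
  also have "\<dots> = real d - real k" using on by simp
  also have "\<dots> > 0" using assms(1) by simp
  finally obtain j where j: "j < d" "ip d (r j) (r j) > 0"
    by (meson lessThan_iff not_less sum_nonpos)
  define s where "s = sqrt (ip d (r j) (r j))"
  have s: "s > 0" "s * s = ip d (r j) (r j)" using j by (auto simp: s_def)
  have "r j \<in> Rd d" using assms(2) j unfolding r_def Rd_def unitv_def by auto
  then have 1: "(\<lambda>i. (1/s) * r j i) \<in> Rd d" unfolding Rd_def by auto
  have 2: "ip d (\<lambda>i. (1/s) * r j i) (\<lambda>i. (1/s) * r j i) = 1"
    unfolding ip_scale_left ip_scale_right s(2)[symmetric] using s(1) by simp
  have 3: "\<forall>i<k. ip d (w i) (\<lambda>i. (1/s) * r j i) = 0"
    unfolding ip_scale_right using orth j by simp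
  show ?thesis using 1 2 3 by blast
qed

text \<open>Vectors are functions on all of \<open>nat\<close>, so compactness comes from Tychonoff:
  the sphere is a closed subset of a product of intervals, with singletons from index
  \<open>d\<close> on.\<close>

lemma compact_unit_sphere: "compact {x \<in> Rd d. ip d x x = 1}"
proof -
  define C where "C i = (if i < d then {-1..1::real} else {0})" for i :: nat
  have "compactin (product_topology (\<lambda>i::nat. euclideanreal) UNIV) (PiE UNIV C)"
    by (subst compactin_PiE) (auto simp: C_def)
  then have c: "compact (PiE UNIV C)"
    by (simp add: euclidean_product_topology)
  have cl: "closed {x. ip d x x = 1}"
    unfolding ip_def by (intro closed_Collect_eq continuous_intros continuous_on_product_coordinates)
  have "x i \<in> {-1..1}" if "ip d x x = 1" "i < d" for x i
  proof -
    have "x i * x i \<le> ip d x x" unfolding ip_def using that by (intro member_le_sum) auto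
    then have "(x i)\<^sup>2 \<le> 1" using that by (simp add: power2_eq_square)
    then show ?thesis by (simp add: abs_square_le_1 abs_le_iff)
  qed
  then have "{x \<in> Rd d. ip d x x = 1} \<subseteq> PiE UNIV C"
    unfolding C_def Rd_def by (auto simp: PiE_def)
  moreover have "PiE UNIV C \<inter> {x. ip d x x = 1} \<subseteq> {x \<in> Rd d. ip d x x = 1}"
  proof
    fix x assume x: "x \<in> PiE UNIV C \<inter> {x. ip d x x = 1}"
    have "x i = 0" if "i \<ge> d" for i
    proof -
      have "x i \<in> C i" using x by (auto simp: PiE_def)
      then show ?thesis using that by (simp add: C_def)
    qed
    then show "x \<in> {x \<in> Rd d. ip d x x = 1}" using x by (simp add: Rd_def)
  qed
  ultimately have "{x \<in> Rd d. ip d x x = 1} = PiE UNIV C \<inter> {x. ip d x x = 1}" by blast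
  then show ?thesis using c cl compact_Int_closed by metis
qed

text \<open>Minimise the quadratic form on the unit sphere orthogonal to the vectors found so far.
  The residual \<open>g\<close> at a minimiser \<open>x\<close> is orthogonal to these vectors and
  to \<open>x\<close>, so \<open>x + t g\<close> can be compared with \<open>x\<close> for every
  \<open>t\<close>; the first-order term \<open>2 t |g|^2\<close> then forces
  \<open>g = 0\<close>.\<close>

lemma exists_next_eigenvector:
  assumes sym: "msym d M" and kd: "k < d" and w: "\<And>i. i < k \<Longrightarrow> w i \<in> Rd d"
    and on: "\<And>i j. i < k \<Longrightarrow> j < k \<Longrightarrow> ip d (w i) (w j) = (if i = j then 1 else 0)"
    and eig: "\<And>i. i < k \<Longrightarrow> mv d M (w i) = (\<lambda>m. l i * w i m)"
  shows "\<exists>x\<in>Rd d. \<exists>\<mu>. ip d x x = 1 \<and> (\<forall>i<k. ip d (w i) x = 0) \<and> mv d M x = (\<lambda>m. \<mu> * x m)"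
proof -
  define C where "C = {x \<in> Rd d. ip d x x = 1} \<inter> (\<Inter>i<k. {x. ip d (w i) x = 0})"
  have "compact C" unfolding C_def
    by (intro compact_Int_closed compact_unit_sphere closed_INT ballI)
       (simp add: ip_def, intro closed_Collect_eq continuous_intros continuous_on_product_coordinates)
  moreover have "C \<noteq> {}" using exists_orthogonal_unit[OF kd w on] unfolding C_def by auto
  moreover have "continuous_on C (qform d M)"
    unfolding qform_def
    by (rule continuous_on_subset[where s=UNIV]) (intro continuous_intros continuous_on_product_coordinates, simp)
  ultimately obtain x where x: "x \<in> C" and mn: "\<And>y. y \<in> C \<Longrightarrow> qform d M x \<le> qform d M y"
    using continuous_attains_inf by metis
  define lam where "lam = qform d M x"
  have x1: "x \<in> Rd d" "ip d x x = 1" "\<And>i. i < k \<Longrightarrow> ip d (w i) x = 0"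
    using x by (auto simp: C_def)
  have ray: "lam * ip d y y \<le> qform d M y" if y: "y \<in> Rd d" "\<And>i. i < k \<Longrightarrow> ip d (w i) y = 0" for y
  proof (cases "ip d y y = 0")
    case True
    then have "\<forall>i<d. y i = 0" by (simp add: ip_eq_0_iff)
    then show ?thesis using True by (simp add: qform_def)
  next
    case False
    define s where "s = sqrt (ip d y y)"
    have s: "s > 0" "s * s = ip d y y" using False ip_self_nonneg[of d y] by (auto simp: s_def less_le)
    have "(\<lambda>i. (1/s) * y i) \<in> C"
    proof -
      have "ip d (\<lambda>i. (1/s) * y i) (\<lambda>i. (1/s) * y i) = 1"
        unfolding ip_scale_left ip_scale_right s(2)[symmetric] using s(1) by simp
      moreover have "\<forall>i<k. ip d (w i) (\<lambda>i. (1/s) * y i) = 0"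
        unfolding ip_scale_right using y by simp
      moreover have "(\<lambda>i. (1/s) * y i) \<in> Rd d" using y unfolding Rd_def by simp
      ultimately show ?thesis unfolding C_def by blast
    qed
    then have "lam \<le> qform d M (\<lambda>i. (1/s) * y i)" using mn lam_def by simp
    also have "\<dots> = (1/s) * (1/s) * qform d M y"
      unfolding qform_def sum_distrib_left by (intro sum.cong) auto
    finally have "lam * (s * s) \<le> qform d M y" using s(1) by (simp add: field_simps)
    then show ?thesis using s by simp
  qed
  define g where "g = (\<lambda>i. mv d M x i - lam * x i)"
  have gR: "g \<in> Rd d" using x1 unfolding g_def Rd_def mv_def by auto
  have gw: "ip d (w i) g = 0" if "i < k" for i
  proof -
    have "ip d (w i) (mv d M x) = ip d x (\<lambda>m. l i * w i m)"
      using ip_mv_sym[OF sym] eig that by metis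
    then show ?thesis
      unfolding g_def ip_diff_right ip_scale_right using x1(3)[OF that] by (simp add: ip_commute)
  qed
  have gx: "ip d g x = 0"
    unfolding g_def using x1(2) by (subst ip_commute) (simp add: ip_diff_right ip_scale_right lam_def qform_ip)
  define q where "q = qform d M g - lam * ip d g g"
  have key: "0 \<le> 2 * t * ip d g g + t\<^sup>2 * q" for t
  proof -
    define y where "y = (\<lambda>i. x i + t * g i)"
    have "y \<in> Rd d" using x1 gR by (auto simp: y_def Rd_def)
    moreover have "ip d (w i) y = 0" if "i < k" for i
      unfolding y_def ip_add_right ip_scale_right using gw x1 that by simp
    ultimately have "lam * ip d y y \<le> qform d M y" by (rule ray)
    moreover have "ip d y y = 1 + t\<^sup>2 * ip d g g"
    proof -
      have "ip d y y = ip d x x + 2 * t * ip d g x + t\<^sup>2 * ip d g g"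
        unfolding y_def ip_def sum_distrib_left sum.distrib[symmetric]
        by (intro sum.cong) (auto simp: algebra_simps power2_eq_square)
      then show ?thesis using x1 gx by simp
    qed
    moreover have "qform d M y = lam + 2 * t * ip d g (mv d M x) + t\<^sup>2 * qform d M g"
    proof -
      have "mv d M y = (\<lambda>i. mv d M x i + t * mv d M g i)"
        unfolding mv_def y_def by (auto simp: algebra_simps sum.distrib sum_distrib_left)
      then have "qform d M y = ip d y (mv d M x) + t * ip d y (mv d M g)"
        by (simp add: qform_ip ip_add_right ip_scale_right)
      also have "ip d y (mv d M x) = lam + t * ip d g (mv d M x)"
        unfolding y_def by (subst (1 2) ip_commute) (simp add: ip_add_right ip_scale_right lam_def qform_ip ip_commute)
      also have "ip d y (mv d M g) = ip d g (mv d M x) + t * qform d M g"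
        unfolding y_def by (subst ip_commute)
          (simp add: ip_add_right ip_scale_right qform_ip ip_commute, metis ip_mv_sym[OF sym] ip_commute)
      finally show ?thesis by (simp add: algebra_simps power2_eq_square)
    qed
    moreover have "ip d g (mv d M x) = ip d g g"
    proof -
      have "ip d g g = ip d g (mv d M x) - lam * ip d g x"
        by (subst (2) g_def) (simp add: ip_diff_right ip_scale_right)
      then show ?thesis using gx by simp
    qed
    ultimately show ?thesis unfolding q_def by (simp add: algebra_simps)
  qed
  have "ip d g g = 0"
  proof (rule ccontr)
    assume "ip d g g \<noteq> 0"
    then have G: "ip d g g > 0" using ip_self_nonneg[of d g] by linarith
    \<comment> \<open>A negative step so short that the quadratic term cannot outweigh the linear
      one, whatever the sign of \<open>q\<close>.\<close>
    define t where "t = - (ip d g g / (\<bar>q\<bar> + 1))"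
    have "t * q \<le> \<bar>t\<bar> * \<bar>q\<bar>" by (simp add: abs_mult[symmetric])
    have tq: "\<bar>t\<bar> * \<bar>q\<bar> = ip d g g * (\<bar>q\<bar> / (\<bar>q\<bar> + 1))" unfolding t_def using G by simp
    have "\<bar>q\<bar> / (\<bar>q\<bar> + 1) \<le> 1" by simp
    then have "ip d g g * (\<bar>q\<bar> / (\<bar>q\<bar> + 1)) \<le> ip d g g * 1" using G by (intro mult_left_mono) auto
    moreover have "- (t * q) \<le> \<bar>t\<bar> * \<bar>q\<bar>" by (simp add: abs_mult[symmetric])
    ultimately have "2 * ip d g g + t * q > 0" using G tq by linarith
    moreover have "t < 0" unfolding t_def using G by simp
    ultimately have "t * (2 * ip d g g + t * q) < 0" by (simp add: mult_neg_pos)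
    then show False using key[of t] by (simp add: algebra_simps power2_eq_square)
  qed
  then have "\<forall>i<d. g i = 0" by (simp add: ip_eq_0_iff)
  then have "mv d M x = (\<lambda>m. lam * x m)"
  proof (intro ext)
    fix m show "mv d M x m = lam * x m"
      using \<open>\<forall>i<d. g i = 0\<close> gR unfolding Rd_def by (cases "m < d") (auto simp: g_def)
  qed
  then show ?thesis using x1 by blast
qed

definition eigenbasis :: "nat \<Rightarrow> (nat \<Rightarrow> nat \<Rightarrow> real) \<Rightarrow> (nat \<Rightarrow> nat \<Rightarrow> real) \<Rightarrow> (nat \<Rightarrow> real) \<Rightarrow> bool" where
  "eigenbasis d M w l \<longleftrightarrow> (\<forall>i<d. w i \<in> Rd d) \<and>
     (\<forall>i<d. \<forall>j<d. ip d (w i) (w j) = (if i = j then 1 else 0)) \<and>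
     (\<forall>i<d. mv d M (w i) = (\<lambda>m. l i * w i m))"

lemma spectral:
  assumes sym: "msym d M"
  shows "\<exists>w l. eigenbasis d M w l"
proof -
  have "k \<le> d \<Longrightarrow> \<exists>w l. (\<forall>i<k. w i \<in> Rd d) \<and>
     (\<forall>i<k. \<forall>j<k. ip d (w i) (w j) = (if i = j then 1 else 0)) \<and>
     (\<forall>i<k. mv d M (w i) = (\<lambda>m. l i * w i m))" for k
  proof (induction k)
    case 0
    then show ?case by simp
  next
    case (Suc k)
    then obtain w l where wl: "\<forall>i<k. w i \<in> Rd d"
     "\<forall>i<k. \<forall>j<k. ip d (w i) (w j) = (if i = j then 1 else 0)"
     "\<forall>i<k. mv d M (w i) = (\<lambda>m. l i * w i m)" by auto
    obtain x lam where x: "x \<in> Rd d" "ip d x x = 1" "\<forall>i<k. ip d (w i) x = 0"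
        "mv d M x = (\<lambda>m. lam * x m)"
      using exists_next_eigenvector[OF sym, of k w l] Suc.prems wl by auto
    show ?case
      apply (rule exI[of _ "w(k := x)"], rule exI[of _ "l(k := lam)"])
      using wl x by (auto simp: less_Suc_eq ip_commute)
  qed
  then show ?thesis unfolding eigenbasis_def by blast
qed

text \<open>Functional calculus: for an eigenbasis \<open>w\<close> this is the symmetric matrix
  with eigenvalue \<open>\<phi> k\<close> on \<open>w k\<close>. Inverse and square root become
  pointwise choices of \<open>\<phi>\<close>.\<close>

definition fmat :: "nat \<Rightarrow> (nat \<Rightarrow> nat \<Rightarrow> real) \<Rightarrow> (nat \<Rightarrow> real) \<Rightarrow> nat \<Rightarrow> nat \<Rightarrow> real" where
  "fmat d w \<phi> = (\<lambda>i j. if i < d \<and> j < d then (\<Sum>k<d. \<phi> k * w k i * w k j) else 0)"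

lemma Md_eqI:
  assumes "M \<in> Md d" "N \<in> Md d" "\<And>x. x \<in> Rd d \<Longrightarrow> mv d M x = mv d N x"
  shows "M = N"
proof (intro ext)
  fix i k show "M i k = N i k"
  proof (cases "i < d \<and> k < d")
    case True
    then have "unitv k \<in> Rd d" by (auto simp: Rd_def unitv_def)
    from fun_cong[OF assms(3)[OF this], of i] show ?thesis
      using True by (simp add: mv_unitv)
  next
    case False
    then show ?thesis using assms(1,2) unfolding Md_def by (metis (mono_tags, lifting) mem_Collect_eq not_less)
  qed
qed

lemma mv_mmul: "mv d (mmul d M N) x = mv d M (mv d N x)"
proof
  fix i
  show "mv d (mmul d M N) x i = mv d M (mv d N x) i"
    unfolding mv_def mmul_def
    by (auto simp: sum_distrib_left sum_distrib_right mult_ac intro: sum.swap)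
qed

lemma mmul_Md: "mmul d M N \<in> Md d" by (auto simp: mmul_def Md_def)

lemma mv_Rd: "mv d M x \<in> Rd d" by (auto simp: mv_def Rd_def)

lemma mv_idm: "x \<in> Rd d \<Longrightarrow> mv d (idm d) x = x"
  by (rule ext) (simp add: mv_def idm_def Rd_def if_distrib[of "\<lambda>z. z * _"] cong: if_cong)

lemma idm_Md: "idm d \<in> Md d" by (auto simp: idm_def Md_def)

locale eigen_decomp =
  fixes d :: nat and M :: "nat \<Rightarrow> nat \<Rightarrow> real" and w :: "nat \<Rightarrow> nat \<Rightarrow> real" and l :: "nat \<Rightarrow> real"
  assumes eb: "eigenbasis d M w l" and MM: "M \<in> Md d" and symM: "msym d M"
begin

lemma wR: "k < d \<Longrightarrow> w k \<in> Rd d" and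
  on: "i < d \<Longrightarrow> j < d \<Longrightarrow> ip d (w i) (w j) = (if i = j then 1 else 0)" and
  ev: "i < d \<Longrightarrow> mv d M (w i) = (\<lambda>m. l i * w i m)"
  using eb unfolding eigenbasis_def by auto

lemma mv_fmat: "mv d (fmat d w \<phi>) x = (\<lambda>i. \<Sum>k<d. \<phi> k * ip d (w k) x * w k i)"
proof
  fix i show "mv d (fmat d w \<phi>) x i = (\<Sum>k<d. \<phi> k * ip d (w k) x * w k i)"
  proof (cases "i < d")
    case True
    have "mv d (fmat d w \<phi>) x i = (\<Sum>j<d. \<Sum>k<d. \<phi> k * w k i * w k j * x j)"
      unfolding mv_def fmat_def using True by (simp add: sum_distrib_right)
    also have "\<dots> = (\<Sum>k<d. \<Sum>j<d. \<phi> k * w k i * w k j * x j)" by (rule sum.swap)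
    also have "\<dots> = (\<Sum>k<d. \<phi> k * ip d (w k) x * w k i)"
      unfolding ip_def by (simp add: sum_distrib_left sum_distrib_right mult_ac)
    finally show ?thesis .
  next
    case False
    then show ?thesis using wR by (simp add: mv_def Rd_def)
  qed
qed

lemma fmat_Md: "fmat d w \<phi> \<in> Md d" by (auto simp: fmat_def Md_def)

lemma fmat_sym: "msym d (fmat d w \<phi>)" by (auto simp: fmat_def msym_def mult_ac)

text \<open>A square matrix with orthonormal rows has orthonormal columns: the residuals of the
  unit vectors have squared lengths adding up to \<open>d - d = 0\<close>.\<close>
lemma expansion:
  assumes x: "x \<in> Rd d"
  shows "x = (\<lambda>i. \<Sum>k<d. ip d (w k) x * w k i)"
proof -
  have bessel: "ip d (\<lambda>i. y i - (\<Sum>k<d. ip d (w k) y * w k i)) (\<lambda>i. y i - (\<Sum>k<d. ip d (w k) y * w k i))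
      = ip d y y - (\<Sum>k<d. (ip d (w k) y)\<^sup>2)" (is "ip d ?r ?r = _") for y
  proof -
    have o: "ip d (w m) ?r = 0" if "m < d" for m
    proof -
      have "ip d (w m) ?r = ip d (w m) y - (\<Sum>k<d. ip d (w k) y * ip d (w m) (w k))"
        by (simp add: ip_diff_right ip_sum_right)
      also have "(\<Sum>k<d. ip d (w k) y * ip d (w m) (w k)) = (\<Sum>k<d. if k = m then ip d (w k) y else 0)"
        using on that by (intro sum.cong) auto
      finally show ?thesis using that by simp
    qed
    have "ip d ?r ?r = ip d ?r y - (\<Sum>k<d. ip d (w k) y * ip d ?r (w k))"
      by (simp add: ip_diff_right ip_sum_right)
    also have "(\<Sum>k<d. ip d (w k) y * ip d ?r (w k)) = 0"
      using o by (intro sum.neutral) (simp add: ip_commute)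
    also have "ip d ?r y = ip d y y - (\<Sum>k<d. ip d (w k) y * ip d y (w k))"
      by (subst ip_commute) (simp add: ip_diff_right ip_sum_right)
    finally show ?thesis by (simp add: power2_eq_square ip_commute)
  qed
  note u = ip_unitv
  define r where "r j = (\<lambda>i. unitv j i - (\<Sum>k<d. ip d (w k) (unitv j) * w k i))" for j
  have rr: "ip d (r j) (r j) = 1 - (\<Sum>k<d. (w k j)\<^sup>2)" if "j < d" for j
    unfolding r_def bessel using that by (simp add: u) (simp add: unitv_def)
  have "(\<Sum>j<d. ip d (r j) (r j)) = real d - (\<Sum>k<d. ip d (w k) (w k))"
    by (simp add: rr sum_subtractf) (subst sum.swap, simp add: ip_def power2_eq_square)
  also have "\<dots> = 0" by (simp add: on)
  finally have "\<forall>j\<in>{..<d}. ip d (r j) (r j) = 0"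
    by (subst sum_nonneg_eq_0_iff[symmetric]) (auto simp: ip_self_nonneg)
  then have r0: "r j i = 0" if "j < d" "i < d" for i j using that by (simp add: ip_eq_0_iff)
  then have col: "(\<Sum>k<d. w k j * w k i) = (if i = j then 1 else 0)" if "j < d" "i < d" for i j
  proof -
    have "r j i = unitv j i - (\<Sum>k<d. w k j * w k i)" using that by (simp add: r_def u)
    then show ?thesis using r0[OF that] by (simp add: unitv_def split: if_splits)
  qed
  show ?thesis
  proof
    fix i show "x i = (\<Sum>k<d. ip d (w k) x * w k i)"
    proof (cases "i < d")
      case True
      have "(\<Sum>k<d. ip d (w k) x * w k i) = (\<Sum>j<d. x j * (\<Sum>k<d. w k j * w k i))"
        unfolding ip_def sum_distrib_left sum_distrib_right
        by (subst sum.swap) (simp add: mult_ac)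
      also have "\<dots> = (\<Sum>j<d. if j = i then x j else 0)"
        using True by (intro sum.cong) (auto simp: col)
      finally show ?thesis using True by simp
    next
      case False then show ?thesis using x wR by (simp add: Rd_def)
    qed
  qed
qed

lemma parseval:
  assumes x: "x \<in> Rd d"
  shows "ip d x x = (\<Sum>k<d. (ip d (w k) x)\<^sup>2)"
proof -
  have "ip d x x = ip d x (\<lambda>i. \<Sum>k<d. ip d (w k) x * w k i)"
    using expansion[OF x] by metis
  then show ?thesis by (simp add: ip_sum_right power2_eq_square ip_commute)
qed

lemma exists_component:
  assumes "x \<in> Rd d" "\<exists>i<d. x i \<noteq> 0"
  shows "\<exists>k<d. ip d (w k) x \<noteq> 0"
proof (rule ccontr)
  assume "\<not> ?thesis"
  then have "ip d x x = 0" unfolding parseval[OF assms(1)] by (intro sum.neutral) auto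
  then show False using assms(2) by (auto simp: ip_eq_0_iff)
qed

lemma qform_fmat: "qform d (fmat d w \<phi>) x = (\<Sum>k<d. \<phi> k * (ip d (w k) x)\<^sup>2)"
  unfolding qform_ip mv_fmat ip_sum_right
  by (simp add: power2_eq_square ip_commute mult_ac)

lemma mv_fmat_w: "m < d \<Longrightarrow> mv d (fmat d w \<phi>) (w m) = (\<lambda>i. \<phi> m * w m i)"
proof
  fix i assume m: "m < d"
  have "(\<Sum>k<d. \<phi> k * ip d (w k) (w m) * w k i) = (\<Sum>k<d. if k = m then \<phi> k * w k i else 0)"
    using m by (intro sum.cong) (auto simp: on)
  then show "mv d (fmat d w \<phi>) (w m) i = \<phi> m * w m i" by (simp add: mv_fmat m)
qed

lemma ip_w_mv_fmat: "m < d \<Longrightarrow> ip d (w m) (mv d (fmat d w \<phi>) x) = \<phi> m * ip d (w m) x"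
  by (subst ip_mv_sym[OF fmat_sym]) (simp add: mv_fmat_w ip_scale_right ip_commute)

lemma mmul_fmat: "mmul d (fmat d w \<phi>) (fmat d w \<psi>) = fmat d w (\<lambda>k. \<phi> k * \<psi> k)"
proof (rule Md_eqI[OF mmul_Md fmat_Md])
  fix x :: "nat \<Rightarrow> real"
  show "mv d (mmul d (fmat d w \<phi>) (fmat d w \<psi>)) x = mv d (fmat d w (\<lambda>k. \<phi> k * \<psi> k)) x"
    unfolding mv_mmul by (simp add: mv_fmat[of _ "mv d (fmat d w \<psi>) x"] ip_w_mv_fmat)
      (simp add: mv_fmat mult_ac)
qed

lemma M_fmat: "M = fmat d w l"
proof (rule Md_eqI[OF MM fmat_Md])
  fix x assume x: "x \<in> Rd d"
  have "ip d (w k) (mv d M x) = l k * ip d (w k) x" if "k < d" for k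
    by (subst ip_mv_sym[OF symM]) (simp add: ev that ip_scale_right ip_commute)
  then have "mv d M x = (\<lambda>i. \<Sum>k<d. l k * ip d (w k) x * w k i)"
    by (subst expansion[OF mv_Rd]) simp
  then show "mv d M x = mv d (fmat d w l) x" by (simp add: mv_fmat)
qed

lemma fmat_one: "fmat d w (\<lambda>_. 1) = idm d"
proof (rule Md_eqI[OF fmat_Md idm_Md])
  fix x assume "x \<in> Rd d"
  then show "mv d (fmat d w (\<lambda>_. 1)) x = mv d (idm d) x"
    using expansion by (simp add: mv_fmat mv_idm flip: expansion)
qed

lemma fmat_cong: "(\<And>k. k < d \<Longrightarrow> \<phi> k = \<psi> k) \<Longrightarrow> fmat d w \<phi> = fmat d w \<psi>"
  unfolding fmat_def by (intro ext) (auto intro!: sum.cong)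

lemma reigs_eq: "reigs d M = l ` {..<d}"
proof
  show "l ` {..<d} \<subseteq> reigs d M"
  proof
    fix \<mu> assume "\<mu> \<in> l ` {..<d}"
    then obtain k where k: "k < d" "\<mu> = l k" by auto
    have "\<not> (\<forall>i<d. w k i = 0)" using on[OF k(1) k(1)] ip_eq_0_iff[of d "w k"] by auto
    then show "\<mu> \<in> reigs d M" unfolding reigs_def using wR ev k by blast
  qed
  show "reigs d M \<subseteq> l ` {..<d}"
  proof
    fix \<mu> assume "\<mu> \<in> reigs d M"
    then obtain x where x: "x \<in> Rd d" "\<exists>i<d. x i \<noteq> 0" "mv d M x = (\<lambda>i. \<mu> * x i)"
      unfolding reigs_def by auto
    then obtain k where k: "k < d" "ip d (w k) x \<noteq> 0" using exists_component by blast
    have "ip d (w k) (mv d M x) = l k * ip d (w k) x"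
      by (subst ip_mv_sym[OF symM]) (simp add: ev k ip_scale_right ip_commute)
    then have "\<mu> = l k" using k unfolding x(3) by (simp add: ip_scale_right)
    then show "\<mu> \<in> l ` {..<d}" using k by auto
  qed
qed

lemma lmin_le: "k < d \<Longrightarrow> lmin d M \<le> l k" and le_lmax: "k < d \<Longrightarrow> l k \<le> lmax d M"
  unfolding lmin_def lmax_def reigs_eq by auto

lemma lmin_attained: "0 < d \<Longrightarrow> \<exists>k<d. lmin d M = l k"
proof -
  assume "0 < d"
  then have "finite (l ` {..<d})" "l ` {..<d} \<noteq> {}" by auto
  from Min_in[OF this] show "\<exists>k<d. lmin d M = l k" unfolding lmin_def reigs_eq by auto
qed

lemma qform_ge_lmin: "x \<in> Rd d \<Longrightarrow> lmin d M * ip d x x \<le> qform d M x"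
  unfolding parseval by (subst (2) M_fmat) (auto simp: qform_fmat sum_distrib_left intro!: sum_mono mult_right_mono lmin_le)

lemma qform_le_lmax: "x \<in> Rd d \<Longrightarrow> qform d M x \<le> lmax d M * ip d x x"
  unfolding parseval by (subst M_fmat) (auto simp: qform_fmat sum_distrib_left intro!: sum_mono mult_right_mono le_lmax)

end

lemma eigen_decompI:
  assumes "M \<in> Md d" "msym d M" shows "\<exists>w l. eigen_decomp d M w l"
  using spectral[OF assms(2)] assms unfolding eigen_decomp_def by blast

lemma Rayleigh:
  assumes "M \<in> Md d" "msym d M" "x \<in> Rd d"
  shows "lmin d M * ip d x x \<le> qform d M x" "qform d M x \<le> lmax d M * ip d x x"
  using eigen_decompI[OF assms(1,2)] eigen_decomp.qform_ge_lmin eigen_decomp.qform_le_lmax assms by blast+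

lemma lmin_eigenvector:
  assumes "M \<in> Md d" "msym d M" "0 < d"
  shows "\<exists>x\<in>Rd d. ip d x x = 1 \<and> qform d M x = lmin d M"
proof -
  obtain w l where "eigen_decomp d M w l" using eigen_decompI assms by blast
  then interpret eigen_decomp d M w l .
  obtain k where k: "k < d" "lmin d M = l k" using lmin_attained assms by auto
  show ?thesis using k wR on by (intro bexI[of _ "w k"]) (auto simp: qform_ip ev ip_scale_right)
qed

lemma ip_one_nonzero: "ip d x x = 1 \<Longrightarrow> \<exists>i<d. x i \<noteq> 0"
  using ip_eq_0_iff[of d x] by auto

lemma posdef_lmin_pos:
  assumes "M \<in> Md d" "posdef d M" "0 < d"
  shows "0 < lmin d M" "lmin d M \<le> lmax d M"
proof -
  have s: "msym d M" using assms by (simp add: posdef_def)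
  obtain x where x: "x\<in>Rd d" "ip d x x = 1" "qform d M x = lmin d M"
    using lmin_eigenvector[OF assms(1) s assms(3)] by auto
  then show "0 < lmin d M" using assms(2) ip_one_nonzero[OF x(2)] unfolding posdef_def by auto
  show "lmin d M \<le> lmax d M" using Rayleigh(2)[OF assms(1) s x(1)] x by simp
qed

context eigen_decomp
begin

lemma eigenvalue_pos: "posdef d M \<Longrightarrow> k < d \<Longrightarrow> 0 < l k"
  using posdef_lmin_pos[OF MM] lmin_le[of k] by force

lemma posdef_fmat:
  assumes "\<And>k. k < d \<Longrightarrow> 0 < \<phi> k" shows "posdef d (fmat d w \<phi>)"
  unfolding posdef_def
proof (intro conjI ballI impI fmat_sym)
  fix x assume x: "x \<in> Rd d" "\<exists>i<d. x i \<noteq> 0"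
  then obtain k where k: "k < d" "ip d (w k) x \<noteq> 0" using exists_component by blast
  show "0 < qform d (fmat d w \<phi>) x" unfolding qform_fmat
    using k assms by (intro sum_pos2[of _ k]) (auto simp: less_imp_le)
qed

text \<open>\<open>minv\<close> describes a right inverse. The functional calculus also provides a
  left inverse, and multiplying by it gives uniqueness.\<close>

lemma minv_fmat:
  assumes "\<And>k. k < d \<Longrightarrow> \<phi> k \<noteq> 0"
  shows "minv d (fmat d w \<phi>) = fmat d w (\<lambda>k. 1 / \<phi> k)"
  unfolding minv_def
proof (rule the_equality)
  have *: "mmul d (fmat d w \<phi>) (fmat d w (\<lambda>k. 1 / \<phi> k)) = idm d"
    "mmul d (fmat d w (\<lambda>k. 1 / \<phi> k)) (fmat d w \<phi>) = idm d"
    unfolding mmul_fmat fmat_one[symmetric] using assms by (auto intro!: fmat_cong)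
  then show "fmat d w (\<lambda>k. 1 / \<phi> k) \<in> Md d \<and> mmul d (fmat d w \<phi>) (fmat d w (\<lambda>k. 1 / \<phi> k)) = idm d"
    using fmat_Md by auto
  fix N assume N: "N \<in> Md d \<and> mmul d (fmat d w \<phi>) N = idm d"
  show "N = fmat d w (\<lambda>k. 1 / \<phi> k)"
  proof (rule Md_eqI)
    fix x :: "nat \<Rightarrow> real" assume x: "x \<in> Rd d"
    have "mv d N x = mv d (mmul d (fmat d w (\<lambda>k. 1 / \<phi> k)) (fmat d w \<phi>)) (mv d N x)"
      unfolding * by (simp add: mv_idm mv_Rd)
    also have "\<dots> = mv d (fmat d w (\<lambda>k. 1 / \<phi> k)) (mv d (mmul d (fmat d w \<phi>) N) x)"
      unfolding mv_mmul ..
    finally show "mv d N x = mv d (fmat d w (\<lambda>k. 1 / \<phi> k)) x" using N x by (simp add: mv_idm)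
  qed (use N fmat_Md in auto)
qed

text \<open>Uniqueness of the positive root \<open>R\<close>: on an eigenvector \<open>w k\<close> one has
  \<open>(R + sqrt (l k)) ((R - sqrt (l k)) (w k)) = 0\<close>, and the first factor is positive definite.\<close>
lemma msqrt_fmat:
  assumes pd: "posdef d M"
  shows "msqrt d M = fmat d w (\<lambda>k. sqrt (l k))"
  unfolding msqrt_def
proof (rule the_equality)
  have lp: "\<And>k. k < d \<Longrightarrow> 0 < l k" using eigenvalue_pos[OF pd] .
  have sq: "mmul d (fmat d w (\<lambda>k. sqrt (l k))) (fmat d w (\<lambda>k. sqrt (l k))) = M"
    unfolding mmul_fmat by (subst M_fmat) (auto intro!: fmat_cong simp: lp less_imp_le)
  then show "fmat d w (\<lambda>k. sqrt (l k)) \<in> Md d \<and> posdef d (fmat d w (\<lambda>k. sqrt (l k))) \<and>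
      mmul d (fmat d w (\<lambda>k. sqrt (l k))) (fmat d w (\<lambda>k. sqrt (l k))) = M"
    using fmat_Md posdef_fmat lp by auto
  fix R assume R: "R \<in> Md d \<and> posdef d R \<and> mmul d R R = M"
  have Rw: "mv d R (w k) = (\<lambda>i. sqrt (l k) * w k i)" if k: "k < d" for k
  proof -
    define s where "s = sqrt (l k)"
    have s: "s > 0" "s * s = l k" using lp[OF k] by (auto simp: s_def)
    define y where "y = (\<lambda>i. mv d R (w k) i - s * w k i)"
    have yR: "y \<in> Rd d" using wR[OF k] mv_Rd[of d R "w k"] unfolding y_def Rd_def by auto
    have "mv d R y = (\<lambda>i. mv d R (mv d R (w k)) i - s * mv d R (w k) i)"
      unfolding y_def mv_def[of d R "\<lambda>i. mv d R (w k) i - s * w k i"]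
      by (auto simp: mv_def algebra_simps sum_subtractf sum_distrib_left)
    also have "mv d R (mv d R (w k)) = (\<lambda>i. l k * w k i)"
      using R ev[OF k] by (simp flip: mv_mmul)
    finally have "mv d R y = (\<lambda>i. - s * y i)"
      unfolding y_def s(2)[symmetric] by (auto simp: algebra_simps)
    then have "qform d R y = - s * ip d y y" unfolding qform_ip by (simp only: ip_scale_right)
    then have "qform d R y \<le> 0" using s ip_self_nonneg[of d y] by simp
    then have "\<not> (\<exists>i<d. y i \<noteq> 0)" using R yR unfolding posdef_def by force
    then have "y i = 0" for i using yR unfolding Rd_def by (cases "i < d") auto
    then show ?thesis unfolding y_def s_def by (auto intro!: ext)
  qed
  show "R = fmat d w (\<lambda>k. sqrt (l k))"
  proof (rule Md_eqI)
    fix x :: "nat \<Rightarrow> real" assume x: "x \<in> Rd d"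
    have sR: "msym d R" using R by (simp add: posdef_def)
    have "ip d (w k) (mv d R x) = sqrt (l k) * ip d (w k) x" if "k < d" for k
      by (subst ip_mv_sym[OF sR]) (simp add: Rw that ip_scale_right ip_commute)
    then show "mv d R x = mv d (fmat d w (\<lambda>k. sqrt (l k))) x"
      by (subst expansion[OF mv_Rd]) (simp add: mv_fmat)
  qed (use R fmat_Md in auto)
qed

end

text \<open>All conclusions are read off the eigenvalues \<open>1 / l k\<close>. The last one
  identifies the norm behind \<open>JSmax\<close>, which uses the inverse square root, with
  \<open>snorm\<close>, which uses the inverse.\<close>

lemma posdef_minv:
  assumes "M \<in> Md d" "posdef d M" "0 < d"
  shows "minv d M \<in> Md d" "posdef d (minv d M)" "mmul d M (minv d M) = idm d" "mmul d (minv d M) M = idm d"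
    "x \<in> Rd d \<Longrightarrow> ip d x x / lmax d M \<le> qform d (minv d M) x"
    "x \<in> Rd d \<Longrightarrow> qform d (minv d M) x \<le> ip d x x / lmin d M"
    "(vnorm d (mv d (minv d (msqrt d M)) x))\<^sup>2 = qform d (minv d M) x"
proof -
  obtain w l where "eigen_decomp d M w l" using eigen_decompI[of M d] assms unfolding posdef_def by blast
  then interpret eigen_decomp d M w l .
  have lp: "0 < l k" if "k < d" for k using eigenvalue_pos[OF assms(2) that] .
  have m: "minv d M = fmat d w (\<lambda>k. 1 / l k)"
    by (subst M_fmat, rule minv_fmat) (use lp in force)
  show "minv d M \<in> Md d" "posdef d (minv d M)" unfolding m using posdef_fmat fmat_Md lp by auto
  show "mmul d M (minv d M) = idm d" "mmul d (minv d M) M = idm d"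
    unfolding m by (subst M_fmat, unfold mmul_fmat fmat_one[symmetric], rule fmat_cong, use lp in force)+
  show "ip d x x / lmax d M \<le> qform d (minv d M) x" if "x \<in> Rd d"
    unfolding m qform_fmat parseval[OF that] sum_divide_distrib
    using lp le_lmax posdef_lmin_pos[OF assms]
    by (intro sum_mono) (auto simp: divide_simps intro!: mult_right_mono mult_left_mono)
  show "qform d (minv d M) x \<le> ip d x x / lmin d M" if "x \<in> Rd d"
    unfolding m qform_fmat parseval[OF that] sum_divide_distrib
    using lp lmin_le posdef_lmin_pos[OF assms]
    by (intro sum_mono) (auto simp: divide_simps intro!: mult_right_mono mult_left_mono)
  have r: "minv d (msqrt d M) = fmat d w (\<lambda>k. 1 / sqrt (l k))"
    unfolding msqrt_fmat[OF assms(2)] by (rule minv_fmat) (use lp in force)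
  have "(vnorm d (mv d (minv d (msqrt d M)) x))\<^sup>2 = ip d x (mv d (mmul d (minv d (msqrt d M)) (minv d (msqrt d M))) x)"
    unfolding vnorm_ip r mv_mmul real_sqrt_pow2[OF ip_self_nonneg] by (rule ip_mv_sym[OF fmat_sym])
  also have "mmul d (minv d (msqrt d M)) (minv d (msqrt d M)) = minv d M"
    unfolding r m mmul_fmat by (rule fmat_cong) (use lp in \<open>auto simp: less_imp_le simp flip: real_sqrt_mult\<close>)
  finally show "(vnorm d (mv d (minv d (msqrt d M)) x))\<^sup>2 = qform d (minv d M) x" by (simp add: qform_ip)
qed

text \<open>The substitution \<open>y = mv d (msqrt d M) x\<close> turns the Rayleigh quotient of
  \<open>R N R\<close> at \<open>y\<close> into \<open>qform d N x / qform d M x\<close>. For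
  \<open>M = Sig\<close> and \<open>N\<close> the matrix \<open>sigma2\<close> the minimum
  \<open>\<beta>\<close> is twice \<open>alpha1\<close>.\<close>

lemma generalized_Rayleigh:
  assumes "M \<in> Md d" "posdef d M" "0 < d" "N \<in> Md d" "msym d N"
  defines "R \<equiv> minv d (msqrt d M)"
  defines "\<beta> \<equiv> lmin d (mmul d (mmul d R N) R)"
  shows "x \<in> Rd d \<Longrightarrow> \<beta> * qform d M x \<le> qform d N x"
    and "\<exists>x\<in>Rd d. (\<exists>i<d. x i \<noteq> 0) \<and> qform d N x = \<beta> * qform d M x"
proof -
  obtain w l where "eigen_decomp d M w l" using eigen_decompI[of M d] assms unfolding posdef_def by blast
  then interpret eigen_decomp d M w l .
  have lp: "0 < l k" if "k < d" for k using eigenvalue_pos[OF assms(2) that] .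
  define Q where "Q = msqrt d M"
  have Q: "Q = fmat d w (\<lambda>k. sqrt (l k))" unfolding Q_def by (rule msqrt_fmat[OF assms(2)])
  have R: "R = fmat d w (\<lambda>k. 1 / sqrt (l k))"
    unfolding R_def Q[unfolded Q_def] by (rule minv_fmat) (use lp in force)
  have RQ: "mmul d R Q = idm d" "mmul d Q R = idm d"
    unfolding R Q mmul_fmat fmat_one[symmetric] by (rule fmat_cong, use lp in force)+
  have sR: "msym d R" and sQ: "msym d Q" unfolding R Q by (rule fmat_sym)+
  have QQ: "mmul d Q Q = M"
    unfolding Q mmul_fmat by (subst M_fmat) (auto intro!: fmat_cong simp: lp less_imp_le)
  define T where "T = mmul d (mmul d R N) R"
  have ipT: "ip d x (mv d T y) = ip d (mv d R x) (mv d N (mv d R y))" for x y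
    unfolding T_def mv_mmul using ip_mv_sym[OF sR] ip_commute by metis
  have sT: "msym d T"
  proof -
    have "T i j = T j i" if "i < d" "j < d" for i j
    proof -
      have u: "ip d (unitv i) (mv d T (unitv j)) = T i j" if "i < d" "j < d" for i j
        using that by (subst ip_commute) (simp add: ip_unitv mv_unitv)
      show ?thesis using u[OF that] u[OF that(2,1)] unfolding ipT using ip_mv_sym[OF assms(5)] by metis
    qed
    then show ?thesis unfolding msym_def by blast
  qed
  have TM: "T \<in> Md d" unfolding T_def by (rule mmul_Md)
  have qT: "qform d T x = qform d N (mv d R x)" for x unfolding qform_ip ipT ..
  have qM: "qform d M x = ip d (mv d Q x) (mv d Q x)" for x
    unfolding qform_ip QQ[symmetric] mv_mmul using ip_mv_sym[OF sQ] ip_commute by metis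
  have cancel: "mv d R (mv d Q x) = x" "mv d Q (mv d R x) = x" if "x \<in> Rd d" for x
    using RQ mv_idm[OF that] by (simp_all flip: mv_mmul)
  show "\<beta> * qform d M x \<le> qform d N x" if "x \<in> Rd d"
    using Rayleigh(1)[OF TM sT mv_Rd, of Q x] unfolding qT qM cancel[OF that]
    by (simp add: \<beta>_def T_def)
  obtain y where y: "y \<in> Rd d" "ip d y y = 1" "qform d T y = lmin d T"
    using lmin_eigenvector[OF TM sT assms(3)] by auto
  have "qform d N (mv d R y) = \<beta> * qform d M (mv d R y)"
    using y unfolding qT qM cancel[OF y(1)] by (simp add: \<beta>_def T_def)
  moreover have "\<exists>i<d. mv d R y i \<noteq> 0"
  proof (rule ccontr)
    assume "\<not> (\<exists>i<d. mv d R y i \<noteq> 0)"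
    then have "mv d Q (mv d R y) = (\<lambda>i. 0)" by (auto simp: mv_def[of d Q])
    then show False using y cancel[OF y(1)] by (simp add: ip_def)
  qed
  ultimately show "\<exists>x\<in>Rd d. (\<exists>i<d. x i \<noteq> 0) \<and> qform d N x = \<beta> * qform d M x"
    using mv_Rd by blast
qed

section \<open>Finite Markov chains\<close>

definition gen :: "'s set \<Rightarrow> ('s \<Rightarrow> 's \<Rightarrow> real) \<Rightarrow> ('s \<Rightarrow> real) \<Rightarrow> 's \<Rightarrow> real" where
  "gen S q f X = (\<Sum>Y\<in>S. q X Y * (f Y - f X))"

definition semi :: "'s set \<Rightarrow> ('s \<Rightarrow> 's \<Rightarrow> real) \<Rightarrow> real \<Rightarrow> ('s \<Rightarrow> real) \<Rightarrow> 's \<Rightarrow> real" where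
  "semi S q t f X = (\<Sum>Y\<in>S. transP S q t X Y * f Y)"

locale finite_chain =
  fixes S :: "'s set" and q :: "'s \<Rightarrow> 's \<Rightarrow> real"
  assumes fin: "finite S" and q_nonneg: "X \<in> S \<Longrightarrow> Y \<in> S \<Longrightarrow> 0 \<le> q X Y"
begin

lemma gen_cong: "(\<And>Y. Y \<in> S \<Longrightarrow> f Y = g Y) \<Longrightarrow> X \<in> S \<Longrightarrow> gen S q f X = gen S q g X"
  unfolding gen_def by (intro sum.cong) auto

lemma gen_diff: "gen S q (\<lambda>Y. f Y - g Y) X = gen S q f X - gen S q g X"
  unfolding gen_def by (simp add: algebra_simps sum.distrib sum_subtractf)

lemma gen_add: "gen S q (\<lambda>Y. f Y + g Y) X = gen S q f X + gen S q g X"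
  unfolding gen_def by (simp add: algebra_simps sum.distrib sum_subtractf)

lemma gen_scale: "gen S q (\<lambda>Y. a * f Y) X = a * gen S q f X"
  unfolding gen_def by (simp add: algebra_simps sum_distrib_left)

lemma gen_const: "gen S q (\<lambda>Y. a) X = 0"
  unfolding gen_def by simp

text \<open>Parabolic maximum principle: at the first time at which \<open>D - e (1 + t)\<close> touches \<open>0\<close>,
  the generator is nonpositive there while the time derivative is nonnegative.\<close>
lemma comparison:
  fixes D D' :: "real \<Rightarrow> 's \<Rightarrow> real"
  assumes deriv: "\<And>t X. t \<in> {0..T} \<Longrightarrow> X \<in> S \<Longrightarrow> ((\<lambda>t. D t X) has_real_derivative D' t X) (at t)"
    and init: "\<And>X. X \<in> S \<Longrightarrow> D 0 X \<le> 0"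
    and bd: "\<And>t X. t \<in> {0..T} \<Longrightarrow> X \<in> S \<Longrightarrow> X \<notin> U \<Longrightarrow> D t X \<le> 0"
    and sub: "\<And>t X. t \<in> {0..T} \<Longrightarrow> X \<in> S \<Longrightarrow> X \<in> U \<Longrightarrow> D' t X \<le> gen S q (D t) X"
    and tX: "t \<in> {0..T}" "X \<in> S"
  shows "D t X \<le> 0"
proof -
  have lt: "D t X - e * (1 + t) < 0" if e: "e > 0" and tX: "t \<in> {0..T}" "X \<in> S" for e t X
  proof (rule ccontr)
    assume neg: "\<not> D t X - e * (1 + t) < 0"
    define G where "G t X = D t X - e * (1 + t)" for t X
    have dG: "((\<lambda>t. G t X) has_real_derivative D' t X - e) (at t)" if "t \<in> {0..T}" "X \<in> S" for t X
      unfolding G_def by (rule derivative_eq_intros deriv that refl | simp)+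
    define Z where "Z = (\<Union>X\<in>S. {t \<in> {0..T}. 0 \<le> G t X})"
    have "closed {t \<in> {0..T}. 0 \<le> G t X}" if "X \<in> S" for X
    proof (rule continuous_on_closed_Collect_le)
      show "continuous_on {0..T} (\<lambda>t. G t X)"
        using dG that by (intro continuous_at_imp_continuous_on ballI DERIV_isCont) blast
    qed auto
    then have "closed Z" unfolding Z_def using fin by (intro closed_UN) auto
    moreover have "bounded Z" by (rule bounded_subset[of "{0..T}"]) (auto simp: Z_def)
    ultimately have "compact Z" by (simp add: compact_eq_bounded_closed)
    moreover have "t \<in> Z" using neg tX unfolding Z_def G_def by (auto simp: not_less intro!: bexI[of _ X])
    ultimately obtain t0 where t0: "t0 \<in> Z" "\<And>t. t \<in> Z \<Longrightarrow> t0 \<le> t"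
      using compact_attains_inf[of Z] by auto
    then obtain X0 where X0: "X0 \<in> S" "t0 \<in> {0..T}" "0 \<le> G t0 X0" unfolding Z_def by auto
    have "G 0 X0 < 0" using init[OF X0(1)] e by (simp add: G_def)
    then have pos: "t0 > 0" using X0 by (metis atLeastAtMost_iff less_le not_le)
    have below: "G t Y < 0" if "t \<in> {0..<t0}" "Y \<in> S" for t Y
      using t0(2)[of t] that X0(2) unfolding Z_def by (force simp: not_le)
    have le0: "G t0 Y \<le> 0" if Y: "Y \<in> S" for Y
    proof (rule tendsto_upperbound[of "\<lambda>t. G t Y" _ "at_left t0"])
      have "isCont (\<lambda>t. G t Y) t0" using dG X0(2) Y by (meson DERIV_isCont)
      then show "((\<lambda>t. G t Y) \<longlongrightarrow> G t0 Y) (at_left t0)"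
        unfolding isCont_def by (rule tendsto_within_subset) simp
      have "\<forall>\<^sub>F t in at_left t0. t \<in> {0<..<t0}" using pos by (rule eventually_at_left_real)
      then show "\<forall>\<^sub>F t in at_left t0. G t Y \<le> 0"
        by (rule eventually_mono) (use below Y in \<open>auto intro: less_imp_le\<close>)
    qed simp
    have zero: "G t0 X0 = 0" using le0[OF X0(1)] X0(3) by simp
    have "X0 \<in> U"
      using bd[OF X0(2,1)] zero e pos unfolding G_def by (smt (verit) mult_pos_pos)
    then have "D' t0 X0 \<le> gen S q (D t0) X0" using sub X0 by blast
    also have "\<dots> = (\<Sum>Y\<in>S. q X0 Y * (G t0 Y - G t0 X0))"
      unfolding gen_def G_def by simp
    also have "\<dots> \<le> 0"
      using le0 zero q_nonneg X0(1) by (intro sum_nonpos) (auto simp: mult_nonneg_nonpos)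
    finally have "D' t0 X0 - e < 0" using e by simp
    from DERIV_neg_dec_left[OF dG[OF X0(2,1)] this] obtain h where
      h: "h > 0" "\<And>k. 0 < k \<Longrightarrow> k < h \<Longrightarrow> G t0 X0 < G (t0 - k) X0" by blast
    define k where "k = min (h / 2) (t0 / 2)"
    have "0 < k" "k < h" "t0 - k \<in> {0..<t0}" using h(1) pos by (auto simp: k_def min_def)
    then show False using h(2)[of k] below[of "t0 - k" X0] zero X0(1) by force
  qed
  show ?thesis
  proof (rule field_le_epsilon)
    fix e :: real assume "e > 0"
    then show "D t X \<le> 0 + e" using lt[of "e / (1 + t)" t X] tX by simp
  qed
qed

section \<open>The matrix exponential and its semigroup\<close>

lemma genQ_row: "X \<in> S \<Longrightarrow> (\<Sum>Z\<in>S. genQ S q X Z * f Z) = gen S q f X"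
proof -
  assume X: "X \<in> S"
  have "(\<Sum>Z\<in>S. genQ S q X Z * f Z) = genQ S q X X * f X + (\<Sum>Z\<in>S - {X}. genQ S q X Z * f Z)"
    using fin X by (rule sum.remove)
  also have "(\<Sum>Z\<in>S - {X}. genQ S q X Z * f Z) = (\<Sum>Z\<in>S - {X}. q X Z * f Z)"
    by (intro sum.cong) (auto simp: genQ_def)
  also have "genQ S q X X * f X + \<dots> = (\<Sum>Z\<in>S - {X}. q X Z * (f Z - f X))"
    by (simp add: genQ_def algebra_simps sum_subtractf sum_distrib_left)
  also have "\<dots> = gen S q f X"
    unfolding gen_def using sum.remove[OF fin X, of "\<lambda>Z. q X Z * (f Z - f X)"] by simp
  finally show ?thesis .
qed

text \<open>A crude norm of the Q-matrix, which makes the exponential series converge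
  absolutely.\<close>

definition R :: real where "R = (\<Sum>X\<in>S. \<Sum>Z\<in>S. \<bar>genQ S q X Z\<bar>)"

lemma Qpow_bound: "X \<in> S \<Longrightarrow> \<bar>Qpow S q k X Y\<bar> \<le> R ^ k"
proof (induction k arbitrary: X)
  case 0 then show ?case by simp
next
  case (Suc k)
  have "\<bar>Qpow S q (Suc k) X Y\<bar> \<le> (\<Sum>Z\<in>S. \<bar>genQ S q X Z\<bar> * \<bar>Qpow S q k Z Y\<bar>)"
    using Suc.prems by (simp add: sum_abs[THEN order_trans] abs_mult)
  also have "\<dots> \<le> (\<Sum>Z\<in>S. \<bar>genQ S q X Z\<bar> * R ^ k)"
    using Suc.IH by (intro sum_mono mult_left_mono) auto
  also have "\<dots> = (\<Sum>Z\<in>S. \<bar>genQ S q X Z\<bar>) * R ^ k" by (simp add: sum_distrib_right)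
  also have "\<dots> \<le> R * R ^ k"
    unfolding R_def using fin Suc.prems
    by (intro mult_right_mono zero_le_power sum_nonneg member_le_sum[of X S "\<lambda>X. \<Sum>Z\<in>S. \<bar>genQ S q X Z\<bar>"]) (auto intro: sum_nonneg)
  finally show ?case by simp
qed

lemma summable_Qpow: "X \<in> S \<Longrightarrow> summable (\<lambda>k. Qpow S q k X Y / fact k * t ^ k)"
proof (rule summable_comparison_test'[where N=0])
  show "summable (\<lambda>k. (R * \<bar>t\<bar>) ^ k /\<^sub>R fact k)" by (rule summable_exp_generic)
  fix k assume X: "X \<in> S"
  have "norm (Qpow S q k X Y / fact k * t ^ k) = \<bar>Qpow S q k X Y\<bar> * \<bar>t\<bar> ^ k / fact k"
    by (simp add: abs_mult power_abs)
  also have "\<dots> \<le> R ^ k * \<bar>t\<bar> ^ k / fact k"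
    using Qpow_bound[OF X] by (intro divide_right_mono mult_right_mono) auto
  finally show "norm (Qpow S q k X Y / fact k * t ^ k) \<le> (R * \<bar>t\<bar>) ^ k /\<^sub>R fact k"
    by (simp add: power_mult_distrib field_simps)
qed

text \<open>Termwise differentiation of the exponential series. \<open>Qpow\<close> multiplies by
  the generator on the left, which is why the backward equation comes out.\<close>

lemma transP_deriv:
  assumes X: "X \<in> S"
  shows "((\<lambda>t. transP S q t X Y) has_real_derivative (\<Sum>Z\<in>S. genQ S q X Z * transP S q t Z Y)) (at t)"
proof -
  define c where "c X k = Qpow S q k X Y / fact k" for X k
  have tr: "transP S q t X Y = (\<Sum>k. c X k * t ^ k)" for t X
    unfolding transP_def c_def by (simp add: mult_ac)
  have "diffs (c X) k = (\<Sum>Z\<in>S. genQ S q X Z * c Z k)" for k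
    using X unfolding diffs_def c_def
    by (simp add: sum_divide_distrib sum_distrib_left field_simps del: of_nat_Suc)
  then have "(\<Sum>k. diffs (c X) k * t ^ k) = (\<Sum>k. \<Sum>Z\<in>S. genQ S q X Z * (c Z k * t ^ k))"
    by (simp add: sum_distrib_left mult_ac)
  also have "\<dots> = (\<Sum>Z\<in>S. \<Sum>k. genQ S q X Z * (c Z k * t ^ k))"
    by (rule suminf_sum) (unfold c_def, intro summable_mult summable_Qpow)
  also have "\<dots> = (\<Sum>Z\<in>S. genQ S q X Z * transP S q t Z Y)"
    unfolding tr by (intro sum.cong refl suminf_mult) (unfold c_def, intro summable_Qpow)
  finally have "(\<Sum>k. diffs (c X) k * t ^ k) = (\<Sum>Z\<in>S. genQ S q X Z * transP S q t Z Y)" .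
  moreover have "((\<lambda>t. \<Sum>k. c X k * t ^ k) has_real_derivative (\<Sum>k. diffs (c X) k * t ^ k)) (at t)"
    using X by (intro termdiffs_strong_converges_everywhere) (unfold c_def, intro summable_Qpow)
  ultimately show ?thesis unfolding tr by simp
qed

lemma semi_deriv:
  assumes X: "X \<in> S"
  shows "((\<lambda>t. semi S q t f X) has_real_derivative gen S q (semi S q t f) X) (at t)"
proof -
  have "((\<lambda>t. semi S q t f X) has_real_derivative (\<Sum>Y\<in>S. (\<Sum>Z\<in>S. genQ S q X Z * transP S q t Z Y) * f Y)) (at t)"
    unfolding semi_def by (intro DERIV_sum DERIV_cmult_right transP_deriv X)
  also have "(\<Sum>Y\<in>S. (\<Sum>Z\<in>S. genQ S q X Z * transP S q t Z Y) * f Y) = (\<Sum>Z\<in>S. genQ S q X Z * semi S q t f Z)"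
    unfolding semi_def sum_distrib_left sum_distrib_right by (subst sum.swap) (simp add: mult_ac)
  finally show ?thesis using genQ_row[OF X] by simp
qed

lemma semi_0: "X \<in> S \<Longrightarrow> semi S q 0 f X = f X"
proof -
  assume X: "X \<in> S"
  have "transP S q 0 X Y = (if X = Y then 1 else 0)" for Y
  proof -
    have "(\<lambda>k. 0 ^ k / fact k * Qpow S q k X Y) = (\<lambda>k. (if k = 0 then Qpow S q k X Y else 0))"
      by (auto simp: fun_eq_iff)
    moreover have "(\<Sum>k. (if k = 0 then Qpow S q k X Y else 0)) = Qpow S q 0 X Y"
      using sums_single[of 0 "\<lambda>k. Qpow S q k X Y"] sums_unique by force
    ultimately show ?thesis unfolding transP_def by simp
  qed
  then have "semi S q 0 f X = (\<Sum>Y\<in>S. if X = Y then f Y else 0)"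
    unfolding semi_def by (intro sum.cong) auto
  then show ?thesis using X fin by simp
qed

text \<open>\<open>comparison\<close> with \<open>U = S\<close>, so that no boundary values are
  required. Constants as supersolutions give positivity and the sup bounds for
  \<open>semi\<close>.\<close>

lemma solution_le:
  assumes "\<And>t X. t \<in> {0..T} \<Longrightarrow> X \<in> S \<Longrightarrow> ((\<lambda>t. F t X) has_real_derivative F' t X) (at t)"
    and "\<And>t X. t \<in> {0..T} \<Longrightarrow> X \<in> S \<Longrightarrow> gen S q (F t) X \<le> F' t X"
    and "\<And>X. X \<in> S \<Longrightarrow> f X \<le> F 0 X"
    and tX: "t \<in> {0..T}" "X \<in> S"
  shows "semi S q t f X \<le> F t X"
proof -
  have "semi S q t f X - F t X \<le> 0"
    by (rule comparison[where T=T and U=S and D = "\<lambda>t X. semi S q t f X - F t X"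
         and D' = "\<lambda>t X. gen S q (semi S q t f) X - F' t X"])
      (use assms semi_0 in \<open>auto intro!: DERIV_diff semi_deriv simp: gen_diff\<close>)
  then show ?thesis by simp
qed

lemma semi_diff: "semi S q t (\<lambda>Y. f Y - g Y) X = semi S q t f X - semi S q t g X"
  unfolding semi_def by (simp add: algebra_simps sum_subtractf)

lemma semi_scale: "semi S q t (\<lambda>Y. a * f Y) X = a * semi S q t f X"
  unfolding semi_def by (simp add: algebra_simps sum_distrib_left)

lemma semi_le:
  assumes "0 \<le> t" "X \<in> S" "\<And>Y. Y \<in> S \<Longrightarrow> f Y \<le> m"
  shows "semi S q t f X \<le> m"
  by (rule solution_le[where T=t and F="\<lambda>_ _. m" and F'="\<lambda>_ _. 0"]) (use assms in \<open>auto simp: gen_const\<close>)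

lemma semi_mono:
  assumes "0 \<le> t" "X \<in> S" "\<And>Y. Y \<in> S \<Longrightarrow> f Y \<le> g Y"
  shows "semi S q t f X \<le> semi S q t g X"
  using semi_le[of t X "\<lambda>Y. f Y - g Y" 0] assms by (simp add: semi_diff)

lemma semi_ge:
  assumes "0 \<le> t" "X \<in> S" "\<And>Y. Y \<in> S \<Longrightarrow> m \<le> f Y"
  shows "m \<le> semi S q t f X"
  using semi_le[of t X "\<lambda>Y. - 1 * f Y" "- m"] assms unfolding semi_scale by simp

lemma semi_const: "0 \<le> t \<Longrightarrow> X \<in> S \<Longrightarrow> semi S q t (\<lambda>_. m) X = m"
  by (intro antisym semi_le semi_ge) auto

lemma semi_abs_le:
  assumes "0 \<le> t" "X \<in> S" "\<And>Y. Y \<in> S \<Longrightarrow> \<bar>f Y\<bar> \<le> m"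
  shows "\<bar>semi S q t f X\<bar> \<le> m"
proof -
  have "\<And>Y. Y \<in> S \<Longrightarrow> f Y \<le> m" "\<And>Y. Y \<in> S \<Longrightarrow> - m \<le> f Y" using assms(3) abs_le_iff by force+
  then show ?thesis using semi_le[OF assms(1,2), of f m] semi_ge[OF assms(1,2), of "-m" f] by simp
qed

text \<open>Both sides solve the backward equation in \<open>t\<close> with the same initial value.
  The comparison is one-sided, so it is applied to \<open>f\<close> with the factors 1 and
  -1.\<close>

lemma semi_semi:
  assumes "0 \<le> t" "0 \<le> s" "X \<in> S"
  shows "semi S q (t + s) f X = semi S q t (semi S q s f) X"
proof -
  have *: "semi S q t (\<lambda>Y. a * semi S q s f Y) X \<le> a * semi S q (t + s) f X" for a
  proof (rule solution_le[where T=t and F="\<lambda>t X. a * semi S q (t + s) f X" and F'="\<lambda>t X. a * gen S q (semi S q (t+s) f) X"])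
    fix t X assume "X \<in> S"
    have "((\<lambda>t. semi S q (t + s) f X) has_real_derivative gen S q (semi S q (t + s) f) X) (at t)"
      using DERIV_shift[of "\<lambda>t. semi S q t f X" _ t s] semi_deriv[OF \<open>X \<in> S\<close>] by blast
    then show "((\<lambda>t. a * semi S q (t + s) f X) has_real_derivative a * gen S q (semi S q (t+s) f) X) (at t)"
      by (rule DERIV_cmult)
  qed (use assms in \<open>auto simp: gen_scale\<close>)
  show ?thesis using *[of 1] *[of "-1"] unfolding semi_scale by simp
qed

end


section \<open>Chains that halve oscillations, and their equilibrium\<close>

locale contracting_chain = finite_chain S q
  for S :: "'s set" and q :: "'s \<Rightarrow> 's \<Rightarrow> real" +
  fixes x0 :: 's and T :: real
  assumes x0: "x0 \<in> S" and T_pos: "T > 0"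
    and contr: "\<And>f X Y. (\<And>Z. Z \<in> S \<Longrightarrow> \<bar>f Z\<bar> \<le> 1) \<Longrightarrow> X \<in> S \<Longrightarrow> Y \<in> S \<Longrightarrow>
        semi S q T f X - semi S q T f Y \<le> 1/2"
begin

definition osc_le :: "('s \<Rightarrow> real) \<Rightarrow> real \<Rightarrow> bool" where
  "osc_le f b \<longleftrightarrow> (\<forall>X\<in>S. \<forall>Y\<in>S. f X - f Y \<le> b)"

text \<open>A function of oscillation at most \<open>b\<close> becomes bounded by 1 after
  subtracting its value at \<open>x0\<close> and dividing by \<open>b\<close>, so the contraction
  assumption applies to it.\<close>

lemma osc_semi_T:
  assumes "osc_le f b" "b > 0" shows "osc_le (semi S q T f) (b / 2)"
  unfolding osc_le_def
proof (intro ballI)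
  fix X Y assume XY: "X \<in> S" "Y \<in> S"
  define g where "g Z = (1 / b) * (f Z - f x0)" for Z
  have "\<bar>g Z\<bar> \<le> 1" if "Z \<in> S" for Z
  proof -
    have "\<bar>f Z - f x0\<bar> \<le> b" using assms(1) that x0 unfolding osc_le_def by (auto simp: abs_le_iff)
    then show ?thesis using assms(2) unfolding g_def by (simp add: abs_mult field_simps)
  qed
  from contr[OF this XY] have "semi S q T g X - semi S q T g Y \<le> 1/2" .
  moreover have "semi S q T g Z = (1 / b) * (semi S q T f Z - f x0)" if "Z \<in> S" for Z
    unfolding g_def semi_scale semi_diff using semi_const that T_pos by simp
  ultimately show "semi S q T f X - semi S q T f Y \<le> b / 2"
    using assms(2) XY by (simp add: field_simps)
qed

lemma osc_semi:
  assumes "osc_le f b" "0 \<le> t" shows "osc_le (semi S q t f) b"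
  unfolding osc_le_def
proof (intro ballI)
  fix X Y assume XY: "X \<in> S" "Y \<in> S"
  have "semi S q t f X - b \<le> f Z" if Z: "Z \<in> S" for Z
  proof -
    have "semi S q t f X \<le> f Z + b"
      using assms Z XY by (intro semi_le) (auto simp: osc_le_def algebra_simps)
    then show ?thesis by simp
  qed
  from semi_ge[OF assms(2) XY(2), of "semi S q t f X - b" f, OF this] show "semi S q t f X - semi S q t f Y \<le> b" by simp
qed

lemma osc_semi_kT:
  assumes "osc_le f b" "b > 0" shows "osc_le (semi S q (real k * T) f) (b / 2 ^ k)"
proof (induction k)
  case 0 then show ?case using assms semi_0 by (simp add: osc_le_def)
next
  case (Suc k)
  have "osc_le (semi S q T (semi S q (real k * T) f)) (b / 2 ^ k / 2)"
    using Suc assms by (intro osc_semi_T) auto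
  moreover have "semi S q (real (Suc k) * T) f X = semi S q T (semi S q (real k * T) f) X" if "X \<in> S" for X
    using semi_semi[of T "real k * T" X f] T_pos that by (simp add: algebra_simps)
  ultimately show ?case by (simp add: osc_le_def mult.commute)
qed

definition \<kappa> :: real where "\<kappa> = ln 2 / T"

lemma kappa_pos: "\<kappa> > 0" unfolding \<kappa>_def using T_pos by simp

text \<open>The factor 2 pays for rounding \<open>t / T\<close> down to an integer.\<close>

lemma osc_decay:
  assumes "osc_le f b" "b > 0" "0 \<le> t" shows "osc_le (semi S q t f) (2 * b * exp (- \<kappa> * t))"
proof -
  define k where "k = nat \<lfloor>t / T\<rfloor>"
  have tT: "0 \<le> t / T" using assms T_pos by simp
  then have k: "real k \<le> t / T" "t / T < real k + 1" unfolding k_def by linarith+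
  then have s: "0 \<le> t - real k * T" using T_pos by (simp add: field_simps)
  have "osc_le (semi S q (t - real k * T) (semi S q (real k * T) f)) (b / 2 ^ k)"
    by (intro osc_semi osc_semi_kT assms s)
  moreover have "semi S q t f X = semi S q (t - real k * T) (semi S q (real k * T) f) X" if "X \<in> S" for X
    using semi_semi[OF s _ that, of "real k * T" f] T_pos by simp
  ultimately have o: "osc_le (semi S q t f) (b / 2 ^ k)" by (simp add: osc_le_def)
  have "\<kappa> * t - ln 2 \<le> real k * ln 2"
  proof -
    have "(t / T) * ln 2 \<le> (real k + 1) * ln 2" using k by (intro mult_right_mono) auto
    then show ?thesis unfolding \<kappa>_def by (simp add: algebra_simps)
  qed
  then have "exp (- (real k * ln 2)) \<le> exp (ln 2 - \<kappa> * t)" by simp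
  also have "exp (ln 2 - \<kappa> * t) = 2 * exp (- \<kappa> * t)" by (simp add: exp_diff exp_minus field_simps)
  finally have "1 / 2 ^ k \<le> 2 * exp (- \<kappa> * t)"
    by (simp add: exp_minus exp_of_nat_mult field_simps)
  then have "b * (1 / 2 ^ k) \<le> b * (2 * exp (- \<kappa> * t))" using assms(2) by (intro mult_left_mono) auto
  then show ?thesis using o unfolding osc_le_def by (auto simp: mult_ac intro: order_trans)
qed

text \<open>The limit is taken from \<open>x0\<close> along multiples of \<open>T\<close> only. It
  exists by \<open>convergent_semi\<close>, and \<open>equil_eq\<close> identifies it with the
  measure described by \<open>equil\<close>.\<close>

definition equilibrium :: "'s \<Rightarrow> real" where
  "equilibrium Y = (if Y \<in> S then lim (\<lambda>k. transP S q (real k * T) x0 Y) else 0)"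

definition eq_mean :: "('s \<Rightarrow> real) \<Rightarrow> real" where
  "eq_mean f = (\<Sum>Y\<in>S. equilibrium Y * f Y)"

lemma osc_ex: "\<exists>b>0. osc_le f b"
proof -
  have "f X - f Y \<le> 2 * (\<Sum>Z\<in>S. \<bar>f Z\<bar>) + 1" if "X \<in> S" "Y \<in> S" for X Y
    using member_le_sum[of X S "\<lambda>Z. \<bar>f Z\<bar>"] member_le_sum[of Y S "\<lambda>Z. \<bar>f Z\<bar>"] fin that by auto
  moreover have "2 * (\<Sum>Z\<in>S. \<bar>f Z\<bar>) + 1 > 0" using sum_nonneg[of S "\<lambda>Z. \<bar>f Z\<bar>"] by (simp add: add_nonneg_pos)
  ultimately show ?thesis unfolding osc_le_def by blast
qed

lemma semi_close:
  assumes "osc_le f b" "0 \<le> t" "X \<in> S" "Y \<in> S"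
  shows "\<bar>semi S q t f X - f Y\<bar> \<le> b"
proof -
  have "semi S q t f X \<le> f Y + b"
    using assms by (intro semi_le) (auto simp: osc_le_def algebra_simps)
  moreover have "f Y - b \<le> semi S q t f X"
    using assms by (intro semi_ge) (auto simp: osc_le_def algebra_simps)
  ultimately show ?thesis by (simp add: abs_le_iff)
qed

lemma semi_decay_later:
  assumes "osc_le f b" "b > 0" "0 \<le> t" "t \<le> s" "X \<in> S" "Y \<in> S"
  shows "\<bar>semi S q s f X - semi S q t f Y\<bar> \<le> 2 * b * exp (- \<kappa> * t)"
  using semi_close[OF osc_decay[OF assms(1-3)], of "s - t" X Y] semi_semi[of "s - t" t X f] assms by simp

text \<open>The semigroup averages: from time \<open>k T\<close> on, all values stay within the
  oscillation left at that time, which decays geometrically.\<close>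

lemma convergent_semi: "convergent (\<lambda>k. semi S q (real k * T) f x0)"
proof -
  obtain b where b: "b > 0" "osc_le f b" using osc_ex by auto
  have "(\<lambda>k. b / 2 ^ k) \<longlonglongrightarrow> 0"
    using tendsto_mult_right_zero[OF LIMSEQ_inverse_realpow_zero[of 2], of b] by (simp add: field_simps)
  have d: "\<bar>semi S q (real m * T) f x0 - semi S q (real k * T) f x0\<bar> \<le> b / 2 ^ k" if "k \<le> m" for k m
    using semi_close[OF osc_semi_kT[OF b(2,1)], of "real m * T - real k * T" x0 x0 k]
      semi_semi[of "real m * T - real k * T" "real k * T" x0 f] that T_pos x0 by simp
  have "Cauchy (\<lambda>k. semi S q (real k * T) f x0)"
  proof (rule metric_CauchyI)
    fix e :: real assume "e > 0"
    then obtain N where N: "\<And>k. k \<ge> N \<Longrightarrow> b / 2 ^ k < e / 2"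
      using LIMSEQ_D[OF \<open>(\<lambda>k. b / 2 ^ k) \<longlonglongrightarrow> 0\<close>, of "e/2"] b by auto
    show "\<exists>M. \<forall>m\<ge>M. \<forall>n\<ge>M. dist (semi S q (real m * T) f x0) (semi S q (real n * T) f x0) < e"
    proof (intro exI[of _ N] allI impI)
      fix m n assume "N \<le> m" "N \<le> n"
      then show "dist (semi S q (real m * T) f x0) (semi S q (real n * T) f x0) < e"
        using d[of N m] d[of N n] N[of N] unfolding dist_real_def by linarith
    qed
  qed
  then show ?thesis by (rule Cauchy_convergent)
qed

lemma semi_indicator: "Y \<in> S \<Longrightarrow> semi S q t (\<lambda>Z. if Z = Y then 1 else 0) X = transP S q t X Y"
  unfolding semi_def using fin by (simp add: if_distrib[of "\<lambda>z. _ * z"] cong: if_cong)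

lemma eq_mean_lim: "(\<lambda>k. semi S q (real k * T) f x0) \<longlonglongrightarrow> eq_mean f"
proof -
  have "(\<lambda>k. transP S q (real k * T) x0 Y) \<longlonglongrightarrow> equilibrium Y" if "Y \<in> S" for Y
    using convergent_semi[of "\<lambda>Z. if Z = Y then 1 else 0"] that
    by (simp add: semi_indicator equilibrium_def convergent_LIMSEQ_iff)
  then show ?thesis unfolding semi_def eq_mean_def by (intro tendsto_sum tendsto_mult tendsto_const) auto
qed

lemma eq_mean_bound:
  assumes "osc_le f b" "b > 0" "0 \<le> t" "X \<in> S"
  shows "\<bar>semi S q t f X - eq_mean f\<bar> \<le> 2 * b * exp (- \<kappa> * t)"
proof (rule tendsto_upperbound)
  show "(\<lambda>k. \<bar>semi S q t f X - semi S q (real k * T) f x0\<bar>) \<longlonglongrightarrow> \<bar>semi S q t f X - eq_mean f\<bar>"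
    by (intro tendsto_intros eq_mean_lim)
  obtain N :: nat where N: "t / T < real N" using reals_Archimedean2 by blast
  have "t \<le> real k * T" if "k \<ge> N" for k
  proof -
    have "t / T \<le> real k" using N that by linarith
    then show ?thesis using T_pos by (simp add: field_simps)
  qed
  then show "\<forall>\<^sub>F k in sequentially. \<bar>semi S q t f X - semi S q (real k * T) f x0\<bar> \<le> 2 * b * exp (- \<kappa> * t)"
    using semi_decay_later[OF assms(1-3) _ x0 assms(4)]
    by (intro eventually_sequentiallyI[of N]) (subst abs_minus_commute, blast)
qed simp

lemma exp_lim: "((\<lambda>t. c * exp (- \<kappa> * t)) \<longlongrightarrow> 0) at_top"
proof -
  have "((\<lambda>t. exp (- (\<kappa> * t))) \<longlongrightarrow> 0) at_top"
    using kappa_pos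
    by (intro filterlim_compose[OF exp_at_bot] filterlim_uminus_at_top[THEN iffD1]
        filterlim_tendsto_pos_mult_at_top[OF tendsto_const] filterlim_ident) auto
  from tendsto_mult_right_zero[OF this, of c] show ?thesis by simp
qed

lemma semi_tendsto_eq_mean: "X \<in> S \<Longrightarrow> ((\<lambda>t. semi S q t f X) \<longlongrightarrow> eq_mean f) at_top"
proof -
  assume X: "X \<in> S"
  obtain b where b: "b > 0" "osc_le f b" using osc_ex by auto
  have "((\<lambda>t. semi S q t f X - eq_mean f) \<longlongrightarrow> 0) at_top"
    by (rule Lim_null_comparison[OF _ exp_lim[of "2 * b"]],
        rule eventually_mono[OF eventually_ge_at_top[of 0]])
       (use eq_mean_bound[OF b(2,1) _ X] in simp)
  then show ?thesis by (simp add: LIM_zero_iff)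
qed

lemma eq_mean_semi: "0 \<le> s \<Longrightarrow> eq_mean (semi S q s f) = eq_mean f"
proof -
  assume s: "0 \<le> s"
  have "((\<lambda>t. semi S q (t + s) f x0) \<longlongrightarrow> eq_mean f) at_top"
    by (subst add.commute) (intro filterlim_compose[OF semi_tendsto_eq_mean[OF x0]]
       filterlim_tendsto_add_at_top[OF tendsto_const filterlim_ident])
  moreover have "\<forall>\<^sub>F t in at_top. semi S q (t + s) f x0 = semi S q t (semi S q s f) x0"
    by (rule eventually_mono[OF eventually_ge_at_top[of 0]]) (simp add: semi_semi s x0)
  ultimately have "((\<lambda>t. semi S q t (semi S q s f) x0) \<longlongrightarrow> eq_mean f) at_top"
    by (simp add: tendsto_cong)
  then show ?thesis using semi_tendsto_eq_mean[OF x0, of "semi S q s f"] tendsto_unique trivial_limit_at_top_linorder by blast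
qed

text \<open>Stationarity, as the derivative at 0 of the constant
  \<open>eq_mean (semi S q s f)\<close>. Constancy is known only for \<open>s \<ge> 0\<close>, hence
  the two one-sided sign arguments.\<close>

lemma eq_mean_gen: "eq_mean (gen S q f) = 0"
proof -
  have d: "((\<lambda>s. eq_mean (semi S q s f)) has_real_derivative eq_mean (gen S q f)) (at 0)"
  proof -
    have "((\<lambda>s. eq_mean (semi S q s f)) has_real_derivative (\<Sum>Y\<in>S. equilibrium Y * gen S q (semi S q 0 f) Y)) (at 0)"
      unfolding eq_mean_def by (intro DERIV_sum DERIV_cmult semi_deriv)
    also have "(\<Sum>Y\<in>S. equilibrium Y * gen S q (semi S q 0 f) Y) = eq_mean (gen S q f)"
      unfolding eq_mean_def by (intro sum.cong refl arg_cong2[where f="(*)"] gen_cong semi_0)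
    finally show ?thesis .
  qed
  have c: "eq_mean (semi S q h f) = eq_mean (semi S q 0 f)" if "h > 0" for h
    using eq_mean_semi[of h f] eq_mean_semi[of 0 f] that by simp
  have "\<not> eq_mean (gen S q f) > 0"
  proof
    assume "eq_mean (gen S q f) > 0"
    from DERIV_pos_inc_right[OF d this] obtain h where h: "h > 0"
      "\<And>k. 0 < k \<Longrightarrow> k < h \<Longrightarrow> eq_mean (semi S q 0 f) < eq_mean (semi S q (0 + k) f)" by blast
    show False using h(2)[of "h/2"] c[of "h/2"] h(1) by simp
  qed
  moreover have "\<not> eq_mean (gen S q f) < 0"
  proof
    assume "eq_mean (gen S q f) < 0"
    from DERIV_neg_dec_right[OF d this] obtain h where h: "h > 0"
      "\<And>k. 0 < k \<Longrightarrow> k < h \<Longrightarrow> eq_mean (semi S q 0 f) > eq_mean (semi S q (0 + k) f)" by blast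
    show False using h(2)[of "h/2"] c[of "h/2"] h(1) by simp
  qed
  ultimately show ?thesis by linarith
qed

lemma gen_indicator:
  assumes "X \<in> S" "Y \<in> S" shows "gen S q (\<lambda>Z. if Z = Y then 1 else 0) X = genQ S q X Y"
  using genQ_row[OF assms(1), of "\<lambda>Z. if Z = Y then 1 else 0"] assms(2) fin
  by (simp add: if_distrib[of "\<lambda>z. _ * z"] cong: if_cong)

text \<open>Uniqueness: if \<open>p\<close> annihilates the generator, the \<open>p\<close>-mean of
  \<open>semi S q s f\<close> does not depend on \<open>s\<close>. Letting \<open>s\<close> tend to
  infinity it equals \<open>eq_mean f\<close>, and indicators recover \<open>p\<close>.\<close>

lemma equil_eq: "equil S q = equilibrium"
  unfolding equil_def
proof (rule the_equality)
  have "0 \<le> equilibrium X" if "X \<in> S" for X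
  proof (rule tendsto_lowerbound)
    show "(\<lambda>k. semi S q (real k * T) (\<lambda>Z. if Z = X then 1 else 0) x0) \<longlonglongrightarrow> equilibrium X"
      using eq_mean_lim[of "\<lambda>Z. if Z = X then 1 else 0"] that fin unfolding eq_mean_def
      by (simp add: if_distrib[of "\<lambda>z. _ * z"] cong: if_cong)
    show "\<forall>\<^sub>F k in sequentially. 0 \<le> semi S q (real k * T) (\<lambda>Z. if Z = X then 1 else 0) x0"
      using T_pos x0 by (intro always_eventually allI semi_ge) auto
  qed simp
  moreover have "(\<Sum>X\<in>S. equilibrium X) = 1"
  proof -
    have "(\<lambda>k. semi S q (real k * T) (\<lambda>_. 1) x0) \<longlonglongrightarrow> eq_mean (\<lambda>_. 1)" by (rule eq_mean_lim)
    moreover have "semi S q (real k * T) (\<lambda>_. 1) x0 = 1" for k using semi_const x0 T_pos by simp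
    ultimately have "eq_mean (\<lambda>_. 1) = 1" by (simp add: LIMSEQ_const_iff)
    then show ?thesis by (simp add: eq_mean_def)
  qed
  moreover have "(\<Sum>X\<in>S. equilibrium X * genQ S q X Y) = 0" if "Y \<in> S" for Y
    using eq_mean_gen[of "\<lambda>Z. if Z = Y then 1 else 0"] that unfolding eq_mean_def by (simp add: gen_indicator cong: sum.cong)
  ultimately show "(\<forall>X. X \<notin> S \<longrightarrow> equilibrium X = 0) \<and> (\<forall>X\<in>S. 0 \<le> equilibrium X) \<and>
     sum equilibrium S = 1 \<and> (\<forall>Y\<in>S. (\<Sum>X\<in>S. equilibrium X * genQ S q X Y) = 0)"
    by (auto simp: equilibrium_def)
  fix p assume p: "(\<forall>X. X \<notin> S \<longrightarrow> p X = 0) \<and> (\<forall>X\<in>S. 0 \<le> p X) \<and>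
     sum p S = 1 \<and> (\<forall>Y\<in>S. (\<Sum>X\<in>S. p X * genQ S q X Y) = 0)"
  have p0: "(\<Sum>X\<in>S. p X * gen S q f X) = 0" for f
  proof -
    have "(\<Sum>X\<in>S. p X * gen S q f X) = (\<Sum>X\<in>S. \<Sum>Z\<in>S. p X * genQ S q X Z * f Z)"
      by (intro sum.cong refl) (simp add: genQ_row[symmetric] sum_distrib_left mult_ac)
    also have "\<dots> = (\<Sum>Z\<in>S. (\<Sum>X\<in>S. p X * genQ S q X Z) * f Z)"
      by (subst sum.swap) (simp add: sum_distrib_right)
    finally show ?thesis using p by simp
  qed
  have pf: "(\<Sum>X\<in>S. p X * f X) = eq_mean f" for f
  proof -
    define F where "F s = (\<Sum>X\<in>S. p X * semi S q s f X)" for s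
    have "(F has_real_derivative 0) (at s)" for s
    proof -
      have "(F has_real_derivative (\<Sum>X\<in>S. p X * gen S q (semi S q s f) X)) (at s)"
        unfolding F_def by (intro DERIV_sum DERIV_cmult semi_deriv)
      then show ?thesis by (simp add: p0)
    qed
    then have "F s = F 0" for s by (intro DERIV_isconst_all) auto
    moreover have "(F \<longlongrightarrow> (\<Sum>X\<in>S. p X * eq_mean f)) at_top"
      unfolding F_def by (intro tendsto_sum tendsto_mult tendsto_const semi_tendsto_eq_mean)
    ultimately have "((\<lambda>s::real. F 0) \<longlongrightarrow> (\<Sum>X\<in>S. p X * eq_mean f)) at_top"
      by (metis (mono_tags, lifting) tendsto_cong eventually_at_top_linorder)
    then have "F 0 = (\<Sum>X\<in>S. p X * eq_mean f)"
      by (simp add: tendsto_const_iff)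
    moreover have "F 0 = (\<Sum>X\<in>S. p X * f X)" unfolding F_def by (simp add: semi_0)
    ultimately show ?thesis using p by (simp add: sum_distrib_right[symmetric])
  qed
  show "p = equilibrium"
  proof
    fix Y show "p Y = equilibrium Y"
    proof (cases "Y \<in> S")
      case True
      then show ?thesis using pf[of "\<lambda>Z. if Z = Y then 1 else 0"] fin unfolding eq_mean_def
        by (simp add: if_distrib[of "\<lambda>z. _ * z"] cong: if_cong)
    next
      case False then show ?thesis using p by (simp add: equilibrium_def)
    qed
  qed
qed

section \<open>The Stein solution and its linear functionals\<close>

definition stein :: "('s \<Rightarrow> real) \<Rightarrow> 's \<Rightarrow> real" where
  "stein f X = - integral {0..} (\<lambda>t. semi S q t f X - eq_mean f)"

lemma continuous_semi: "X \<in> S \<Longrightarrow> continuous_on A (\<lambda>t. semi S q t f X)"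
  using DERIV_isCont[OF semi_deriv] continuous_at_imp_continuous_on by blast

lemma measurable_semi:
  "X \<in> S \<Longrightarrow> (\<lambda>t. semi S q t f X - eq_mean f) \<in> borel_measurable (lebesgue_on {a..})"
  by (intro continuous_imp_measurable_on_sets_lebesgue continuous_intros continuous_semi) auto

context
  fixes f :: "'s \<Rightarrow> real" assumes f01: "\<And>X. X \<in> S \<Longrightarrow> 0 \<le> f X \<and> f X \<le> 1"
begin

lemma stein_integrand_bound: "0 \<le> t \<Longrightarrow> X \<in> S \<Longrightarrow> \<bar>semi S q t f X - eq_mean f\<bar> \<le> 2 * exp (- \<kappa> * t)"
proof -
  have "f X - f Y \<le> 1" if "X \<in> S" "Y \<in> S" for X Y using f01[OF that(1)] f01[OF that(2)] by linarith
  then have "osc_le f 1" by (simp add: osc_le_def)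
  then show "0 \<le> t \<Longrightarrow> X \<in> S \<Longrightarrow> \<bar>semi S q t f X - eq_mean f\<bar> \<le> 2 * exp (- \<kappa> * t)" using eq_mean_bound[of f 1] by simp
qed

lemma exp_has_integral: "((\<lambda>t. c * exp (- \<kappa> * (t - a))) has_integral c / \<kappa>) {a..}"
proof -
  have "((\<lambda>t. (c * exp (\<kappa> * a)) * exp (- \<kappa> * t)) has_integral (c * exp (\<kappa> * a)) * (exp (- \<kappa> * a) / \<kappa>)) {a..}"
    by (intro has_integral_mult_right has_integral_exp_minus_to_infinity kappa_pos)
  moreover have "(c * exp (\<kappa> * a)) * exp (- \<kappa> * t) = c * exp (- \<kappa> * (t - a))" for t
    by (simp add: algebra_simps exp_add[symmetric])
  moreover have "(c * exp (\<kappa> * a)) * (exp (- \<kappa> * a) / \<kappa>) = c / \<kappa>"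
    by (simp add: exp_minus)
  ultimately show ?thesis by (simp only:)
qed

text \<open>Here \<open>2 / \<kappa> = 2 T / ln 2\<close>, and
  \<open>ln 2 \<ge> 2/3\<close>.\<close>

lemma two_div_kappa: "2 / \<kappa> \<le> 3 * T"
  using ln2_ge_two_thirds T_pos unfolding \<kappa>_def by (simp add: field_simps)

lemma stein_bound: "X \<in> S \<Longrightarrow> \<bar>stein f X\<bar> \<le> 3 * T"
proof -
  assume X: "X \<in> S"
  have "norm (integral {0..} (\<lambda>t. semi S q t f X - eq_mean f)) \<le> 2 / \<kappa>"
    using exp_has_integral[of 2 0] stein_integrand_bound X
    by (intro integral_norm_bound_integral'[where g="\<lambda>t. 2 * exp (- \<kappa> * (t - 0))"] measurable_semi) auto
  then show ?thesis unfolding stein_def using two_div_kappa by simp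
qed

lemma stein_integrable: "X \<in> S \<Longrightarrow> (\<lambda>t. semi S q t f X - eq_mean f) integrable_on {0..}"
  by (rule measurable_bounded_by_integrable_imp_integrable[where g="\<lambda>t. 2 * exp (- \<kappa> * (t - 0))"])
     (use exp_has_integral[of 2 0] stein_integrand_bound in \<open>auto intro!: measurable_semi simp: integrable_on_def\<close>)

text \<open>Weights of total mass zero, such as those of a difference, cancel the equilibrium mean.
  Time is cut into three: a trivial bound up to \<open>\<tau>\<close>, the smoothing bound
  \<open>\<beta>\<close> up to \<open>T0\<close>, and after \<open>T0\<close> the smoothing over
  \<open>[0, T0]\<close> applied to a function that has already relaxed for time
  \<open>t - T0\<close>. Its exponential decay has total mass at most \<open>3 T\<close>.\<close>

lemma stein_functional:
  fixes c :: "'i \<Rightarrow> real" and x :: "'i \<Rightarrow> 's"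
  assumes I: "finite I" "\<And>i. i \<in> I \<Longrightarrow> x i \<in> S" "(\<Sum>i\<in>I. c i) = 0"
    and T0: "0 \<le> \<tau>" "\<tau> \<le> T0"
    and small: "\<And>g t. (\<And>X. X \<in> S \<Longrightarrow> \<bar>g X\<bar> \<le> 1) \<Longrightarrow> 0 \<le> t \<Longrightarrow> \<bar>\<Sum>i\<in>I. c i * semi S q t g (x i)\<bar> \<le> C0"
    and large: "\<And>g t. (\<And>X. X \<in> S \<Longrightarrow> \<bar>g X\<bar> \<le> 1) \<Longrightarrow> \<tau> \<le> t \<Longrightarrow> t \<le> T0 \<Longrightarrow> \<bar>\<Sum>i\<in>I. c i * semi S q t g (x i)\<bar> \<le> \<beta> t"
    and int: "(\<beta> has_integral Ib) {\<tau>..T0}"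
  shows "\<bar>\<Sum>i\<in>I. c i * stein f (x i)\<bar> \<le> C0 * \<tau> + Ib + \<beta> T0 * (3 * T)"
proof -
  define \<phi> where "\<phi> t = (\<Sum>i\<in>I. c i * (semi S q t f (x i) - eq_mean f))" for t
  have f1: "\<And>X. X \<in> S \<Longrightarrow> \<bar>f X\<bar> \<le> 1" using f01 by (simp add: abs_le_iff)
  have phi: "\<phi> t = (\<Sum>i\<in>I. c i * semi S q t f (x i))" for t
    unfolding \<phi>_def using I(3) by (simp add: algebra_simps sum_subtractf sum_distrib_right[symmetric])
  have "(\<Sum>i\<in>I. c i * stein f (x i)) = - integral {0..} \<phi>"
    unfolding stein_def \<phi>_def using I
    by (subst integral_sum) (auto intro!: integrable_on_mult_right stein_integrable simp: sum_negf)
  have cont: "continuous_on A \<phi>" for A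
    unfolding \<phi>_def using I by (intro continuous_intros continuous_semi) auto
  have tail: "\<bar>\<phi> t\<bar> \<le> 2 * \<beta> T0 * exp (- \<kappa> * (t - T0))" if t: "t \<ge> T0" for t
  proof -
    define e where "e = 2 * exp (- \<kappa> * (t - T0))"
    have e: "e > 0" by (simp add: e_def)
    \<comment> \<open>The relaxed function, normalised by its own bound \<open>e\<close>, is again a
      test function for the hypothesis \<open>large\<close> at time \<open>T0\<close>.\<close>
    define g where "g Y = (1 / e) * (semi S q (t - T0) f Y - eq_mean f)" for Y
    have g1: "\<bar>g Y\<bar> \<le> 1" if "Y \<in> S" for Y
      using stein_integrand_bound[of "t - T0" Y] that t e unfolding g_def e_def by (simp add: abs_mult field_simps)
    have "semi S q T0 g X = (1 / e) * (semi S q t f X - eq_mean f)" if "X \<in> S" for X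
      unfolding g_def semi_scale semi_diff
      using semi_semi[of T0 "t - T0" X f] semi_const[of T0 X "eq_mean f"] that t T0 by simp
    then have "(\<Sum>i\<in>I. c i * semi S q T0 g (x i)) = (1 / e) * \<phi> t"
      unfolding \<phi>_def sum_distrib_left using I by (intro sum.cong) auto
    then have "\<bar>(1 / e) * \<phi> t\<bar> \<le> \<beta> T0" using large[of g T0] g1 T0 by simp
    then show ?thesis using e unfolding abs_mult by (simp add: field_simps e_def)
  qed
  have i1: "norm (integral {0..\<tau>} \<phi>) \<le> C0 * \<tau>"
    using T0 small[OF f1] has_integral_const_real[of C0 0 \<tau>] unfolding phi
    by (intro integral_norm_bound_integral'[where g="\<lambda>_. C0"] continuous_imp_measurable_on_sets_lebesgue cont[unfolded phi[abs_def]])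
      (auto simp: mult.commute)
  have i2: "norm (integral {\<tau>..T0} \<phi>) \<le> Ib"
    using T0 large[OF f1] int unfolding phi
    by (intro integral_norm_bound_integral'[where g=\<beta>] continuous_imp_measurable_on_sets_lebesgue cont[unfolded phi[abs_def]]) auto
  have i3: "norm (integral {T0..} \<phi>) \<le> 2 * \<beta> T0 / \<kappa>"
    using tail exp_has_integral[of "2 * \<beta> T0" T0]
    by (intro integral_norm_bound_integral'[where g="\<lambda>t. 2 * \<beta> T0 * exp (- \<kappa> * (t - T0))"] continuous_imp_measurable_on_sets_lebesgue cont) auto
  have "integral {0..} \<phi> = integral {0..\<tau>} \<phi> + integral {\<tau>..T0} \<phi> + integral {T0..} \<phi>"
  proof -
    have e1: "{0..} = {0..T0} \<union> {T0..}" "{0..T0} = {0..\<tau>} \<union> {\<tau>..T0}" using T0 by auto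
    have "integral {0..T0} \<phi> = integral {0..\<tau>} \<phi> + integral {\<tau>..T0} \<phi>"
      using T0 by (intro Henstock_Kurzweil_Integration.integral_combine[symmetric] integrable_continuous_interval cont) auto
    moreover have "integral {0..} \<phi> = integral {0..T0} \<phi> + integral {T0..} \<phi>"
    proof (subst e1(1), rule integral_Un)
      show "\<phi> integrable_on {0..T0}" by (intro integrable_continuous_interval cont)
      have "negligible ({0..T0} \<inter> {T0..})" by (rule negligible_subset[of "{T0}"]) auto
      then show "negligible ({0..T0} \<inter> {T0..})" .
      show "\<phi> integrable_on {T0..}"
      proof (rule measurable_bounded_by_integrable_imp_integrable)
        show "\<phi> \<in> borel_measurable (lebesgue_on {T0..})"
          by (rule continuous_imp_measurable_on_sets_lebesgue[OF cont]) simp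
        show "(\<lambda>t. 2 * \<beta> T0 * exp (- \<kappa> * (t - T0))) integrable_on {T0..}"
          using exp_has_integral unfolding integrable_on_def by blast
      qed (use tail in auto)
    qed
    ultimately show ?thesis by simp
  qed
  then have "\<bar>integral {0..} \<phi>\<bar> \<le> C0 * \<tau> + Ib + 2 * \<beta> T0 / \<kappa>" using i1 i2 i3 by simp
  moreover have "0 \<le> \<beta> T0" using large[of f T0] f1 T0 by (smt (verit) abs_ge_zero)
  then have "\<beta> T0 * (2 / \<kappa>) \<le> \<beta> T0 * (3 * T)" using two_div_kappa by (rule mult_left_mono[rotated])
  ultimately show ?thesis
    using \<open>(\<Sum>i\<in>I. c i * stein f (x i)) = - integral {0..} \<phi>\<close> by (simp add: mult.commute)
qed

end

end

section \<open>Bernstein estimates for chains with affine rates\<close>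

definition tr :: "(nat \<Rightarrow> int) \<Rightarrow> (nat \<Rightarrow> int) \<Rightarrow> nat \<Rightarrow> int" where
  "tr X J = (\<lambda>i. X i + J i)"

lemma tr_commute: "tr (tr X J) K = tr (tr X K) J"
  unfolding tr_def by (simp add: algebra_simps)

lemma Dj_tr: "Dj j h X = h (tr X (unitv j)) - h X"
  unfolding Dj_def tr_def ..

lemma Dj_commute: "Dj i (Dj j h) X = Dj j (Dj i h) X"
  unfolding Dj_tr by (simp add: tr_commute[of X "unitv i"])

lemma inj_unitv: "inj (unitv :: nat \<Rightarrow> nat \<Rightarrow> 'a::zero_neq_one)"
  unfolding inj_def unitv_def by (metis zero_neq_one)

lemma mv_add: "mv d M (\<lambda>i. x i + y i) = (\<lambda>i. mv d M x i + mv d M y i)"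
  unfolding mv_def by (auto simp: algebra_simps sum.distrib)

lemma mv_scale: "mv d M (\<lambda>i. a * x i) = (\<lambda>i. a * mv d M x i)"
  unfolding mv_def by (auto simp: algebra_simps sum_distrib_left)

lemma mv_diff: "mv d M (\<lambda>i. x i - y i) = (\<lambda>i. mv d M x i - mv d M y i)"
  unfolding mv_def by (auto simp: algebra_simps sum_subtractf)

lemma mv_sum: "mv d M (\<lambda>i. \<Sum>J\<in>K. c J * x J i) = (\<lambda>i. \<Sum>J\<in>K. c J * mv d M (x J) i)"
proof
  fix i show "mv d M (\<lambda>i. \<Sum>J\<in>K. c J * x J i) i = (\<Sum>J\<in>K. c J * mv d M (x J) i)"
    unfolding mv_def by (auto simp: sum_distrib_left mult_ac intro: sum.swap)
qed

lemma qform_polar: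
  assumes "msym d M"
  shows "qform d M y - qform d M x = 2 * ip d x (mv d M (\<lambda>i. y i - x i)) + qform d M (\<lambda>i. y i - x i)"
proof -
  have "ip d y (mv d M x) = ip d x (mv d M y)" by (rule ip_mv_sym[OF assms])
  then show ?thesis
    unfolding qform_ip mv_diff ip_diff_right
    by (simp add: ip_commute[of d "\<lambda>i. y i - x i"] ip_diff_right ip_commute[of d "mv d M y"] ip_commute[of d "mv d M x"])
qed

text \<open>Weighted arithmetic-geometric mean inequality, from the nonnegativity of the form at
  \<open>s x - y\<close>.\<close>

lemma qform_young:
  assumes "msym d M" "\<And>v. 0 \<le> qform d M v" "s > 0"
  shows "2 * ip d x (mv d M y) \<le> s * qform d M x + (1 / s) * qform d M y"
proof -
  have "ip d y (mv d M x) = ip d x (mv d M y)" by (rule ip_mv_sym[OF assms(1)])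
  then have "qform d M (\<lambda>i. s * x i - y i) = s * s * qform d M x - 2 * s * ip d x (mv d M y) + qform d M y"
    unfolding qform_ip mv_diff mv_scale ip_diff_right ip_scale_right
    by (simp add: ip_commute[of d "\<lambda>i. s * x i - y i"] ip_diff_right ip_scale_right
       ip_commute[of d "mv d M y"] ip_commute[of d "mv d M x"] algebra_simps)
  then have "0 \<le> s * s * qform d M x - 2 * s * ip d x (mv d M y) + qform d M y" using assms(2) by metis
  then have "s * (2 * ip d x (mv d M y)) \<le> s * (s * qform d M x + (1 / s) * qform d M y)"
    using assms(3) by (simp add: algebra_simps)
  then show ?thesis using assms(3) by simp
qed

text \<open>\<open>S\<close> is the state space and \<open>U\<close> the part of it where jumps from nearby points are never
  suppressed. On \<open>S\<close> the rates are affine, with slopes \<open>A\<close> for the jumps \<open>unitv k\<close>.\<close>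
locale linear_chain = finite_chain S q for S :: "(nat \<Rightarrow> int) set" and q +
  fixes d :: nat and Js :: "(nat \<Rightarrow> int) set" and r :: "(nat \<Rightarrow> int) \<Rightarrow> (nat \<Rightarrow> int) \<Rightarrow> real"
    and U :: "(nat \<Rightarrow> int) set" and A Sig :: "nat \<Rightarrow> nat \<Rightarrow> real" and m l1 l2 a \<alpha> :: real
  assumes finJ: "finite Js" and unitJ: "k < d \<Longrightarrow> unitv k \<in> Js"
    and r_nonneg: "X \<in> S \<Longrightarrow> J \<in> Js \<Longrightarrow> 0 \<le> r J X"
    and r_ge: "X \<in> S \<Longrightarrow> k < d \<Longrightarrow> m \<le> r (unitv k) X"
    and gen_jumps: "X \<in> S \<Longrightarrow> gen S q f X = (\<Sum>J\<in>Js. (if tr X J \<in> S then r J X else 0) * (f (tr X J) - f X))"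
    and r_unit: "X \<in> S \<Longrightarrow> tr X (unitv j) \<in> S \<Longrightarrow> j < d \<Longrightarrow> k < d \<Longrightarrow>
        r (unitv k) (tr X (unitv j)) = r (unitv k) X + A k j"
    and r_other: "X \<in> S \<Longrightarrow> tr X (unitv j) \<in> S \<Longrightarrow> j < d \<Longrightarrow> J \<in> Js \<Longrightarrow> J \<notin> unitv ` {..<d} \<Longrightarrow>
        r J (tr X (unitv j)) = r J X"
    and U_S: "U \<subseteq> S"
    and U1: "X \<in> U \<Longrightarrow> i < d \<Longrightarrow> tr X (unitv i) \<in> S"
    and U2: "X \<in> U \<Longrightarrow> i < d \<Longrightarrow> j < d \<Longrightarrow> tr (tr X (unitv i)) (unitv j) \<in> S"
    and UJ: "X \<in> U \<Longrightarrow> J \<in> Js \<Longrightarrow> tr X J \<in> S"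
    and U1J: "X \<in> U \<Longrightarrow> i < d \<Longrightarrow> J \<in> Js \<Longrightarrow> tr (tr X (unitv i)) J \<in> S"
    and U2J: "X \<in> U \<Longrightarrow> i < d \<Longrightarrow> j < d \<Longrightarrow> J \<in> Js \<Longrightarrow> tr (tr (tr X (unitv i)) (unitv j)) J \<in> S"
    and symSig: "msym d Sig"
    and Sig_ge: "l1 * ip d v v \<le> qform d Sig v" and Sig_le: "qform d Sig v \<le> l2 * ip d v v"
    and A_le: "ip d (mv d A v) (mv d A v) \<le> a\<^sup>2 * ip d v v"
    and lyap: "2 * ip d v (mv d Sig (mv d (mtr A) v)) \<le> - 2 * \<alpha> * qform d Sig v"
    and pos: "0 < l1" "0 < l2" "0 < m" "0 < a" "0 < \<alpha>" "0 < d"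
    and m_large: "2 * l2 * a\<^sup>2 \<le> \<alpha> * m * l1"
begin

text \<open>The generator with no jump suppressed. Differences commute with it up to a linear term;
  \<open>gen\<close> agrees with it wherever all jumps stay in \<open>S\<close>.\<close>

definition G :: "((nat \<Rightarrow> int) \<Rightarrow> real) \<Rightarrow> (nat \<Rightarrow> int) \<Rightarrow> real" where
  "G f X = (\<Sum>J\<in>Js. r J X * (f (tr X J) - f X))"

lemma gen_G: "X \<in> S \<Longrightarrow> (\<And>J. J \<in> Js \<Longrightarrow> tr X J \<in> S) \<Longrightarrow> gen S q f X = G f X"
  unfolding G_def by (subst gen_jumps) auto

lemma A_col: "k < d \<Longrightarrow> (\<Sum>i<d. (A i k)\<^sup>2) \<le> a\<^sup>2"
proof -
  assume k: "k < d"
  have "ip d (mv d A (unitv k)) (mv d A (unitv k)) = (\<Sum>i<d. (A i k)\<^sup>2)"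
    unfolding ip_def using k by (intro sum.cong) (auto simp: mv_unitv power2_eq_square)
  moreover have "ip d (unitv k) (unitv k) = (1::real)" using k by (simp add: ip_unitv) (simp add: unitv_def)
  ultimately show ?thesis using A_le[of "unitv k"] by simp
qed

lemma sum_unit_le:
  fixes h :: "(nat \<Rightarrow> int) \<Rightarrow> real"
  assumes "\<And>J. J \<in> Js \<Longrightarrow> 0 \<le> h J" shows "(\<Sum>k<d. h (unitv k)) \<le> sum h Js"
proof -
  have "(\<Sum>k<d. h (unitv k)) = sum h (unitv ` {..<d})"
    by (subst sum.reindex) (auto intro: inj_on_subset[OF inj_unitv])
  also have "\<dots> \<le> sum h Js" using assms finJ unitJ by (intro sum_mono2) auto
  finally show ?thesis .
qed

text \<open>A unit step changes only the rates of the jumps \<open>unitv k\<close>, by the constants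
  \<open>A k j\<close>. The identity is exact because the correction is taken at the shifted
  point.\<close>

lemma commutator:
  assumes X: "X \<in> S" "tr X (unitv j) \<in> S" "j < d"
  shows "G u (tr X (unitv j)) - G u X = G (Dj j u) X + (\<Sum>k<d. A k j * Dj k u (tr X (unitv j)))"
proof -
  define Y where "Y = tr X (unitv j)"
  have rs: "r J Y = r J X + (\<Sum>k<d. if J = unitv k then A k j else 0)" if J: "J \<in> Js" for J
  proof (cases "J \<in> unitv ` {..<d}")
    case True
    then obtain k where k: "k < d" "J = unitv k" by auto
    have "(\<Sum>k'<d. if J = unitv k' then A k' j else 0) = (\<Sum>k'<d. if k = k' then A k' j else 0)"
      using k(2) inj_unitv by (intro sum.cong) (auto dest: injD)
    then show ?thesis using r_unit[OF X k(1)] k by (simp add: Y_def)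
  next
    case False
    then have "(\<Sum>k<d. if J = unitv k then A k j else 0) = 0" by (intro sum.neutral) auto
    then show ?thesis using r_other[OF X J False] by (simp add: Y_def)
  qed
  have "(\<Sum>J\<in>Js. (\<Sum>k<d. if J = unitv k then A k j else 0) * (u (tr Y J) - u Y))
     = (\<Sum>k<d. \<Sum>J\<in>Js. (if J = unitv k then A k j * (u (tr Y J) - u Y) else 0))"
    unfolding sum_distrib_right by (subst sum.swap) (intro sum.cong refl, auto)
  also have "\<dots> = (\<Sum>k<d. A k j * Dj k u Y)"
    using finJ unitJ by (intro sum.cong) (auto simp: Dj_tr)
  finally have s: "(\<Sum>J\<in>Js. (\<Sum>k<d. if J = unitv k then A k j else 0) * (u (tr Y J) - u Y)) = (\<Sum>k<d. A k j * Dj k u Y)" .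
  have "G u Y = (\<Sum>J\<in>Js. r J X * (u (tr Y J) - u Y)) + (\<Sum>k<d. A k j * Dj k u Y)"
    unfolding G_def s[symmetric] sum.distrib[symmetric] by (intro sum.cong) (auto simp: rs algebra_simps)
  moreover have "(\<Sum>J\<in>Js. r J X * (u (tr Y J) - u Y)) - G u X = G (Dj j u) X"
    unfolding G_def sum_subtractf[symmetric]
    by (intro sum.cong refl) (simp add: Dj_tr Y_def tr_commute[of X "unitv j"] algebra_simps)
  ultimately show ?thesis unfolding Y_def by simp
qed

definition grd :: "((nat \<Rightarrow> int) \<Rightarrow> real) \<Rightarrow> (nat \<Rightarrow> int) \<Rightarrow> nat \<Rightarrow> real" where
  "grd u X = (\<lambda>j. Dj j u X)"

text \<open>A gradient is a covector, so the weight is \<open>Sig\<close> and not its inverse: this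
  is the form for which the Lyapunov equation turns the term with \<open>mtr A\<close> into
  decay.\<close>

definition W :: "((nat \<Rightarrow> int) \<Rightarrow> real) \<Rightarrow> (nat \<Rightarrow> int) \<Rightarrow> real" where
  "W u X = qform d Sig (grd u X)"

definition Z :: "((nat \<Rightarrow> int) \<Rightarrow> real) \<Rightarrow> (nat \<Rightarrow> int) \<Rightarrow> real" where
  "Z u X = (\<Sum>i<d. \<Sum>j<d. (Dj i (Dj j u) X)\<^sup>2)"

lemma Sig_nonneg: "0 \<le> qform d Sig v"
  using Sig_ge[of v] ip_self_nonneg[of d v] pos by (meson mult_nonneg_nonneg less_imp_le order_trans)

text \<open>The excess of \<open>G\<close> of the square over \<open>2 u G u\<close> is the sum of
  \<open>r J X\<close> times squared increments. The unit jumps alone, with rates at least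
  \<open>m\<close>, give the squared gradient.\<close>

lemma G_square: "X \<in> U \<Longrightarrow> 2 * u X * G u X \<le> G (\<lambda>Y. (u Y)\<^sup>2) X - m / l2 * W u X"
proof -
  assume X: "X \<in> U"
  then have XS: "X \<in> S" using U_S by auto
  have "G (\<lambda>Y. (u Y)\<^sup>2) X = 2 * u X * G u X + (\<Sum>J\<in>Js. r J X * (u (tr X J) - u X)\<^sup>2)"
    unfolding G_def sum_distrib_left sum.distrib[symmetric]
    by (intro sum.cong) (auto simp: power2_eq_square algebra_simps)
  moreover have "m * ip d (grd u X) (grd u X) \<le> (\<Sum>k<d. r (unitv k) X * (u (tr X (unitv k)) - u X)\<^sup>2)"
    unfolding ip_def grd_def sum_distrib_left
    by (intro sum_mono) (auto simp: Dj_tr power2_eq_square intro!: mult_right_mono r_ge XS)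
  moreover have "(\<Sum>k<d. r (unitv k) X * (u (tr X (unitv k)) - u X)\<^sup>2) \<le> (\<Sum>J\<in>Js. r J X * (u (tr X J) - u X)\<^sup>2)"
    using r_nonneg[OF XS] by (intro sum_unit_le) auto
  moreover have "m / l2 * W u X \<le> m * ip d (grd u X) (grd u X)"
    unfolding W_def using Sig_le[of "grd u X"] pos by (simp add: field_simps)
  ultimately show ?thesis by linarith
qed

text \<open>\<open>v'\<close> is the time derivative of the gradient at \<open>X\<close> when
  \<open>u\<close> solves the backward equation. The squared increments of the gradient give a gain
  \<open>m * l1 * Z\<close>; half of it and half of the Lyapunov decay pay for the error
  \<open>e\<close>.\<close>

lemma bernstein_W:
  fixes u :: "(nat \<Rightarrow> int) \<Rightarrow> real"
  assumes X: "X \<in> U"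
  defines "v' \<equiv> (\<lambda>j. G (Dj j u) X + (\<Sum>k<d. A k j * Dj k u (tr X (unitv j))))"
  shows "2 * ip d (grd u X) (mv d Sig v') \<le> G (W u) X - \<alpha> * W u X - m * l1 / 2 * Z u X"
proof -
  have XS: "X \<in> S" using X U_S by auto
  define V where "V = grd u X"
  define dV where "dV J = (\<lambda>j. grd u (tr X J) j - V j)" for J
  \<comment> \<open>The cost of moving the linear term of \<open>commutator\<close> from the shifted
    point back to \<open>X\<close>: it consists of second differences.\<close>
  define e where "e = (\<lambda>j. \<Sum>k<d. A k j * Dj j (Dj k u) X)"
  have "v' j = (\<Sum>J\<in>Js. r J X * dV J j) + (mv d (mtr A) V j + e j)" if "j < d" for j
  proof -
    have "(\<Sum>k<d. A k j * Dj k u (tr X (unitv j))) = mv d (mtr A) V j + e j"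
      using that unfolding mv_def mtr_def e_def V_def grd_def
      by (simp add: sum.distrib[symmetric] Dj_tr algebra_simps)
    then show ?thesis unfolding v'_def G_def dV_def V_def grd_def by simp
  qed
  then have "mv d Sig v' = mv d Sig (\<lambda>j. (\<Sum>J\<in>Js. r J X * dV J j) + (mv d (mtr A) V j + e j))"
    unfolding mv_def by (intro ext) auto
  then have 1: "2 * ip d V (mv d Sig v') = (\<Sum>J\<in>Js. r J X * (2 * ip d V (mv d Sig (dV J))))
       + 2 * ip d V (mv d Sig (mv d (mtr A) V)) + 2 * ip d V (mv d Sig e)"
    by (simp only: mv_add mv_sum ip_add_right ip_sum_right) (simp add: distrib_left sum_distrib_left mult_ac)
  have "G (W u) X = (\<Sum>J\<in>Js. r J X * (2 * ip d V (mv d Sig (dV J)) + qform d Sig (dV J)))"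
    unfolding G_def W_def dV_def V_def by (intro sum.cong refl arg_cong2[where f="(*)"] qform_polar symSig)
  then have 2: "G (W u) X = (\<Sum>J\<in>Js. r J X * (2 * ip d V (mv d Sig (dV J)))) + (\<Sum>J\<in>Js. r J X * qform d Sig (dV J))"
    by (simp add: algebra_simps sum.distrib)
  have "m * l1 * Z u X = (\<Sum>i<d. m * (l1 * ip d (dV (unitv i)) (dV (unitv i))))"
    unfolding Z_def ip_def dV_def V_def grd_def sum_distrib_left
    by (intro sum.cong) (auto simp: Dj_tr power2_eq_square mult_ac)
  also have "\<dots> \<le> (\<Sum>i<d. r (unitv i) X * qform d Sig (dV (unitv i)))"
    using pos by (intro sum_mono mult_mono r_ge XS Sig_ge) (auto intro!: order_trans[OF _ r_ge[OF XS]] mult_nonneg_nonneg ip_self_nonneg)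
  also have "\<dots> \<le> (\<Sum>J\<in>Js. r J X * qform d Sig (dV J))"
    using r_nonneg[OF XS] Sig_nonneg by (intro sum_unit_le) auto
  finally have 3: "m * l1 * Z u X \<le> (\<Sum>J\<in>Js. r J X * qform d Sig (dV J))" .
  have 4: "2 * ip d V (mv d Sig (mv d (mtr A) V)) \<le> - 2 * \<alpha> * W u X"
    unfolding W_def V_def by (rule lyap)
  have "ip d e e \<le> (\<Sum>j<d. a\<^sup>2 * (\<Sum>k<d. (Dj j (Dj k u) X)\<^sup>2))"
    unfolding ip_def
  proof (intro sum_mono)
    fix j assume "j \<in> {..<d}" then have j: "j < d" by simp
    have "e j * e j \<le> (\<Sum>k<d. (A k j)\<^sup>2) * (\<Sum>k<d. (Dj j (Dj k u) X)\<^sup>2)"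
      using Cauchy_Schwarz_ineq_sum[of "\<lambda>k. A k j" "\<lambda>k. Dj j (Dj k u) X" "{..<d}"]
      unfolding e_def by (simp add: power2_eq_square)
    also have "\<dots> \<le> a\<^sup>2 * (\<Sum>k<d. (Dj j (Dj k u) X)\<^sup>2)"
      by (intro mult_right_mono A_col j sum_nonneg) auto
    finally show "e j * e j \<le> a\<^sup>2 * (\<Sum>k<d. (Dj j (Dj k u) X)\<^sup>2)" .
  qed
  also have "\<dots> = a\<^sup>2 * Z u X" unfolding Z_def by (simp add: sum_distrib_left)
  finally have ee: "ip d e e \<le> a\<^sup>2 * Z u X" .
  have Z0: "0 \<le> Z u X" unfolding Z_def by (intro sum_nonneg) auto
  \<comment> \<open>Young's inequality with weight \<open>\<alpha>\<close> spends one of the two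
    units of decay; \<open>m_large\<close> makes the remainder at most half of the gain in
    \<open>Z\<close>.\<close>
  have "2 * ip d V (mv d Sig e) \<le> \<alpha> * W u X + (1 / \<alpha>) * qform d Sig e"
    unfolding W_def V_def by (rule qform_young[OF symSig Sig_nonneg]) (use pos in auto)
  also have "(1 / \<alpha>) * qform d Sig e \<le> (1 / \<alpha>) * (l2 * (a\<^sup>2 * Z u X))"
    using pos ee by (intro mult_left_mono order_trans[OF Sig_le]) auto
  also have "\<dots> = (2 * l2 * a\<^sup>2) * Z u X / (2 * \<alpha>)" using pos by simp
  also have "\<dots> \<le> (\<alpha> * m * l1) * Z u X / (2 * \<alpha>)"
    using pos m_large Z0 by (intro divide_right_mono mult_right_mono) auto
  also have "\<dots> = m * l1 / 2 * Z u X" using pos by simp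
  finally have 5: "2 * ip d V (mv d Sig e) \<le> \<alpha> * W u X + m * l1 / 2 * Z u X" by simp
  have "m * l1 / 2 * Z u X = m * l1 * Z u X / 2" by simp
  then show ?thesis using 1 2 3 4 5 unfolding V_def[symmetric] by linarith
qed

text \<open>Both linear terms contribute equally by the symmetry of second differences, whence
  \<open>4 * P\<close>. Moving them to \<open>X\<close> costs third differences, which are absorbed
  by the squared increments \<open>Q\<close>. No decay survives, only growth at a bounded rate,
  which is harmless for short times.\<close>

lemma bernstein_Z:
  fixes u :: "(nat \<Rightarrow> int) \<Rightarrow> real"
  assumes X: "X \<in> U"
  defines "D' \<equiv> (\<lambda>i j. G (Dj i (Dj j u)) X + (\<Sum>k<d. A k i * Dj k (Dj j u) (tr X (unitv i)))
      + (\<Sum>k<d. A k j * Dj i (Dj k u) (tr X (unitv j))))"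
  shows "(\<Sum>i<d. \<Sum>j<d. 2 * Dj i (Dj j u) X * D' i j) \<le> G (Z u) X + (4 * a + 4 * a\<^sup>2 / m) * Z u X"
proof -
  have XS: "X \<in> S" using X U_S by auto
  define D where "D i j = Dj i (Dj j u)" for i j
  have Dsym: "D i j Y = D j i Y" for i j Y unfolding D_def by (rule Dj_commute)
  define P where "P = (\<Sum>i<d. \<Sum>j<d. D i j X * (\<Sum>k<d. A k i * D k j (tr X (unitv i))))"
  have "(\<Sum>i<d. \<Sum>j<d. D i j X * (\<Sum>k<d. A k j * D i k (tr X (unitv j)))) = P"
    unfolding P_def by (subst sum.swap) (simp add: Dsym)
  then have 1: "(\<Sum>i<d. \<Sum>j<d. 2 * D i j X * D' i j) = (\<Sum>i<d. \<Sum>j<d. 2 * D i j X * G (D i j) X) + 4 * P"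
    unfolding D'_def D_def[symmetric]
    by (simp add: algebra_simps sum.distrib P_def) (simp add: sum_distrib_left[symmetric] mult.assoc)
  define Q where "Q J = (\<Sum>i<d. \<Sum>j<d. (D i j (tr X J) - D i j X)\<^sup>2)" for J
  have 2: "G (Z u) X = (\<Sum>i<d. \<Sum>j<d. 2 * D i j X * G (D i j) X) + (\<Sum>J\<in>Js. r J X * Q J)"
  proof -
    have "G (Z u) X = (\<Sum>J\<in>Js. (\<Sum>i<d. \<Sum>j<d. 2 * D i j X * (r J X * (D i j (tr X J) - D i j X))) + r J X * Q J)"
      unfolding G_def Z_def Q_def D_def[symmetric] sum_distrib_left sum_subtractf[symmetric] sum.distrib[symmetric]
      by (intro sum.cong refl) (simp add: power2_eq_square algebra_simps)
    also have "(\<Sum>J\<in>Js. (\<Sum>i<d. \<Sum>j<d. 2 * D i j X * (r J X * (D i j (tr X J) - D i j X))) + r J X * Q J)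
      = (\<Sum>i<d. \<Sum>j<d. \<Sum>J\<in>Js. 2 * D i j X * (r J X * (D i j (tr X J) - D i j X))) + (\<Sum>J\<in>Js. r J X * Q J)"
      unfolding sum.distrib by (subst sum.swap, subst (2) sum.swap) simp
    finally show ?thesis unfolding G_def by (simp add: sum_distrib_left)
  qed
  have "(\<Sum>i<d. m * Q (unitv i)) \<le> (\<Sum>i<d. r (unitv i) X * Q (unitv i))"
    unfolding Q_def by (intro sum_mono mult_right_mono r_ge XS sum_nonneg) auto
  also have "\<dots> \<le> (\<Sum>J\<in>Js. r J X * Q J)"
    using r_nonneg[OF XS] unfolding Q_def by (intro sum_unit_le mult_nonneg_nonneg sum_nonneg) auto
  finally have 3: "(\<Sum>i<d. m * Q (unitv i)) \<le> (\<Sum>J\<in>Js. r J X * Q J)" .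
  define E where "E i j = (\<Sum>k<d. A k i * (D k j (tr X (unitv i)) - D k j X))" for i j
  have P2: "P = (\<Sum>i<d. \<Sum>j<d. D i j X * (\<Sum>k<d. A k i * D k j X)) + (\<Sum>i<d. \<Sum>j<d. D i j X * E i j)"
    unfolding P_def E_def by (simp add: sum.distrib[symmetric] algebra_simps sum_subtractf sum_distrib_left)
  have zz: "Z u X = (\<Sum>j<d. ip d (\<lambda>i. D i j X) (\<lambda>i. D i j X))"
    unfolding Z_def ip_def D_def[symmetric] by (subst sum.swap) (simp add: power2_eq_square)
  have "(\<Sum>i<d. \<Sum>j<d. D i j X * (\<Sum>k<d. A k i * D k j X)) = (\<Sum>j<d. ip d (\<lambda>i. D i j X) (mv d A (\<lambda>i. D i j X)))"
  proof -
    have "(\<Sum>i<d. \<Sum>j<d. D i j X * (\<Sum>k<d. A k i * D k j X)) = (\<Sum>j<d. \<Sum>i<d. \<Sum>k<d. D k j X * (A k i * D i j X))"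
      by (subst sum.swap) (simp add: sum_distrib_left mult_ac)
    also have "\<dots> = (\<Sum>j<d. \<Sum>k<d. \<Sum>i<d. D k j X * (A k i * D i j X))"
      by (intro sum.cong refl sum.swap)
    also have "\<dots> = (\<Sum>j<d. ip d (\<lambda>i. D i j X) (mv d A (\<lambda>i. D i j X)))"
      unfolding ip_mv by (simp add: mult_ac)
    finally show ?thesis .
  qed
  also have "\<dots> \<le> (\<Sum>j<d. a * ip d (\<lambda>i. D i j X) (\<lambda>i. D i j X))"
  proof (intro sum_mono)
    fix j
    let ?x = "\<lambda>i. D i j X"
    have "(ip d ?x (mv d A ?x))\<^sup>2 \<le> ip d ?x ?x * ip d (mv d A ?x) (mv d A ?x)" by (rule ip_cauchy)
    also have "\<dots> \<le> ip d ?x ?x * (a\<^sup>2 * ip d ?x ?x)" by (intro mult_left_mono A_le ip_self_nonneg)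
    also have "\<dots> = (a * ip d ?x ?x)\<^sup>2" by (simp add: power2_eq_square mult_ac)
    finally have sq: "(ip d ?x (mv d A ?x))\<^sup>2 \<le> (a * ip d ?x ?x)\<^sup>2" .
    have "0 \<le> a * ip d ?x ?x" using pos ip_self_nonneg by simp
    then show "ip d ?x (mv d A ?x) \<le> a * ip d ?x ?x" by (rule power2_le_imp_le[OF sq])
  qed
  also have "\<dots> = a * Z u X" unfolding zz by (simp add: sum_distrib_left)
  finally have 4: "(\<Sum>i<d. \<Sum>j<d. D i j X * (\<Sum>k<d. A k i * D k j X)) \<le> a * Z u X" .
  have "(\<Sum>i<d. \<Sum>j<d. 4 * (D i j X * E i j)) \<le> (\<Sum>i<d. \<Sum>j<d. 4 * a\<^sup>2 / m * (D i j X)\<^sup>2 + m * (\<Sum>k<d. (D k j (tr X (unitv i)) - D k j X)\<^sup>2))"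
  proof (intro sum_mono)
    fix i j assume "i \<in> {..<d}" then have i: "i < d" by simp
    let ?s = "\<Sum>k<d. (D k j (tr X (unitv i)) - D k j X)\<^sup>2"
    have "(E i j)\<^sup>2 \<le> (\<Sum>k<d. (A k i)\<^sup>2) * ?s"
      unfolding E_def by (rule Cauchy_Schwarz_ineq_sum)
    also have "\<dots> \<le> a\<^sup>2 * ?s" by (intro mult_right_mono A_col i sum_nonneg) auto
    finally have "m / a\<^sup>2 * (E i j)\<^sup>2 \<le> m / a\<^sup>2 * (a\<^sup>2 * ?s)" using pos by (intro mult_left_mono) auto
    also have "\<dots> = m * ?s" using pos by simp
    finally have x: "m / a\<^sup>2 * (E i j)\<^sup>2 \<le> m * ?s" .
    \<comment> \<open>A completed square with the weight chosen so that the square of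
      \<open>E i j\<close> costs exactly \<open>m\<close> times the squared third
      differences.\<close>
    have "0 \<le> m / a\<^sup>2 * (E i j - 2 * a\<^sup>2 / m * D i j X)\<^sup>2" using pos by auto
    also have "\<dots> = m / a\<^sup>2 * (E i j)\<^sup>2 - 4 * (D i j X * E i j) + 4 * a\<^sup>2 / m * (D i j X)\<^sup>2"
      using pos by (simp add: power2_eq_square field_simps)
    finally show "4 * (D i j X * E i j) \<le> 4 * a\<^sup>2 / m * (D i j X)\<^sup>2 + m * ?s" using x by linarith
  qed
  also have "\<dots> = 4 * a\<^sup>2 / m * Z u X + (\<Sum>i<d. m * Q (unitv i))"
  proof -
    have "(\<Sum>i<d. \<Sum>j<d. m * (\<Sum>k<d. (D k j (tr X (unitv i)) - D k j X)\<^sup>2)) = (\<Sum>i<d. m * Q (unitv i))"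
      unfolding Q_def sum_distrib_left by (intro sum.cong refl sum.swap)
    then show ?thesis unfolding Z_def D_def[symmetric] by (simp add: sum.distrib sum_distrib_left)
  qed
  finally have 5: "4 * (\<Sum>i<d. \<Sum>j<d. D i j X * E i j) \<le> 4 * a\<^sup>2 / m * Z u X + (\<Sum>i<d. m * Q (unitv i))"
    by (simp add: sum_distrib_left)
  have "(\<Sum>i<d. \<Sum>j<d. 2 * D i j X * D' i j) \<le> G (Z u) X + (4 * a + 4 * a\<^sup>2 / m) * Z u X"
    using 1 2 3 4 5 P2 by (simp add: distrib_right)
  then show ?thesis unfolding D_def .
qed

text \<open>Extended by zero outside \<open>S\<close>, so that differences near the boundary are
  total and the crude bounds by 1 hold at every lattice point.\<close>

definition ut :: "((nat \<Rightarrow> int) \<Rightarrow> real) \<Rightarrow> real \<Rightarrow> (nat \<Rightarrow> int) \<Rightarrow> real" where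
  "ut f t X = (if X \<in> S then semi S q t f X else 0)"

definition ut' :: "((nat \<Rightarrow> int) \<Rightarrow> real) \<Rightarrow> real \<Rightarrow> (nat \<Rightarrow> int) \<Rightarrow> real" where
  "ut' f t X = (if X \<in> S then gen S q (ut f t) X else 0)"

lemma ut_deriv: "((\<lambda>t. ut f t X) has_real_derivative ut' f t X) (at t)"
proof (cases "X \<in> S")
  case True
  have "gen S q (ut f t) X = gen S q (semi S q t f) X"
    by (intro gen_cong) (auto simp: ut_def True)
  then show ?thesis using semi_deriv[OF True] by (simp add: ut_def ut'_def True)
qed (simp add: ut_def ut'_def)

lemma Dj_deriv:
  assumes "\<And>Y. ((\<lambda>t. h t Y) has_real_derivative h' Y) (at t)"
  shows "((\<lambda>t. Dj j (h t) X) has_real_derivative Dj j h' X) (at t)"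
  unfolding Dj_tr by (intro DERIV_diff assms)

lemma qform_deriv:
  assumes "msym d M" "\<And>i. i < d \<Longrightarrow> ((\<lambda>t. v t i) has_real_derivative v' i) (at t)"
  shows "((\<lambda>t. qform d M (v t)) has_real_derivative 2 * ip d (v t) (mv d M v')) (at t)"
proof -
  have "((\<lambda>t. qform d M (v t)) has_real_derivative
      (\<Sum>i<d. \<Sum>k<d. v' i * M i k * v t k + v t i * M i k * v' k)) (at t)"
    unfolding qform_def by (auto intro!: DERIV_sum derivative_eq_intros assms)
  also have "(\<Sum>i<d. \<Sum>k<d. v' i * M i k * v t k + v t i * M i k * v' k) = ip d v' (mv d M (v t)) + ip d (v t) (mv d M v')"
    unfolding ip_mv by (simp add: sum.distrib)
  also have "ip d v' (mv d M (v t)) = ip d (v t) (mv d M v')" by (rule ip_mv_sym[OF assms(1)])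
  finally show ?thesis by simp
qed

lemma W_deriv: "((\<lambda>t. W (ut f t) X) has_real_derivative 2 * ip d (grd (ut f t) X) (mv d Sig (grd (ut' f t) X))) (at t)"
  unfolding W_def by (rule qform_deriv[OF symSig]) (simp add: grd_def Dj_deriv ut_deriv)

lemma Z_deriv: "((\<lambda>t. Z (ut f t) X) has_real_derivative
    (\<Sum>i<d. \<Sum>j<d. 2 * Dj i (Dj j (ut f t)) X * Dj i (Dj j (ut' f t)) X)) (at t)"
proof -
  have *: "((\<lambda>t. (Dj i (Dj j (ut f t)) X)\<^sup>2) has_real_derivative
       2 * Dj i (Dj j (ut f t)) X * Dj i (Dj j (ut' f t)) X) (at t)" for i j
    using DERIV_power[OF Dj_deriv[OF Dj_deriv[OF ut_deriv]], where n=2] by (simp add: mult_ac)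
  show ?thesis unfolding Z_def by (intro DERIV_sum *)
qed

lemma ut'_U: "X \<in> U \<Longrightarrow> ut' f t X = G (ut f t) X"
  unfolding ut'_def using U_S UJ by (auto simp: gen_G)

lemma ut'_U1: "X \<in> U \<Longrightarrow> i < d \<Longrightarrow> ut' f t (tr X (unitv i)) = G (ut f t) (tr X (unitv i))"
  unfolding ut'_def using U1 U1J by (auto simp: gen_G)

lemma ut'_U2: "X \<in> U \<Longrightarrow> i < d \<Longrightarrow> j < d \<Longrightarrow>
    ut' f t (tr (tr X (unitv i)) (unitv j)) = G (ut f t) (tr (tr X (unitv i)) (unitv j))"
  unfolding ut'_def using U2 U2J by (auto simp: gen_G)

lemma Dj_ut':
  assumes "X \<in> U" "j < d"
  shows "Dj j (ut' f t) X = G (Dj j (ut f t)) X + (\<Sum>k<d. A k j * Dj k (ut f t) (tr X (unitv j)))"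
  unfolding Dj_tr[of j "ut' f t"] ut'_U[OF assms(1)] ut'_U1[OF assms]
  by (rule commutator) (use assms U_S U1 in auto)

text \<open>\<open>commutator\<close> is applied once at \<open>X\<close> and
  \<open>tr X (unitv i)\<close> to the function itself, and once to its difference; since
  \<open>A\<close> is constant, the first linear term is merely differenced.\<close>

lemma Dj_Dj_ut':
  assumes X: "X \<in> U" and ij: "i < d" "j < d"
  shows "Dj i (Dj j (ut' f t)) X = G (Dj i (Dj j (ut f t))) X
     + (\<Sum>k<d. A k i * Dj k (Dj j (ut f t)) (tr X (unitv i)))
     + (\<Sum>k<d. A k j * Dj i (Dj k (ut f t)) (tr X (unitv j)))"
proof -
  have XS: "X \<in> S" using X U_S by auto
  let ?u = "ut f t" and ?Y = "tr X (unitv i)"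
  have 1: "Dj j (ut' f t) ?Y = G (Dj j ?u) ?Y + (\<Sum>k<d. A k j * Dj k ?u (tr ?Y (unitv j)))"
    unfolding Dj_tr[of j "ut' f t"] ut'_U1[OF X ij(1)] ut'_U2[OF X ij]
    by (rule commutator) (use X ij U1 U2 in auto)
  have 2: "G (Dj j ?u) ?Y - G (Dj j ?u) X = G (Dj i (Dj j ?u)) X + (\<Sum>k<d. A k i * Dj k (Dj j ?u) ?Y)"
    by (rule commutator) (use X XS ij U1 in auto)
  have "(\<Sum>k<d. A k j * Dj k ?u (tr ?Y (unitv j))) - (\<Sum>k<d. A k j * Dj k ?u (tr X (unitv j)))
      = (\<Sum>k<d. A k j * Dj i (Dj k ?u) (tr X (unitv j)))"
    unfolding sum_subtractf[symmetric]
    by (intro sum.cong refl) (simp add: Dj_tr[of i "Dj _ _"] tr_commute[of X "unitv i"] algebra_simps)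
  then show ?thesis
    unfolding Dj_tr[of i "Dj j (ut' f t)"] 1 Dj_ut'[OF X ij(2)] using 2 by simp
qed

lemma W_sub:
  assumes X: "X \<in> U"
  shows "2 * ip d (grd (ut f t) X) (mv d Sig (grd (ut' f t) X))
    \<le> G (W (ut f t)) X - \<alpha> * W (ut f t) X - m * l1 / 2 * Z (ut f t) X"
proof -
  have *: "mv d Sig (grd (ut' f t) X) = mv d Sig (\<lambda>j. G (Dj j (ut f t)) X + (\<Sum>k<d. A k j * Dj k (ut f t) (tr X (unitv j))))"
    unfolding mv_def grd_def by (intro ext) (auto simp: Dj_ut'[OF X])
  show ?thesis unfolding * by (rule bernstein_W[OF X])
qed

lemma Z_sub:
  assumes X: "X \<in> U"
  shows "(\<Sum>i<d. \<Sum>j<d. 2 * Dj i (Dj j (ut f t)) X * Dj i (Dj j (ut' f t)) X)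
     \<le> G (Z (ut f t)) X + (4 * a + 4 * a\<^sup>2 / m) * Z (ut f t) X"
  using bernstein_Z[OF X, of "ut f t"] by (simp add: Dj_Dj_ut'[OF X])

lemma ut_abs: "(\<And>X. X \<in> S \<Longrightarrow> \<bar>f X\<bar> \<le> 1) \<Longrightarrow> 0 \<le> t \<Longrightarrow> \<bar>ut f t X\<bar> \<le> 1"
  unfolding ut_def by (auto intro!: semi_abs_le)

lemma W_crude:
  assumes "\<And>X. \<bar>u X\<bar> \<le> 1" shows "W u X \<le> 4 * real d * l2"
proof -
  have "\<bar>Dj j u X\<bar> \<le> 2" for j unfolding Dj_tr using assms[of X] assms[of "tr X (unitv j)"] by linarith
  then have "(Dj j u X)\<^sup>2 \<le> 2\<^sup>2" for j by (intro abs_le_square_iff[THEN iffD1]) simp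
  then have "ip d (grd u X) (grd u X) \<le> (\<Sum>j<d. 4)"
    unfolding ip_def grd_def by (intro sum_mono) (simp add: power2_eq_square)
  then have "l2 * ip d (grd u X) (grd u X) \<le> l2 * (4 * real d)" using pos by (intro mult_left_mono) auto
  then show ?thesis unfolding W_def using Sig_le[of "grd u X"] by (simp add: mult_ac)
qed

lemma Z_crude:
  assumes "\<And>X. \<bar>u X\<bar> \<le> 1" shows "Z u X \<le> 16 * (real d)\<^sup>2"
proof -
  have "\<bar>Dj i (Dj j u) X\<bar> \<le> 4" for i j
    unfolding Dj_tr using assms[of X] assms[of "tr X (unitv j)"] assms[of "tr X (unitv i)"]
      assms[of "tr (tr X (unitv i)) (unitv j)"] by linarith
  then have "(Dj i (Dj j u) X)\<^sup>2 \<le> 4\<^sup>2" for i j by (intro abs_le_square_iff[THEN iffD1]) simp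
  then have "Z u X \<le> (\<Sum>i<d. \<Sum>j<d. 16)" unfolding Z_def by (intro sum_mono) simp
  then show ?thesis by (simp add: power2_eq_square)
qed

lemma W_nonneg: "0 \<le> W u X" unfolding W_def by (rule Sig_nonneg)

lemma Z_nonneg: "0 \<le> Z u X" unfolding Z_def by (intro sum_nonneg) auto

section \<open>Localisation by a barrier, and Bernstein estimates in time\<close>

context
  fixes E :: "(nat \<Rightarrow> int) \<Rightarrow> real" and Eout c :: real
  assumes E0: "\<And>X. X \<in> S \<Longrightarrow> 0 \<le> E X" and GE: "\<And>X. X \<in> U \<Longrightarrow> G E X \<le> c"
    and Eo: "\<And>X. X \<in> S \<Longrightarrow> X \<notin> U \<Longrightarrow> Eout \<le> E X" and Ec: "0 < Eout" "0 \<le> c"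
begin

text \<open>Subtract from \<open>F\<close> the multiple \<open>M / Eout\<close> of
  \<open>E X + c * t\<close>. Outside \<open>U\<close> this multiple is at least the crude bound
  \<open>M\<close>; inside \<open>U\<close> the term \<open>c * t\<close> compensates for
  \<open>G E X \<le> c\<close>. What remains satisfies the hypotheses of
  \<open>comparison\<close>.\<close>

lemma barrier:
  assumes deriv: "\<And>t X. t \<in> {0..T} \<Longrightarrow> X \<in> S \<Longrightarrow> ((\<lambda>t. F t X) has_real_derivative F' t X) (at t)"
    and sub: "\<And>t X. t \<in> {0..T} \<Longrightarrow> X \<in> U \<Longrightarrow> F' t X \<le> G (F t) X"
    and init: "\<And>X. X \<in> S \<Longrightarrow> F 0 X \<le> m0"
    and crude: "\<And>t X. t \<in> {0..T} \<Longrightarrow> X \<in> S \<Longrightarrow> F t X \<le> M"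
    and nn: "0 \<le> m0" "0 \<le> M" and tX: "t \<in> {0..T}" "X \<in> S"
  shows "F t X \<le> m0 + M * ((E X + c * t) / Eout)"
proof -
  define D where "D t X = F t X - m0 - M / Eout * (E X + c * t)" for t X
  have "D t X \<le> 0"
  proof (rule comparison[where T=T and U=U and D=D and D'="\<lambda>t X. F' t X - M / Eout * c", OF _ _ _ _ tX])
    fix t X assume t: "t \<in> {0..T}" and X: "X \<in> S"
    show "((\<lambda>t. D t X) has_real_derivative F' t X - M / Eout * c) (at t)"
      unfolding D_def using Ec by (auto intro!: derivative_eq_intros deriv t X)
    show "D t X \<le> 0" if "X \<notin> U"
    proof -
      have "M / Eout * Eout \<le> M / Eout * (E X + c * t)"
        using Eo[OF X that] Ec nn t by (intro mult_left_mono) (auto intro: add_increasing2)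
      then show ?thesis using crude[OF t X] Ec nn unfolding D_def by simp
    qed
    show "F' t X - M / Eout * c \<le> gen S q (D t) X" if XU: "X \<in> U"
    proof -
      have "gen S q (D t) X = gen S q (\<lambda>X. F t X - (m0 + M / Eout * (E X + c * t))) X"
        unfolding D_def by (simp add: algebra_simps)
      also have "\<dots> = gen S q (F t) X - M / Eout * gen S q E X"
        by (simp only: gen_diff gen_add gen_scale gen_const) simp
      also have "\<dots> = G (F t) X - M / Eout * G E X" using X XU UJ by (simp add: gen_G)
      also have "\<dots> \<ge> G (F t) X - M / Eout * c"
        using GE[OF XU] nn Ec by (intro diff_left_mono mult_left_mono) auto
      finally show ?thesis using sub[OF t XU] by linarith
    qed
  next
    fix X assume X: "X \<in> S"
    have "0 \<le> M / Eout * E X" using nn Ec E0[OF X] by simp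
    then show "D 0 X \<le> 0" unfolding D_def using init[OF X] by simp
  qed
  then show ?thesis unfolding D_def by simp
qed

context
  fixes f :: "(nat \<Rightarrow> int) \<Rightarrow> real" assumes f1: "\<And>X. X \<in> S \<Longrightarrow> \<bar>f X\<bar> \<le> 1"
begin

text \<open>The factor \<open>exp (\<alpha> * t)\<close> uses up the decay in \<open>W_sub\<close>;
  the gain in second differences is dropped.\<close>

lemma long_time:
  assumes "0 \<le> t" "t \<le> T" "X \<in> S"
  shows "exp (\<alpha> * t) * W (ut f t) X \<le> 4 * real d * l2 + exp (\<alpha> * T) * (4 * real d * l2) * ((E X + c * t) / Eout)"
proof (rule barrier[where T=T and F="\<lambda>t X. exp (\<alpha> * t) * W (ut f t) X"
    and F'="\<lambda>t X. exp (\<alpha> * t) * (\<alpha> * W (ut f t) X + 2 * ip d (grd (ut f t) X) (mv d Sig (grd (ut' f t) X)))"])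
  fix t X assume t: "t \<in> {0..T}"
  show "((\<lambda>t. exp (\<alpha> * t) * W (ut f t) X) has_real_derivative
     exp (\<alpha> * t) * (\<alpha> * W (ut f t) X + 2 * ip d (grd (ut f t) X) (mv d Sig (grd (ut' f t) X)))) (at t)"
    by (rule derivative_eq_intros W_deriv refl | simp add: algebra_simps)+
  have w: "W (ut f t) X \<le> 4 * real d * l2" using t by (intro W_crude ut_abs f1) auto
  have e: "exp (\<alpha> * t) \<le> exp (\<alpha> * T)" using t pos by simp
  show "exp (\<alpha> * t) * W (ut f t) X \<le> exp (\<alpha> * T) * (4 * real d * l2)"
    by (intro mult_mono w e W_nonneg) auto
  show "exp (\<alpha> * t) * (\<alpha> * W (ut f t) X + 2 * ip d (grd (ut f t) X) (mv d Sig (grd (ut' f t) X)))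
     \<le> G (\<lambda>X. exp (\<alpha> * t) * W (ut f t) X) X" if "X \<in> U"
  proof -
    have "G (\<lambda>X. exp (\<alpha> * t) * W (ut f t) X) X = exp (\<alpha> * t) * G (W (ut f t)) X"
      unfolding G_def by (simp add: sum_distrib_left algebra_simps)
    moreover have "\<alpha> * W (ut f t) X + 2 * ip d (grd (ut f t) X) (mv d Sig (grd (ut' f t) X)) \<le> G (W (ut f t)) X"
    proof -
      have "0 \<le> m * l1 / 2 * Z (ut f t) X" using pos Z_nonneg[of "ut f t" X] by simp
      then show ?thesis using W_sub[OF that, of f t] by linarith
    qed
    ultimately show ?thesis by simp
  qed
next
  fix X show "exp (\<alpha> * 0) * W (ut f 0) X \<le> 4 * real d * l2"
    using W_crude[OF ut_abs[OF f1]] by simp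
qed (use assms pos in auto)

text \<open>Bernstein's combination. Differentiating the weight \<open>t\<close> of \<open>W\<close>
  costs \<open>m / (2 * l2) * W\<close>, half of what \<open>G_square\<close> supplies. The gain in
  \<open>Z\<close> from \<open>W_sub\<close> pays both for differentiating \<open>t^2\<close> and
  for the growth in \<open>Z_sub\<close>, which the condition on \<open>T0\<close> bounds.\<close>

lemma short_time:
  assumes "0 \<le> t" "t \<le> T0" "X \<in> S" and T0: "(4 * a + 4 * a\<^sup>2 / m) * T0 \<le> 1"
  defines "b \<equiv> m\<^sup>2 * l1 / (12 * l2)"
  shows "m / (2 * l2) * t * W (ut f t) X + b * t\<^sup>2 * Z (ut f t) X
    \<le> 1 + (1 + 2 * m * T0 * real d + 16 * b * T0\<^sup>2 * (real d)\<^sup>2) * ((E X + c * t) / Eout)"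
proof -
  define F where "F t X = (ut f t X)\<^sup>2 + (m / (2 * l2) * t * W (ut f t) X + b * t\<^sup>2 * Z (ut f t) X)" for t X
  define w' where "w' t X = 2 * ip d (grd (ut f t) X) (mv d Sig (grd (ut' f t) X))" for t X
  define z' where "z' t X = (\<Sum>i<d. \<Sum>j<d. 2 * Dj i (Dj j (ut f t)) X * Dj i (Dj j (ut' f t)) X)" for t X
  define F' where "F' t X = 2 * ut f t X * ut' f t X + (m / (2 * l2) * (W (ut f t) X + t * w' t X)
     + b * (2 * t * Z (ut f t) X + t\<^sup>2 * z' t X))" for t X
  have b: "b > 0" unfolding b_def using pos by simp
  have F1: "F t X \<le> 1 + (1 + 2 * m * T0 * real d + 16 * b * T0\<^sup>2 * (real d)\<^sup>2) * ((E X + c * t) / Eout)"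
  proof (rule barrier[where T=T0 and F=F and F'=F'])
    fix t X assume t: "t \<in> {0..T0}"
    show "((\<lambda>t. F t X) has_real_derivative F' t X) (at t)"
      unfolding F_def F'_def
    proof (intro DERIV_add)
      show "((\<lambda>t. (ut f t X)\<^sup>2) has_real_derivative 2 * ut f t X * ut' f t X) (at t)"
        using DERIV_power[OF ut_deriv, where n=2] by (simp add: mult_ac)
      show "((\<lambda>t. m / (2 * l2) * t * W (ut f t) X) has_real_derivative m / (2 * l2) * (W (ut f t) X + t * w' t X)) (at t)"
        unfolding w'_def mult.assoc[of "m / (2 * l2)"]
        by (intro DERIV_cmult DERIV_mult[OF DERIV_ident W_deriv, THEN DERIV_cong]) simp
      have "((\<lambda>t. t\<^sup>2) has_real_derivative 2 * t) (at t)" by (auto intro!: derivative_eq_intros)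
      from DERIV_mult[OF this Z_deriv]
      show "((\<lambda>t. b * t\<^sup>2 * Z (ut f t) X) has_real_derivative b * (2 * t * Z (ut f t) X + t\<^sup>2 * z' t X)) (at t)"
        unfolding z'_def mult.assoc[of b] by (intro DERIV_cmult) (simp add: mult_ac add.commute)
    qed
    have u: "\<bar>ut f t Y\<bar> \<le> 1" for Y using t by (intro ut_abs f1) auto
    have "F t X \<le> 1 + (m / (2 * l2) * T0 * (4 * real d * l2) + b * T0\<^sup>2 * (16 * (real d)\<^sup>2))"
      unfolding F_def using t pos b u
      by (intro add_mono mult_mono W_crude Z_crude W_nonneg Z_nonneg power_mono) (auto simp: abs_square_le_1)
    also have "\<dots> = 1 + 2 * m * T0 * real d + 16 * b * T0\<^sup>2 * (real d)\<^sup>2" using pos by simp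
    finally show "F t X \<le> 1 + 2 * m * T0 * real d + 16 * b * T0\<^sup>2 * (real d)\<^sup>2" .
    show "F' t X \<le> G (F t) X" if X: "X \<in> U"
    proof -
      have GF: "G (F t) X = G (\<lambda>Y. (ut f t Y)\<^sup>2) X + (m / (2 * l2) * t * G (W (ut f t)) X + b * t\<^sup>2 * G (Z (ut f t)) X)"
        unfolding F_def G_def by (simp add: sum_distrib_left algebra_simps sum.distrib[symmetric])
      let ?w = "W (ut f t) X" and ?z = "Z (ut f t) X"
      let ?C = "4 * a + 4 * a\<^sup>2 / m"
      have z0: "0 \<le> ?z" by (rule Z_nonneg)
      have 1: "2 * ut f t X * ut' f t X \<le> G (\<lambda>Y. (ut f t Y)\<^sup>2) X - m / l2 * ?w"
        using G_square[OF X, of "ut f t"] by (simp add: ut'_U[OF X])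
      have "w' t X \<le> G (W (ut f t)) X - m * l1 / 2 * ?z"
        using W_sub[OF X, of f t] pos W_nonneg[of "ut f t" X] unfolding w'_def
        by (smt (verit) mult_nonneg_nonneg)
      then have 2: "(m / (2 * l2) * t) * w' t X \<le> (m / (2 * l2) * t) * (G (W (ut f t)) X - m * l1 / 2 * ?z)"
        using t pos by (intro mult_left_mono) auto
      have 3: "(b * t\<^sup>2) * z' t X \<le> (b * t\<^sup>2) * (G (Z (ut f t)) X + ?C * ?z)"
        using Z_sub[OF X, of f t] b unfolding z'_def by (intro mult_left_mono) auto
      have "?C * t \<le> ?C * T0" using t pos by (intro mult_left_mono) auto
      then have "?C * t \<le> 1" using T0 by simp
      then have "(b * t * ?z) * (?C * t) \<le> (b * t * ?z) * 1"
        using b t z0 by (intro mult_left_mono) auto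
      then have 4: "(b * t\<^sup>2) * (?C * ?z) \<le> b * t * ?z" by (simp add: power2_eq_square mult_ac)
      have 5: "(m / (2 * l2) * t) * (m * l1 / 2 * ?z) = 3 * (b * t * ?z)"
        unfolding b_def using pos by (simp add: power2_eq_square field_simps)
      have 6: "m / (2 * l2) * ?w \<le> m / l2 * ?w"
        using pos W_nonneg[of "ut f t" X] by (intro mult_right_mono) (auto simp: field_simps)
      show ?thesis
        using 1 2 3 4 5 6 unfolding F'_def GF by (simp add: distrib_left right_diff_distrib mult_ac)
    qed
  next
    fix X assume "X \<in> S"
    have "\<bar>ut f 0 X\<bar> \<le> 1" by (intro ut_abs f1) auto
    then show "F 0 X \<le> 1" unfolding F_def by (simp add: abs_square_le_1)
  next
    have "0 \<le> T0" using assms by simp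
    then show "0 \<le> 1 + 2 * m * T0 * real d + 16 * b * T0\<^sup>2 * (real d)\<^sup>2"
      using pos b by (intro add_nonneg_nonneg) auto
  qed (use assms in auto)
  have "m / (2 * l2) * t * W (ut f t) X + b * t\<^sup>2 * Z (ut f t) X \<le> F t X" unfolding F_def by simp
  then show ?thesis using F1 by linarith
qed

end

end

end

section \<open>Elementary processes\<close>

lemma vnorm_L2: "vnorm d x = L2_set x {..<d}"
  unfolding vnorm_def L2_set_def ..

lemma vnorm_triangle: "vnorm d (\<lambda>i. x i + y i) \<le> vnorm d x + vnorm d y"
  unfolding vnorm_L2 by (rule L2_set_triangle_ineq)

lemma vnorm_nonneg: "0 \<le> vnorm d x" unfolding vnorm_L2 by (rule L2_set_nonneg)

lemma vnorm_power2: "(vnorm d x)\<^sup>2 = ip d x x"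
  unfolding vnorm_ip by (simp add: ip_self_nonneg)

lemma vnorm_scale: "vnorm d (\<lambda>i. a * x i) = \<bar>a\<bar> * vnorm d x"
  unfolding vnorm_ip ip_scale_left ip_scale_right
  by (simp add: real_sqrt_mult mult.assoc[symmetric])

lemma ip_mv_transpose: "ip d (mv d (mtr M) x) y = ip d x (mv d M y)"
proof -
  have "ip d (mv d (mtr M) x) y = (\<Sum>i<d. \<Sum>k<d. y i * M k i * x k)"
    by (subst ip_commute) (simp add: ip_mv mtr_def)
  also have "\<dots> = (\<Sum>k<d. \<Sum>i<d. y i * M k i * x k)" by (rule sum.swap)
  finally show ?thesis unfolding ip_mv by (simp add: mult_ac)
qed

lemma Rd_restrict: "\<exists>x'\<in>Rd d. \<forall>i<d. x' i = x i"
  by (intro bexI[of _ "\<lambda>i. if i < d then x i else 0"]) (auto simp: Rd_def)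

lemma mv_cong: "(\<And>i. i < d \<Longrightarrow> x i = y i) \<Longrightarrow> mv d M x = mv d M y"
  unfolding mv_def by (intro ext) auto

lemma ip_cong: "(\<And>i. i < d \<Longrightarrow> x i = x' i) \<Longrightarrow> (\<And>i. i < d \<Longrightarrow> y i = y' i) \<Longrightarrow> ip d x y = ip d x' y'"
  unfolding ip_def by (intro sum.cong) auto

lemma qform_cong: "(\<And>i. i < d \<Longrightarrow> x i = y i) \<Longrightarrow> qform d M x = qform d M y"
  unfolding qform_def by (intro sum.cong) auto

text \<open>Both expressions ignore the coordinates from \<open>d\<close> on, so inequalities proved
  on \<open>Rd d\<close> extend to all functions.\<close>

lemma qform_ip_all:
  assumes "\<And>x. x \<in> Rd d \<Longrightarrow> P (qform d M x) (ip d x x)" shows "P (qform d M v) (ip d v v)"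
proof -
  obtain v' where v': "v' \<in> Rd d" "\<forall>i<d. v' i = v i" using Rd_restrict by blast
  have "qform d M v' = qform d M v" "ip d v' v' = ip d v v" using v' by (auto intro: qform_cong ip_cong)
  then show ?thesis using assms[OF v'(1)] by simp
qed

lemma ip_mv_frobenius:
  "ip d (mv d M x) (mv d M x) \<le> (\<Sum>i<d. \<Sum>k<d. (M i k)\<^sup>2) * ip d x x"
proof -
  have "ip d (mv d M x) (mv d M x) = (\<Sum>i<d. (\<Sum>k<d. M i k * x k)\<^sup>2)"
    unfolding ip_def mv_def by (simp add: power2_eq_square)
  also have "\<dots> \<le> (\<Sum>i<d. (\<Sum>k<d. (M i k)\<^sup>2) * (\<Sum>k<d. (x k)\<^sup>2))"
    by (intro sum_mono Cauchy_Schwarz_ineq_sum)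
  finally show ?thesis unfolding ip_def by (simp add: sum_distrib_right power2_eq_square)
qed

text \<open>The Frobenius norm is an upper bound; without one the \<open>Sup\<close> in
  \<open>opnorm\<close> would carry no information.\<close>

lemma opnorm_bdd: "bdd_above {vnorm d (mv d M x) | x. x \<in> Rd d \<and> vnorm d x \<le> 1}"
proof (rule bdd_aboveI[of _ "sqrt (\<Sum>i<d. \<Sum>k<d. (M i k)\<^sup>2)"])
  let ?F = "\<Sum>i<d. \<Sum>k<d. (M i k)\<^sup>2"
  fix z assume "z \<in> {vnorm d (mv d M x) | x. x \<in> Rd d \<and> vnorm d x \<le> 1}"
  then obtain x where x: "vnorm d x \<le> 1" "z = vnorm d (mv d M x)" by auto
  have "(vnorm d x)\<^sup>2 \<le> 1" using x(1) vnorm_nonneg[of d x] by (simp add: abs_square_le_1)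
  then have "?F * ip d x x \<le> ?F * 1"
    by (intro mult_left_mono) (auto simp: vnorm_power2 intro!: sum_nonneg)
  then show "z \<le> sqrt ?F" using ip_mv_frobenius[of d M x] unfolding x(2) vnorm_ip by simp
qed

lemma opnorm_nonneg: "0 \<le> opnorm d M"
proof -
  have "vnorm d (mv d M (\<lambda>_. 0)) \<le> opnorm d M"
    unfolding opnorm_def
    by (rule cSup_upper[OF _ opnorm_bdd]) (auto simp: Rd_def vnorm_def intro!: exI[of _ "\<lambda>_. 0"])
  then show ?thesis using vnorm_nonneg order_trans by blast
qed

lemma opnorm_bound: "ip d (mv d M v) (mv d M v) \<le> (opnorm d M)\<^sup>2 * ip d v v"
proof -
  have op: "vnorm d (mv d M x) \<le> opnorm d M" if "x \<in> Rd d" "vnorm d x \<le> 1" for x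
    unfolding opnorm_def using that by (intro cSup_upper opnorm_bdd) auto
  obtain w where w: "w \<in> Rd d" "\<forall>i<d. w i = v i" using Rd_restrict by blast
  have mw: "mv d M w = mv d M v" "ip d w w = ip d v v" using w by (auto intro: mv_cong ip_cong)
  show ?thesis
  proof (cases "vnorm d w = 0")
    case True
    then have "ip d v v = 0" using vnorm_power2[of d w] mw by simp
    then show ?thesis using ip_mv_frobenius[of d M v] by simp
  next
    case False
    then have p: "vnorm d w > 0" using vnorm_nonneg[of d w] by linarith
    let ?x = "\<lambda>i. (1 / vnorm d w) * w i"
    have "vnorm d ?x = 1" using p by (subst vnorm_scale) simp
    moreover have "?x \<in> Rd d" using w by (simp add: Rd_def)
    ultimately have "vnorm d (mv d M ?x) \<le> opnorm d M" by (intro op) auto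
    then have "(1 / vnorm d w) * vnorm d (mv d M w) \<le> opnorm d M"
      unfolding mv_scale using p by (subst (asm) vnorm_scale) simp
    then have "vnorm d (mv d M w) \<le> opnorm d M * vnorm d w" using p by (simp add: field_simps)
    then have "(vnorm d (mv d M w))\<^sup>2 \<le> (opnorm d M * vnorm d w)\<^sup>2"
      using vnorm_nonneg by (intro power_mono) auto
    then show ?thesis by (simp add: power_mult_distrib vnorm_power2 mw)
  qed
qed

locale elementary_process =
  fixes d :: nat and Jset :: "(nat \<Rightarrow> int) set" and g :: "(nat \<Rightarrow> int) \<Rightarrow> (nat \<Rightarrow> real) \<Rightarrow> real"
    and c :: "nat \<Rightarrow> real" and \<delta>0 :: real and Sig :: "nat \<Rightarrow> nat \<Rightarrow> real"
  assumes el: "elementary d Jset g c \<delta>0" and ly: "lyap_sol d Jset g c Sig"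
begin

abbreviation "A \<equiv> Amat d Jset g c"
abbreviation "\<sigma>2 \<equiv> sigma2 d Jset g c"
abbreviation "Si \<equiv> minv d Sig"
abbreviation "l1 \<equiv> lmin d Sig"
abbreviation "l2 \<equiv> lmax d Sig"
abbreviation "\<alpha> \<equiv> alpha1 d Jset g c Sig"
abbreviation "\<Lambda> \<equiv> Lambar d Jset g c"
abbreviation "\<mu> \<equiv> mustar Jset g c"

lemma d_pos: "0 < d" and finJ: "finite Jset" and JZ: "J \<in> Jset \<Longrightarrow> J \<in> Zd d" and cR: "c \<in> Rd d"
  and \<delta>0_pos: "0 < \<delta>0" and g_nonneg: "J \<in> Jset \<Longrightarrow> \<xi> \<in> Rd d \<Longrightarrow> 0 \<le> g J \<xi>"
  and gc_pos: "J \<in> Jset \<Longrightarrow> 0 < g J c"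
  and drift_c: "driftF d Jset g c = (\<lambda>i. 0)"
  and unitJ: "j < d \<Longrightarrow> unitv j \<in> Jset"
  and g_const: "J \<in> Jset \<Longrightarrow> J \<notin> unitv ` {..<d} \<Longrightarrow> \<xi> \<in> cballd d c \<delta>0 \<Longrightarrow> g J \<xi> = g J c"
  and g_affine: "j < d \<Longrightarrow> affine_on_set (g (unitv j)) d (cballd d c \<delta>0)"
  and g_half: "j < d \<Longrightarrow> \<xi> \<in> cballd d c \<delta>0 \<Longrightarrow> g (unitv j) c / 2 \<le> g (unitv j) \<xi>"
  using el unfolding elementary_def by (auto simp: Suc_le_eq)

lemma SigM: "Sig \<in> Md d" and Sigpd: "posdef d Sig" and Sigsym: "msym d Sig"
  and lyap_eq: "i < d \<Longrightarrow> k < d \<Longrightarrow> mmul d A Sig i k + mmul d Sig (mtr A) i k + \<sigma>2 i k = 0"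
  using ly unfolding lyap_sol_def posdef_def by auto

lemmas l1_pos = posdef_lmin_pos(1)[OF SigM Sigpd d_pos]
lemmas l1_le_l2 = posdef_lmin_pos(2)[OF SigM Sigpd d_pos]
lemmas Si_facts = posdef_minv[OF SigM Sigpd d_pos]

lemma l2_pos: "0 < l2" using l1_pos l1_le_l2 by linarith

lemma Sisym: "msym d Si" using Si_facts(2) by (simp add: posdef_def)

lemma Sig_ge: "l1 * ip d v v \<le> qform d Sig v"
  by (rule qform_ip_all[where P="\<lambda>a b. l1 * b \<le> a"]) (rule Rayleigh(1)[OF SigM Sigsym])

lemma Sig_le: "qform d Sig v \<le> l2 * ip d v v"
  by (rule qform_ip_all[where P="\<lambda>a b. a \<le> l2 * b"]) (rule Rayleigh(2)[OF SigM Sigsym])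

lemma Si_le: "qform d Si v \<le> ip d v v / l1"
  by (rule qform_ip_all[where P="\<lambda>a b. a \<le> b / l1"]) (rule Si_facts(6))

lemma Si_ge: "ip d v v / l2 \<le> qform d Si v"
  by (rule qform_ip_all[where P="\<lambda>a b. b / l2 \<le> a"]) (rule Si_facts(5))

lemma Si_nonneg: "0 \<le> qform d Si v"
  using Si_ge[of v] ip_self_nonneg[of d v] l2_pos by (meson divide_nonneg_pos order_trans)

lemma Sig_Si: "v \<in> Rd d \<Longrightarrow> mv d Sig (mv d Si v) = v" and Si_Sig: "v \<in> Rd d \<Longrightarrow> mv d Si (mv d Sig v) = v"
  using Si_facts(3,4) mv_idm by (simp_all flip: mv_mmul)

lemma \<sigma>2M: "\<sigma>2 \<in> Md d" unfolding sigma2_def Md_def by auto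
lemma \<sigma>2sym: "msym d \<sigma>2" unfolding sigma2_def msym_def by (simp add: mult_ac)

lemma qform_\<sigma>2: "qform d \<sigma>2 v = (\<Sum>J\<in>Jset. g J c * (ip d v (rv J))\<^sup>2)"
proof -
  have "qform d \<sigma>2 v = (\<Sum>i<d. \<Sum>k<d. \<Sum>J\<in>Jset. g J c * ((v i * rv J i) * (v k * rv J k)))"
    unfolding qform_def sigma2_def rv_def
    by (intro sum.cong refl) (simp add: sum_distrib_left sum_distrib_right mult_ac)
  also have "\<dots> = (\<Sum>i<d. \<Sum>J\<in>Jset. \<Sum>k<d. g J c * ((v i * rv J i) * (v k * rv J k)))"
    by (intro sum.cong refl sum.swap)
  also have "\<dots> = (\<Sum>J\<in>Jset. \<Sum>i<d. \<Sum>k<d. g J c * ((v i * rv J i) * (v k * rv J k)))"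
    by (rule sum.swap)
  also have "\<dots> = (\<Sum>J\<in>Jset. g J c * (ip d v (rv J))\<^sup>2)"
    unfolding ip_def power2_eq_square sum_product by (simp add: sum_distrib_left)
  finally show ?thesis .
qed

lemma rv_unitv: "rv (unitv k) = unitv k"
  unfolding rv_def unitv_def by auto

text \<open>The unit jumps have positive rates, and the jump \<open>unitv k\<close> detects a
  nonzero coordinate \<open>v k\<close>.\<close>

lemma \<sigma>2pd: "posdef d \<sigma>2"
  unfolding posdef_def
proof (intro conjI ballI impI \<sigma>2sym)
  fix v assume v: "v \<in> Rd d" "\<exists>i<d. v i \<noteq> 0"
  then obtain k where k: "k < d" "v k \<noteq> 0" by auto
  show "0 < qform d \<sigma>2 v"
    unfolding qform_\<sigma>2
  proof (rule sum_pos2[of _ "unitv k"])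
    show "0 < g (unitv k) c * (ip d v (rv (unitv k)))\<^sup>2"
      using k gc_pos[OF unitJ[OF k(1)]] by (simp add: rv_unitv ip_unitv)
  qed (use finJ unitJ k gc_pos in \<open>auto simp: less_imp_le\<close>)
qed

lemma gen_Rayleigh: "2 * \<alpha> * qform d Sig v \<le> qform d \<sigma>2 v"
proof -
  obtain v' where v': "v' \<in> Rd d" "\<forall>i<d. v' i = v i" using Rd_restrict by blast
  have "qform d Sig v' = qform d Sig v" "qform d \<sigma>2 v' = qform d \<sigma>2 v"
    using v' by (auto intro: qform_cong)
  then show ?thesis using generalized_Rayleigh(1)[OF SigM Sigpd d_pos \<sigma>2M \<sigma>2sym v'(1)]
    by (simp add: alpha1_def)
qed

lemma gen_Rayleigh_attained: "\<exists>v\<in>Rd d. (\<exists>i<d. v i \<noteq> 0) \<and> qform d \<sigma>2 v = 2 * \<alpha> * qform d Sig v"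
  using generalized_Rayleigh(2)[OF SigM Sigpd d_pos \<sigma>2M \<sigma>2sym] by (simp add: alpha1_def)

text \<open>The generalised Rayleigh quotient attains its minimum, at a vector where both forms are
  positive.\<close>

lemma \<alpha>_pos: "0 < \<alpha>"
proof -
  obtain v where v: "v \<in> Rd d" "\<exists>i<d. v i \<noteq> 0" "qform d \<sigma>2 v = 2 * \<alpha> * qform d Sig v"
    using gen_Rayleigh_attained by blast
  have "0 < qform d \<sigma>2 v" "0 < qform d Sig v" using v \<sigma>2pd Sigpd unfolding posdef_def by auto
  then show ?thesis unfolding v(3) by (simp add: zero_less_mult_iff)
qed

lemma lyap_form: "2 * ip d v (mv d Sig (mv d (mtr A) v)) = - qform d \<sigma>2 v"
proof -
  have "ip d v (mv d (mmul d A Sig) v) + ip d v (mv d (mmul d Sig (mtr A)) v) + ip d v (mv d \<sigma>2 v)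
     = (\<Sum>i<d. \<Sum>k<d. v i * (mmul d A Sig i k + mmul d Sig (mtr A) i k + \<sigma>2 i k) * v k)"
    unfolding ip_mv by (simp add: sum.distrib[symmetric] algebra_simps)
  also have "\<dots> = 0" using lyap_eq by (intro sum.neutral ballI) simp
  finally have "ip d v (mv d A (mv d Sig v)) + ip d v (mv d Sig (mv d (mtr A) v)) = - qform d \<sigma>2 v"
    unfolding mv_mmul qform_ip by simp
  moreover have "ip d v (mv d A (mv d Sig v)) = ip d v (mv d Sig (mv d (mtr A) v))"
    using ip_mv_transpose[of d A v "mv d Sig v"] ip_mv_sym[OF Sigsym, of "mv d (mtr A) v" v] by simp
  ultimately show ?thesis by simp
qed

lemma lyap_ineq: "2 * ip d v (mv d Sig (mv d (mtr A) v)) \<le> - 2 * \<alpha> * qform d Sig v"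
  using lyap_form gen_Rayleigh[of v] by simp

text \<open>The dual of \<open>lyap_form\<close>: putting \<open>v = mv d Si y\<close> turns the
  decay of gradients into the inward drift in the norm of the inverse of \<open>Sig\<close>.\<close>

lemma drift_form:
  assumes "y \<in> Rd d"
  shows "2 * ip d y (mv d Si (mv d A y)) = - qform d \<sigma>2 (mv d Si y)"
proof -
  have "ip d y (mv d Si (mv d A y)) = ip d (mv d A y) (mv d Si y)"
    by (rule ip_mv_sym[OF Sisym])
  also have "\<dots> = ip d (mv d (mtr A) (mv d Si y)) y" unfolding ip_mv_transpose by (rule ip_commute)
  also have "\<dots> = ip d (mv d (mtr A) (mv d Si y)) (mv d Sig (mv d Si y))" using Sig_Si[OF assms] by simp
  also have "\<dots> = ip d (mv d Si y) (mv d Sig (mv d (mtr A) (mv d Si y)))" by (rule ip_mv_sym[OF Sigsym])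
  finally show ?thesis using lyap_form[of "mv d Si y"] by simp
qed

lemma qform_Sig_Si: "y \<in> Rd d \<Longrightarrow> qform d Sig (mv d Si y) = qform d Si y"
  unfolding qform_ip by (simp add: Sig_Si) (simp add: ip_commute)

text \<open>\<open>A\<close> is defined through the total drift, whereas the affine rates come with
  unnamed coefficients. They agree because the rate of \<open>unitv j\<close> is the only varying
  one that enters the \<open>j\<close>-th component of the drift.\<close>

lemma affine_coeff:
  assumes "j < d"
  obtains b where "\<And>\<xi>. \<xi> \<in> cballd d c \<delta>0 \<Longrightarrow> g (unitv j) \<xi> = (\<Sum>i<d. A j i * \<xi> i) + b"
proof -
  obtain a b where ab: "\<And>\<xi>. \<xi> \<in> cballd d c \<delta>0 \<Longrightarrow> g (unitv j) \<xi> = (\<Sum>i<d. a i * \<xi> i) + b"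
    using g_affine[OF assms] unfolding affine_on_set_def by blast
  have "A j k = a k" if k: "k < d" for k
  proof -
    define \<eta> where "\<eta> t = (\<lambda>i. c i + t * unitv k i)" for t :: real
    have eta: "\<eta> t \<in> cballd d c \<delta>0" if "\<bar>t\<bar> < \<delta>0" for t
    proof -
      have "vnorm d (\<lambda>i. \<eta> t i - c i) = \<bar>t\<bar> * vnorm d (unitv k)"
        unfolding \<eta>_def by (simp add: vnorm_scale)
      also have "vnorm d (unitv k) = 1" unfolding vnorm_ip using k by (simp add: ip_unitv) (simp add: unitv_def)
      finally show ?thesis using that cR k unfolding cballd_def Rd_def \<eta>_def by (auto simp: unitv_def)
    qed
    have ce: "c \<in> cballd d c \<delta>0" using eta[of 0] \<delta>0_pos by (simp add: \<eta>_def)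
    have dr: "driftF d Jset g (\<eta> t) j = a k * t" if t: "\<bar>t\<bar> < \<delta>0" for t
    proof -
      have "driftF d Jset g (\<eta> t) j = driftF d Jset g (\<eta> t) j - driftF d Jset g c j"
        using drift_c by simp
      also have "\<dots> = (\<Sum>J\<in>Jset. real_of_int (J j) * (g J (\<eta> t) - g J c))"
        unfolding driftF_def using assms by (simp add: sum_subtractf algebra_simps)
      \<comment> \<open>The other unit jumps have \<open>j\<close>-th coordinate zero, and all
        remaining jumps have constant rates on the ball.\<close>
      also have "\<dots> = (\<Sum>J\<in>{unitv j}. real_of_int (J j) * (g J (\<eta> t) - g J c))"
      proof (intro sum.mono_neutral_right finJ ballI)
        fix J assume J: "J \<in> Jset - {unitv j}"
        show "real_of_int (J j) * (g J (\<eta> t) - g J c) = 0"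
        proof (cases "J \<in> unitv ` {..<d}")
          case True
          then have "J j = 0" using J by (auto simp: unitv_def)
          then show ?thesis by simp
        qed (use J g_const eta[OF t] in auto)
      qed (use unitJ assms in auto)
      also have "\<dots> = (\<Sum>i<d. a i * (\<eta> t i - c i))"
        using ab[OF eta[OF t]] ab[OF ce] by (simp add: unitv_def sum_subtractf algebra_simps)
      also have "\<dots> = t * ip d a (unitv k)" unfolding \<eta>_def ip_def by (simp add: sum_distrib_left mult_ac)
      finally show ?thesis using k by (simp add: ip_unitv mult.commute)
    qed
    have "((\<lambda>t. a k * t) has_real_derivative a k) (at 0)" by (auto intro!: derivative_eq_intros)
    moreover have "\<forall>\<^sub>F t in nhds 0. a k * t = driftF d Jset g (\<eta> t) j"
      unfolding eventually_nhds_metric using dr \<delta>0_pos by (intro exI[of _ \<delta>0]) (simp add: dist_real_def)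
    ultimately have "((\<lambda>t. driftF d Jset g (\<eta> t) j) has_real_derivative a k) (at 0)"
      using DERIV_cong_ev[of 0 0 "\<lambda>t. a k * t" "\<lambda>t. driftF d Jset g (\<eta> t) j"] by blast
    then show ?thesis
      unfolding Amat_def pderiv_at_def using k assms by (simp add: \<eta>_def DERIV_imp_deriv)
  qed
  then show ?thesis using ab that[of b] by simp
qed

lemma c_ball: "c \<in> cballd d c \<delta>0"
  using cR \<delta>0_pos by (auto simp: cballd_def vnorm_def)

lemma g_unit_diff:
  assumes "j < d" "\<xi> \<in> cballd d c \<delta>0" "\<eta> \<in> cballd d c \<delta>0"
  shows "g (unitv j) \<xi> - g (unitv j) \<eta> = (\<Sum>i<d. A j i * (\<xi> i - \<eta> i))"
proof -
  obtain b where "\<And>\<xi>. \<xi> \<in> cballd d c \<delta>0 \<Longrightarrow> g (unitv j) \<xi> = (\<Sum>i<d. A j i * \<xi> i) + b"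
    using affine_coeff[OF assms(1)] by blast
  then show ?thesis using assms by (simp add: sum_subtractf algebra_simps)
qed

lemma drift_linear:
  assumes x: "\<xi> \<in> cballd d c \<delta>0"
  shows "(\<lambda>i. \<Sum>J\<in>Jset. g J \<xi> * rv J i) = mv d A (\<lambda>i. \<xi> i - c i)"
proof
  fix j
  show "(\<Sum>J\<in>Jset. g J \<xi> * rv J j) = mv d A (\<lambda>i. \<xi> i - c i) j"
  proof (cases "j < d")
    case True
    have "(\<Sum>J\<in>Jset. g J c * rv J j) = 0"
      using fun_cong[OF drift_c, of j] True by (simp add: driftF_def rv_def mult.commute)
    then have "(\<Sum>J\<in>Jset. g J \<xi> * rv J j) = (\<Sum>J\<in>Jset. (g J \<xi> - g J c) * rv J j)"
      by (simp add: sum_subtractf algebra_simps)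
    also have "\<dots> = (\<Sum>J\<in>{unitv j}. (g J \<xi> - g J c) * rv J j)"
    proof (intro sum.mono_neutral_right finJ ballI)
      fix J assume J: "J \<in> Jset - {unitv j}"
      show "(g J \<xi> - g J c) * rv J j = 0"
      proof (cases "J \<in> unitv ` {..<d}")
        case True
        then have "J j = 0" using J by (auto simp: unitv_def)
        then show ?thesis by (simp add: rv_def)
      qed (use J g_const x in auto)
    qed (use unitJ True in auto)
    also have "\<dots> = mv d A (\<lambda>i. \<xi> i - c i) j"
      using g_unit_diff[OF True x c_ball] True by (simp add: rv_unitv mv_def) (simp add: unitv_def)
    finally show ?thesis .
  next
    case False
    then have "rv J j = 0" if "J \<in> Jset" for J using JZ[OF that] by (simp add: Zd_def rv_def)
    then show ?thesis using False by (simp add: mv_def)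
  qed
qed

text \<open>Reflecting \<open>\<xi>\<close> in \<open>c\<close> turns the lower bound for an affine rate into an upper bound.\<close>
lemma g_upper:
  assumes J: "J \<in> Jset" and x: "\<xi> \<in> cballd d c \<delta>0"
  shows "g J \<xi> \<le> 3/2 * g J c"
proof (cases "J \<in> unitv ` {..<d}")
  case True
  then obtain j where j: "j < d" "J = unitv j" by auto
  define \<eta> where "\<eta> = (\<lambda>i. 2 * c i - \<xi> i)"
  have "vnorm d (\<lambda>i. \<eta> i - c i) = vnorm d (\<lambda>i. \<xi> i - c i)"
    unfolding vnorm_def \<eta>_def by (intro arg_cong[where f=sqrt] sum.cong) (auto simp: power2_commute)
  then have "\<eta> \<in> cballd d c \<delta>0" using x cR unfolding cballd_def Rd_def \<eta>_def by auto
  from g_unit_diff[OF j(1) this c_ball] g_half[OF j(1) this] g_unit_diff[OF j(1) x c_ball]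
  show ?thesis unfolding j(2) \<eta>_def by (simp add: sum_negf[symmetric] sum_subtractf algebra_simps)
next
  case False
  then show ?thesis using g_const[OF J False x] gc_pos[OF J] by simp
qed

lemma g_lower: "J \<in> Jset \<Longrightarrow> \<xi> \<in> cballd d c \<delta>0 \<Longrightarrow> \<mu> \<le> g J \<xi>"
proof -
  assume J: "J \<in> Jset" and x: "\<xi> \<in> cballd d c \<delta>0"
  have "\<mu> \<le> eps0 * g J c" unfolding mustar_def using finJ J by (intro Min_le) auto
  also have "eps0 * g J c \<le> g J \<xi>"
    using g_const[OF J _ x] g_half[OF _ x] gc_pos[OF J] by (cases "J \<in> unitv ` {..<d}") (auto simp: eps0_def)
  finally show ?thesis .
qed

lemma \<mu>_pos: "0 < \<mu>"
proof -
  have "(\<lambda>J. eps0 * g J c) ` Jset \<noteq> {}" using unitJ[OF d_pos] by auto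
  then have "\<mu> \<in> (\<lambda>J. eps0 * g J c) ` Jset" unfolding mustar_def using finJ by (intro Min_in) auto
  then obtain J where J: "J \<in> Jset" "\<mu> = eps0 * g J c" by auto
  then show ?thesis using gc_pos[OF J(1)] unfolding J(2) eps0_def by simp
qed

lemma \<Lambda>_pos: "0 < \<Lambda>"
proof -
  have "mtrace d \<sigma>2 = (\<Sum>i<d. qform d \<sigma>2 (unitv i))"
    unfolding mtrace_def qform_ip
    by (intro sum.cong) (auto simp: ip_unitv mv_unitv ip_commute[of d "unitv _"])
  also have "\<dots> > 0"
  proof (rule sum_pos2[of _ 0])
    have pd: "0 < qform d \<sigma>2 (unitv i)" if "i < d" for i
      using \<sigma>2pd that unfolding posdef_def by (auto simp: Rd_def unitv_def)
    show "0 < qform d \<sigma>2 (unitv 0)" using pd d_pos by simp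
    show "\<And>i. i \<in> {..<d} \<Longrightarrow> 0 \<le> qform d \<sigma>2 (unitv i)" using pd by (simp add: less_imp_le)
  qed (use d_pos in auto)
  finally show ?thesis unfolding Lambar_def lbar_def using d_pos by simp
qed

text \<open>The sum of \<open>g J c\<close> times the squared Euclidean length of \<open>J\<close>
  is the trace of \<open>sigma2\<close>, which is \<open>d\<close> times
  \<open>Lambar\<close>.\<close>

lemma trace_bound: "(\<Sum>J\<in>Jset. g J c * qform d Si (rv J)) \<le> real d * \<Lambda> / l1"
proof -
  have "(\<Sum>J\<in>Jset. g J c * qform d Si (rv J)) \<le> (\<Sum>J\<in>Jset. g J c * (ip d (rv J) (rv J) / l1))"
    by (intro sum_mono mult_left_mono Si_le) (use gc_pos in \<open>auto simp: less_imp_le\<close>)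
  also have "\<dots> = (\<Sum>J\<in>Jset. g J c * ip d (rv J) (rv J)) / l1" by (simp add: sum_divide_distrib)
  also have "(\<Sum>J\<in>Jset. g J c * ip d (rv J) (rv J)) = mtrace d \<sigma>2"
    unfolding mtrace_def sigma2_def ip_def rv_def sum_distrib_left
    by (subst sum.swap) (auto intro!: sum.cong simp: mult_ac)
  also have "mtrace d \<sigma>2 = real d * \<Lambda>" unfolding Lambar_def lbar_def using d_pos by simp
  finally show ?thesis .
qed

lemma snorm_R: "snorm d Sig x = vnorm d (mv d (minv d (msqrt d Sig)) x)"
  unfolding snorm_def Si_facts(7)[symmetric] using vnorm_nonneg by simp

lemma snorm_triangle: "snorm d Sig (\<lambda>i. x i + y i) \<le> snorm d Sig x + snorm d Sig y"
  unfolding snorm_R mv_add by (rule vnorm_triangle)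

lemma snorm_nonneg: "0 \<le> snorm d Sig x" unfolding snorm_R by (rule vnorm_nonneg)

lemma snorm_power2: "(snorm d Sig x)\<^sup>2 = qform d Si x"
  unfolding snorm_def using Si_nonneg by simp

lemma snorm_J: "J \<in> Jset \<Longrightarrow> snorm d Sig (rv J) \<le> JSmax d Jset Sig"
  unfolding snorm_R JSmax_def using finJ by (intro Max_ge) auto

lemma JSmax_pos: "0 < JSmax d Jset Sig"
proof -
  have "0 < qform d Si (unitv 0)"
    using Si_facts(2) d_pos unfolding posdef_def by (auto simp: Rd_def unitv_def)
  then have "0 < snorm d Sig (rv (unitv 0))" unfolding snorm_def rv_unitv by simp
  then show ?thesis using snorm_J[OF unitJ[OF d_pos]] by linarith
qed

lemma Si_cauchy: "\<bar>ip d x (mv d Si y)\<bar> \<le> snorm d Sig x * snorm d Sig y"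
proof -
  have "(ip d x (mv d Si y))\<^sup>2 \<le> qform d Si x * qform d Si y"
  proof (cases "qform d Si y = 0")
    case True
    then have "ip d y y = 0" using Si_ge[of y] ip_self_nonneg[of d y] l2_pos by (simp add: divide_le_0_iff)
    then have "mv d Si y = (\<lambda>_. 0)" unfolding ip_eq_0_iff by (auto simp: mv_def)
    then show ?thesis using True by (simp add: ip_def)
  next
    case False
    then have y: "qform d Si y > 0" using Si_nonneg[of y] by linarith
    define t where "t = ip d x (mv d Si y) / qform d Si y"
    have "0 \<le> qform d Si (\<lambda>i. x i - t * y i)" by (rule Si_nonneg)
    also have "\<dots> = qform d Si x - 2 * t * ip d x (mv d Si y) + t\<^sup>2 * qform d Si y"
      unfolding qform_ip mv_diff mv_scale ip_diff_right ip_scale_right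
      using ip_mv_sym[OF Sisym, of y x]
      by (simp add: ip_commute[of d "\<lambda>i. x i - t * y i"] ip_diff_right ip_scale_right
       ip_commute[of d "mv d Si y"] ip_commute[of d "mv d Si x"] algebra_simps power2_eq_square)
    also have "\<dots> = qform d Si x - (ip d x (mv d Si y))\<^sup>2 / qform d Si y"
      unfolding t_def using y by (simp add: power2_eq_square field_simps)
    finally show ?thesis using y by (simp add: field_simps)
  qed
  then have "(ip d x (mv d Si y))\<^sup>2 \<le> (snorm d Sig x * snorm d Sig y)\<^sup>2"
    by (simp add: power_mult_distrib snorm_power2)
  then show ?thesis
    using snorm_nonneg by (metis abs_le_square_iff abs_of_nonneg mult_nonneg_nonneg)
qed

end

section \<open>The restricted process and its Lyapunov function\<close>

text \<open>For \<open>x = - z\<close> with \<open>z > 0\<close> it follows from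
  \<open>(1 + z) * (1 - z + z^2) = 1 + z^3\<close> and \<open>1 + z \<le> exp z\<close>.\<close>

lemma exp_quadratic_upper:
  fixes x :: real assumes "\<bar>x\<bar> \<le> 1" shows "exp x \<le> 1 + x + x\<^sup>2"
proof (cases "0 \<le> x")
  case True then show ?thesis using exp_bound[of x] assms by simp
next
  case False
  define z where "z = - x"
  have z: "z > 0" "z \<le> 1" using False assms by (auto simp: z_def)
  have "1 \<le> (1 + z) * (1 - z + z\<^sup>2)"
    using z by (simp add: algebra_simps power2_eq_square)
  also have "\<dots> \<le> exp z * (1 - z + z\<^sup>2)"
    using z exp_ge_add_one_self[of z] by (intro mult_right_mono) (auto intro: add_nonneg_nonneg)
  finally have "exp (- z) * 1 \<le> exp (- z) * (exp z * (1 - z + z\<^sup>2))" by (intro mult_left_mono) auto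
  also have "\<dots> = 1 - z + z\<^sup>2" by (simp add: mult.assoc[symmetric] exp_minus)
  finally show ?thesis by (simp add: z_def)
qed

text \<open>The function \<open>ln m / m powr (3/4)\<close> decreases once
  \<open>ln m \<ge> 4/3\<close>, and \<open>4\<close> is already beyond that point. This is why the
  lower limit 4 in \<open>psi_inv\<close> makes the condition persist for larger
  \<open>n\<close>.\<close>

lemma ln_ge_one: "4 \<le> n \<Longrightarrow> 4/3 \<le> ln (real n)"
proof -
  assume n: "4 \<le> n"
  have "4/3 \<le> 2 * ln (2::real)" using ln2_ge_two_thirds by simp
  also have "\<dots> = ln 4" using ln_realpow[of 2 2] by simp
  also have "\<dots> \<le> ln (real n)" using n by simp
  finally show ?thesis .
qed

lemma ln_div_powr_antimono:
  fixes x y :: real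
  assumes "4 \<le> x" "x \<le> y"
  shows "ln y / y powr (3/4) \<le> ln x / x powr (3/4)"
proof -
  have "ln y * y powr (-3/4) \<le> ln x * x powr (-3/4)"
  proof (rule DERIV_nonpos_imp_nonincreasing[OF assms(2)])
    fix t :: real assume t: "x \<le> t" "t \<le> y"
    have "((\<lambda>t. ln t * t powr (-3/4)) has_real_derivative t powr (-3/4) / t * (1 - 3/4 * ln t)) (at t)"
    proof -
      have "t powr (-7/4) = t powr (-3/4) / t" using powr_diff[of t "-3/4" 1] t assms by simp
      then show ?thesis using t assms by (auto intro!: derivative_eq_intros simp: algebra_simps diff_divide_distrib)
    qed
    moreover have "4/3 \<le> ln t"
    proof -
      have "4/3 \<le> ln (real 4)" by (rule ln_ge_one) simp
      also have "\<dots> \<le> ln t" using t assms by simp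
      finally show ?thesis .
    qed
    then have "t powr (-3/4) / t * (1 - 3/4 * ln t) \<le> 0"
      using t assms by (intro mult_nonneg_nonpos) auto
    ultimately show "\<exists>z. ((\<lambda>t. ln t * t powr (-3/4)) has_real_derivative z) (at t) \<and> z \<le> 0" by blast
  qed
  then show ?thesis by (simp add: powr_minus field_simps)
qed

context elementary_process
begin

abbreviation "\<theta> \<equiv> theta1 d Jset g c \<delta>0 Sig"
abbreviation "JS \<equiv> JSmax d Jset Sig"

lemma L0_ge: "1 \<le> L0 d Jset g c \<delta>0"
proof -
  let ?J = "unitv 0 :: nat \<Rightarrow> int"
  have J: "?J \<in> Jset" by (rule unitJ[OF d_pos])
  have "g ?J c \<le> (SUP \<xi>\<in>cballd d c \<delta>0. g ?J \<xi>)"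
    by (rule cSUP_upper[OF c_ball]) (rule bdd_aboveI2[where M="3/2 * g ?J c"], rule g_upper[OF J])
  then have "1 \<le> (SUP \<xi>\<in>cballd d c \<delta>0. g ?J \<xi>) / g ?J c" using gc_pos[OF J] by simp
  also have "\<dots> \<le> L0 d Jset g c \<delta>0" unfolding L0_def using finJ J by (intro Max_ge) auto
  finally show ?thesis .
qed

lemma rho_ge: "1 \<le> rho d \<sigma>2" "1 \<le> rho d Sig"
  unfolding rho_def using posdef_lmin_pos[OF \<sigma>2M \<sigma>2pd d_pos] l1_pos l1_le_l2 by auto

lemma deltastar_pos: "0 < deltastar d Sig \<delta>0"
  unfolding deltastar_def using \<delta>0_pos l2_pos by simp

text \<open>Positivity aside, one fact for each entry of the minimum in \<open>theta1\<close>; the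
  bound 1/64 uses that \<open>L0\<close> and both condition numbers are at least 1.\<close>

lemma \<theta>_facts: "0 < \<theta>" "\<theta> * JS * deltastar d Sig \<delta>0 \<le> 1/3" "real d * \<theta> \<le> 1/64" "\<theta> * JS\<^sup>2 \<le> real d / 4"
proof -
  let ?ds = "deltastar d Sig \<delta>0" and ?K = "L0 d Jset g c \<delta>0 * rho d \<sigma>2 * rho d Sig"
  have dp: "0 < real d" using d_pos by simp
  note p = JSmax_pos deltastar_pos
  have "1 * 1 * 1 \<le> ?K" using L0_ge rho_ge by (intro mult_mono) auto
  then have K: "1 \<le> ?K" by simp
  let ?a = "1 / (3 * (JS / real d) * ?ds)" and ?b = "1 / (64 * L0 d Jset g c \<delta>0 * rho d \<sigma>2 * rho d Sig)"
    and ?c = "1 / (4 * (JS / real d)\<^sup>2)"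
  have b: "?b = 1 / (64 * ?K)" by (simp add: mult.assoc)
  have th: "\<theta> = 1 / real d * min ?a (min ?b ?c)" unfolding theta1_def ..
  have "0 < ?a" "0 < ?b" "0 < ?c" using p dp K unfolding b by auto
  then show "0 < \<theta>" unfolding th using dp by simp
  have "\<theta> \<le> 1 / real d * ?a" unfolding th using dp by (intro mult_left_mono) auto
  also have "\<dots> = 1 / (3 * JS * ?ds)" using dp by simp
  finally show "\<theta> * JS * ?ds \<le> 1/3" using p by (simp add: field_simps)
  have "real d * \<theta> \<le> ?b" unfolding th using dp by simp
  also have "\<dots> \<le> 1 / (64 * 1)" unfolding b using K by (intro divide_left_mono) auto
  finally show "real d * \<theta> \<le> 1/64" by simp
  have "\<theta> \<le> 1 / real d * ?c" unfolding th using dp by (intro mult_left_mono) auto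
  also have "\<dots> = real d / (4 * JS\<^sup>2)" using dp by (simp add: power2_eq_square)
  finally show "\<theta> * JS\<^sup>2 \<le> real d / 4" using p by (simp add: field_simps)
qed

text \<open>\<open>psi\<close> tends to 0, so the \<open>LEAST\<close> is attained, and it decreases
  from 4 on, so its bound passes from the least index to \<open>n\<close>.\<close>

lemma psi_inv_le:
  assumes "0 < \<eta>" "psi_inv d Jset g c \<delta>0 Sig \<eta> \<le> n"
  shows "4 \<le> n" "psi d Jset g c \<delta>0 Sig n \<le> \<eta>"
proof -
  define K where "K = real d * \<theta>"
  have K: "K > 0" using \<theta>_facts(1) d_pos by (simp add: K_def)
  have psi: "psi d Jset g c \<delta>0 Sig m = 4 * sqrt (ln (real m) / (K * real m powr (3/4)))" for m
    unfolding psi_def K_def ..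
  have "((\<lambda>m. 4 * sqrt (ln (real m) / (K * real m powr (3/4)))) \<longlongrightarrow> 0) at_top"
    using K by real_asymp
  then have "\<forall>\<^sub>F m in at_top. 4 * sqrt (ln (real m) / (K * real m powr (3/4))) < \<eta>"
    using assms(1) by (rule order_tendstoD)
  then obtain M where M: "\<And>m. m \<ge> M \<Longrightarrow> psi d Jset g c \<delta>0 Sig m < \<eta>"
    unfolding eventually_at_top_linorder psi by blast
  define m0 where "m0 = psi_inv d Jset g c \<delta>0 Sig \<eta>"
  have m0: "4 \<le> m0 \<and> psi d Jset g c \<delta>0 Sig m0 \<le> \<eta>"
    unfolding m0_def psi_inv_def
    by (rule LeastI[of _ "max 4 M"]) (use M[of "max 4 M"] in auto)
  then show "4 \<le> n" using assms m0_def by simp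
  have "ln (real n) / real n powr (3/4) \<le> ln (real m0) / real m0 powr (3/4)"
    using m0 assms m0_def by (intro ln_div_powr_antimono) auto
  then have "ln (real n) / real n powr (3/4) / K \<le> ln (real m0) / real m0 powr (3/4) / K"
    using K by (intro divide_right_mono) auto
  then have "psi d Jset g c \<delta>0 Sig n \<le> psi d Jset g c \<delta>0 Sig m0"
    unfolding psi by (simp add: mult.commute)
  then show "psi d Jset g c \<delta>0 Sig n \<le> \<eta>" using m0 by simp
qed

end

text \<open>The number \<open>a\<close> is any positive bound for the norm of the drift matrix; it
  is left free so that it can later be a multiple of \<open>\<alpha>\<close>. The assumption
  \<open>n_large\<close> is \<open>m_large\<close> for \<open>m = n * \<mu>\<close>.\<close>

locale restricted_process = elementary_process +
  fixes n :: nat and \<delta> a :: real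
  assumes \<delta>: "0 < \<delta>" "\<delta> \<le> min 3 (\<delta>0 / sqrt l2) / 3"
    and n4: "4 \<le> n" and psi_le: "psi d Jset g c \<delta>0 Sig n \<le> \<delta> / 2" and dn: "d ^ 4 \<le> n"
    and a: "0 < a" "opnorm d A \<le> a" and n_large: "2 * l2 * a\<^sup>2 \<le> \<alpha> * (real n * \<mu>) * l1"
begin

abbreviation "N \<equiv> real n"

lemma N_pos: "0 < N" "4 \<le> N" using n4 by auto

lemma lnN: "1 \<le> ln N" using ln_ge_one[OF n4] by simp

lemma d_powr: "real d \<le> N powr (1/4)"
proof -
  have "real d = (real d ^ 4) powr (1/4)" using d_pos by (simp add: powr_powr flip: powr_numeral)
  also have "\<dots> \<le> N powr (1/4)" using dn by (intro powr_mono2) (auto simp flip: of_nat_power)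
  finally show ?thesis .
qed

lemma d_le: "real d ^ 4 \<le> N" "real d \<le> N"
proof -
  show 1: "real d ^ 4 \<le> N" using dn by (simp flip: of_nat_power)
  have "real d ^ 1 \<le> real d ^ 4" using d_pos by (intro power_increasing) auto
  then show "real d \<le> N" using 1 by simp
qed

text \<open>Square \<open>psi_le\<close> and absorb the dimension by
  \<open>d \<le> N powr (1/4)\<close>. The 64 becomes the exponent 12 in \<open>Ex_ratio\<close>, as
  \<open>3/16 * 64 = 12\<close>.\<close>

lemma \<theta>N: "64 * ln N \<le> \<theta> * N * \<delta>\<^sup>2"
proof -
  let ?R = "ln N / (real d * \<theta> * N powr (3/4))"
  have pp: "0 < real d * \<theta> * N powr (3/4)" using \<theta>_facts(1) d_pos N_pos by simp
  have R0: "0 \<le> ?R" using pp lnN by (intro divide_nonneg_pos) auto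
  have "(4 * sqrt ?R)\<^sup>2 \<le> (\<delta> / 2)\<^sup>2"
    using psi_le R0 unfolding psi_def by (intro power_mono) auto
  then have "16 * ?R \<le> \<delta>\<^sup>2 / 4" using R0 by (simp add: power_mult_distrib power_divide)
  then have "64 * ln N \<le> \<delta>\<^sup>2 * (real d * \<theta> * N powr (3/4))" using pp by (simp add: field_simps)
  also have "\<dots> = \<theta> * \<delta>\<^sup>2 * (real d * N powr (3/4))" by simp
  also have "\<dots> \<le> \<theta> * \<delta>\<^sup>2 * (N powr (1/4) * N powr (3/4))"
    using \<theta>_facts(1) d_powr by (intro mult_left_mono mult_right_mono) auto
  also have "N powr (1/4) * N powr (3/4) = N" using N_pos by (simp flip: powr_add)
  finally show ?thesis by (simp add: mult_ac)
qed

text \<open>Jumps are short compared with the radius of the ball: \<open>\<theta> * JS^2\<close> is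
  at most \<open>d / 4\<close>, hence at most \<open>N / 4\<close>, while
  \<open>\<theta> * (N * \<delta>)^2\<close> is at least \<open>64 * N\<close>.\<close>

lemma N\<delta>: "16 * JS \<le> N * \<delta>"
proof (rule power2_le_imp_le)
  note t = \<theta>_facts
  have "64 * N \<le> 64 * ln N * N" using lnN N_pos by simp
  also have "\<dots> \<le> (\<theta> * N * \<delta>\<^sup>2) * N" using \<theta>N N_pos by (intro mult_right_mono) auto
  finally have 1: "64 * N \<le> \<theta> * (N * \<delta>)\<^sup>2" by (simp add: power2_eq_square mult_ac)
  have "256 * (\<theta> * JS\<^sup>2) \<le> 256 * (N / 4)" using t(4) d_le by (intro mult_left_mono) auto
  then have "\<theta> * (16 * JS)\<^sup>2 \<le> \<theta> * (N * \<delta>)\<^sup>2" using 1 by (simp add: power_mult_distrib)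
  then show "(16 * JS)\<^sup>2 \<le> (N * \<delta>)\<^sup>2" using t(1) by simp
  show "0 \<le> N * \<delta>" using \<delta> by simp
qed

definition ctr :: "(nat \<Rightarrow> int) \<Rightarrow> nat \<Rightarrow> real" where "ctr X = (\<lambda>i. rv X i - N * c i)"

abbreviation nrm :: "(nat \<Rightarrow> int) \<Rightarrow> real" where "nrm X \<equiv> snorm d Sig (ctr X)"

definition V :: "(nat \<Rightarrow> int) \<Rightarrow> real" where "V X = qform d Si (ctr X)"

abbreviation "S \<equiv> Bt d c Sig n \<delta>"
abbreviation "Q \<equiv> qrate d Jset g c Sig n \<delta>"

definition inner :: "real \<Rightarrow> (nat \<Rightarrow> int) set" where "inner \<rho> = {X \<in> Zd d. nrm X \<le> \<rho>}"

definition rt :: "(nat \<Rightarrow> int) \<Rightarrow> (nat \<Rightarrow> int) \<Rightarrow> real" where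
  "rt J X = N * g J (\<lambda>i. rv X i / N)"

lemma S_inner: "S = inner (N * \<delta>)"
  unfolding Bt_def inner_def ctr_def ..

lemma ctr_Rd: "X \<in> Zd d \<Longrightarrow> ctr X \<in> Rd d"
  using cR unfolding Zd_def Rd_def ctr_def rv_def by auto

lemma nrm_sq: "(nrm X)\<^sup>2 = V X" unfolding V_def by (rule snorm_power2)

lemma V_nonneg: "0 \<le> V X" unfolding V_def by (rule Si_nonneg)

lemma ctr_tr: "ctr (tr X J) = (\<lambda>i. ctr X i + rv J i)"
  unfolding ctr_def tr_def rv_def by auto

lemma tr_Zd: "X \<in> Zd d \<Longrightarrow> J \<in> Zd d \<Longrightarrow> tr X J \<in> Zd d"
  unfolding Zd_def tr_def by auto

lemma inner_tr: "X \<in> inner \<rho> \<Longrightarrow> J \<in> Jset \<Longrightarrow> \<rho> + JS \<le> \<rho>' \<Longrightarrow> tr X J \<in> inner \<rho>'"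
proof -
  assume X: "X \<in> inner \<rho>" and J: "J \<in> Jset" and r: "\<rho> + JS \<le> \<rho>'"
  have "nrm (tr X J) \<le> nrm X + JS"
    using snorm_triangle[of "ctr X" "rv J"] snorm_J[OF J] unfolding ctr_tr by linarith
  then show ?thesis using X J r JZ tr_Zd unfolding inner_def by auto
qed

lemma inner_mono: "\<rho> \<le> \<rho>' \<Longrightarrow> inner \<rho> \<subseteq> inner \<rho>'" unfolding inner_def by auto

lemma ip_ctr: "ip d (ctr X) (ctr X) \<le> l2 * V X"
  using Si_ge[of "ctr X"] l2_pos unfolding V_def by (simp add: field_simps)

lemma V_le: "X \<in> inner \<rho> \<Longrightarrow> 0 \<le> \<rho> \<Longrightarrow> V X \<le> \<rho>\<^sup>2"
  using snorm_nonneg[of "ctr X"] unfolding inner_def nrm_sq[symmetric] by (auto intro: power_mono)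

lemma finS: "finite S"
proof -
  define K where "K = \<lceil>N * (\<Sum>i<d. \<bar>c i\<bar>) + sqrt l2 * (N * \<delta>)\<rceil>"
  have "S \<subseteq> {f. \<forall>x. (x \<in> {..<d} \<longrightarrow> f x \<in> {-K..K}) \<and> (x \<notin> {..<d} \<longrightarrow> f x = 0)}"
  proof
    fix X assume X: "X \<in> S"
    have "X i \<in> {-K..K}" if i: "i < d" for i
    proof -
      have "(ctr X i)\<^sup>2 \<le> ip d (ctr X) (ctr X)"
        unfolding ip_def power2_eq_square using i by (intro member_le_sum) auto
      also have "\<dots> \<le> l2 * (N * \<delta>)\<^sup>2"
        using ip_ctr[of X] V_le[of X "N * \<delta>"] X l2_pos \<delta> unfolding S_inner
        by (meson mult_left_mono less_imp_le order_trans mult_nonneg_nonneg of_nat_0_le_iff)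
      also have "\<dots> = (sqrt l2 * (N * \<delta>))\<^sup>2" using l2_pos by (simp add: power_mult_distrib)
      finally have "\<bar>ctr X i\<bar> \<le> sqrt l2 * (N * \<delta>)"
        using \<delta> l2_pos by (intro power2_le_imp_le[of "\<bar>ctr X i\<bar>"]) auto
      moreover have "N * \<bar>c i\<bar> \<le> N * (\<Sum>i<d. \<bar>c i\<bar>)" using i by (intro mult_left_mono member_le_sum) auto
      moreover have "\<bar>rv X i\<bar> \<le> \<bar>ctr X i\<bar> + N * \<bar>c i\<bar>"
        unfolding ctr_def using abs_triangle_ineq[of "rv X i - N * c i" "N * c i"] by (simp add: abs_mult)
      ultimately have "\<bar>real_of_int (X i)\<bar> \<le> of_int K" unfolding K_def rv_def by linarith
      then show ?thesis by (simp add: abs_le_iff)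
    qed
    then show "X \<in> {f. \<forall>x. (x \<in> {..<d} \<longrightarrow> f x \<in> {-K..K}) \<and> (x \<notin> {..<d} \<longrightarrow> f x = 0)}"
      using X unfolding Bt_def Zd_def by auto
  qed
  then show ?thesis by (rule finite_subset) (intro finite_set_of_finite_funs, auto)
qed

lemma \<delta>_le1: "\<delta> \<le> 1" "\<delta> * sqrt l2 \<le> \<delta>0" "\<delta> \<le> deltastar d Sig \<delta>0 / 3"
proof -
  have 3: "\<delta> \<le> (\<delta>0 / sqrt l2) / 3" "\<delta> \<le> 1" using \<delta> by (auto simp: min_def split: if_splits)
  then show "\<delta> \<le> 1" "\<delta> \<le> deltastar d Sig \<delta>0 / 3" by (auto simp: deltastar_def)
  have "\<delta> * sqrt l2 \<le> \<delta>0 / 3" using 3 l2_pos by (simp add: field_simps)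
  then show "\<delta> * sqrt l2 \<le> \<delta>0" using \<delta>0_pos by simp
qed

lemma S_ball: "X \<in> S \<Longrightarrow> (\<lambda>i. rv X i / N) \<in> cballd d c \<delta>0"
proof -
  assume X: "X \<in> S"
  have "(\<lambda>i. rv X i / N - c i) = (\<lambda>i. (1 / N) * ctr X i)"
    using N_pos by (auto simp: ctr_def field_simps)
  then have "vnorm d (\<lambda>i. rv X i / N - c i) = (1 / N) * vnorm d (ctr X)" using N_pos by (simp only: vnorm_scale) simp
  also have "vnorm d (ctr X) \<le> sqrt (l2 * (N * \<delta>)\<^sup>2)"
    unfolding vnorm_ip
    using ip_ctr[of X] V_le[of X "N * \<delta>"] X l2_pos \<delta> unfolding S_inner
    by (intro real_sqrt_le_mono) (meson mult_left_mono less_imp_le order_trans mult_nonneg_nonneg of_nat_0_le_iff)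
  also have "\<dots> = sqrt l2 * (N * \<delta>)" using \<delta> by (simp add: real_sqrt_mult)
  finally have "vnorm d (\<lambda>i. rv X i / N - c i) \<le> (1 / N) * (sqrt l2 * (N * \<delta>))"
    using N_pos by (simp add: divide_right_mono)
  also have "\<dots> = \<delta> * sqrt l2" using N_pos by simp
  finally have "vnorm d (\<lambda>i. rv X i / N - c i) \<le> \<delta>0" using \<delta>_le1 by simp
  moreover have "(\<lambda>i. rv X i / N) \<in> Rd d" using X unfolding Bt_def Zd_def Rd_def rv_def by auto
  ultimately show ?thesis unfolding cballd_def by simp
qed

lemma rt_nonneg: "X \<in> S \<Longrightarrow> J \<in> Jset \<Longrightarrow> 0 \<le> rt J X"
  using S_ball g_nonneg unfolding rt_def cballd_def by simp

lemma rt_upper: "X \<in> S \<Longrightarrow> J \<in> Jset \<Longrightarrow> rt J X \<le> 3/2 * N * g J c"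
  using g_upper[OF _ S_ball, of J X] N_pos unfolding rt_def by simp

text \<open>Sums over target states become sums over jumps. The convention that \<open>qrate\<close>
  vanishes for \<open>X = Y\<close> is harmless, since there the increment of \<open>f\<close> is
  zero.\<close>

lemma gen_jumps:
  assumes X: "X \<in> S"
  shows "gen S Q f X = (\<Sum>J\<in>Jset. (if tr X J \<in> S then rt J X else 0) * (f (tr X J) - f X))"
proof -
  have "Q X Y * (f Y - f X) = (\<Sum>J\<in>Jset. if Y = tr X J then rt J X * (f Y - f X) else 0)" if Y: "Y \<in> S" for Y
  proof (cases "X = Y")
    case True then show ?thesis by (simp cong: if_cong)
  next
    case False
    then have "Q X Y = (\<Sum>J\<in>Jset. if (\<lambda>i. X i + J i) = Y then rt J X else 0)"
      unfolding qrate_def rt_def using X Y finJ by (simp add: sum.inter_filter)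
    then show ?thesis unfolding tr_def
      by (simp add: sum_distrib_right) (intro sum.cong refl, auto)
  qed
  then have "gen S Q f X = (\<Sum>Y\<in>S. \<Sum>J\<in>Jset. if Y = tr X J then rt J X * (f Y - f X) else 0)"
    unfolding gen_def by (intro sum.cong) auto
  also have "\<dots> = (\<Sum>J\<in>Jset. \<Sum>Y\<in>S. if Y = tr X J then rt J X * (f Y - f X) else 0)" by (rule sum.swap)
  also have "\<dots> = (\<Sum>J\<in>Jset. (if tr X J \<in> S then rt J X else 0) * (f (tr X J) - f X))"
    using finS by (intro sum.cong refl) (simp add: sum.delta)
  finally show ?thesis .
qed

abbreviation "U \<equiv> inner (N * \<delta> / 2)"

lemma U_S: "U \<subseteq> S" unfolding S_inner using \<delta> by (intro inner_mono) auto

sublocale linear_chain S Q d Jset rt U A Sig "N * \<mu>" l1 l2 a \<alpha>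
proof unfold_locales
  show "finite S" by (rule finS)
  show "0 \<le> Q X Y" if "X \<in> S" "Y \<in> S" for X Y
    unfolding qrate_def using g_nonneg[OF _ S_ball[OF that(1), unfolded cballd_def, THEN CollectD, THEN conjunct1]]
    by (auto intro!: sum_nonneg)
  show "finite Jset" by (rule finJ)
  show "unitv k \<in> Jset" if "k < d" for k by (rule unitJ[OF that])
  show "0 \<le> rt J X" if "X \<in> S" "J \<in> Jset" for X J by (rule rt_nonneg[OF that])
  show "N * \<mu> \<le> rt (unitv k) X" if "X \<in> S" "k < d" for X k
    unfolding rt_def using g_lower[OF unitJ[OF that(2)] S_ball[OF that(1)]] by (intro mult_left_mono) auto
  show "gen S Q f X = (\<Sum>J\<in>Jset. (if tr X J \<in> S then rt J X else 0) * (f (tr X J) - f X))" if "X \<in> S" for X f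
    by (rule gen_jumps[OF that])
  show "rt (unitv k) (tr X (unitv j)) = rt (unitv k) X + A k j"
    if "X \<in> S" "tr X (unitv j) \<in> S" "j < d" "k < d" for X j k
  proof -
    have "g (unitv k) (\<lambda>i. rv (tr X (unitv j)) i / N) - g (unitv k) (\<lambda>i. rv X i / N)
       = (\<Sum>i<d. A k i * (rv (tr X (unitv j)) i / N - rv X i / N))"
      using g_unit_diff[OF that(4) S_ball[OF that(2)] S_ball[OF that(1)]] .
    also have "\<dots> = (1 / N) * ip d (A k) (rv (unitv j))"
      unfolding ip_def sum_distrib_left by (intro sum.cong) (auto simp: tr_def rv_def add_divide_distrib)
    also have "\<dots> = A k j / N" using that(3) by (simp add: rv_unitv ip_unitv)
    finally show ?thesis unfolding rt_def using N_pos by (simp add: field_simps)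
  qed
  show "rt J (tr X (unitv j)) = rt J X"
    if "X \<in> S" "tr X (unitv j) \<in> S" "j < d" "J \<in> Jset" "J \<notin> unitv ` {..<d}" for X j J
    unfolding rt_def using g_const[OF that(4,5)] S_ball that(1,2) by simp
  show "U \<subseteq> S" by (rule U_S)
  \<comment> \<open>Three jumps lead from half the radius to at most the full radius, as many as a
    second difference of the generator needs.\<close>
  have j: "N * \<delta> / 2 + JS + JS + JS \<le> N * \<delta>" using N\<delta> JSmax_pos by linarith
  show "tr X (unitv i) \<in> S" if "X \<in> U" "i < d" for X i
    unfolding S_inner using that unitJ j JSmax_pos by (intro inner_tr[of X "N * \<delta> / 2"]) auto
  show "tr (tr X (unitv i)) (unitv j) \<in> S" if "X \<in> U" "i < d" "j < d" for X i j
    unfolding S_inner using that unitJ j JSmax_pos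
    by (intro inner_tr[of "tr X _" "N * \<delta> / 2 + JS"] inner_tr[of X "N * \<delta> / 2"]) auto
  show "tr X J \<in> S" if "X \<in> U" "J \<in> Jset" for X J
    unfolding S_inner using that j JSmax_pos by (intro inner_tr[of X "N * \<delta> / 2"]) auto
  show "tr (tr X (unitv i)) J \<in> S" if "X \<in> U" "i < d" "J \<in> Jset" for X i J
    unfolding S_inner using that unitJ j JSmax_pos
    by (intro inner_tr[of "tr X _" "N * \<delta> / 2 + JS"] inner_tr[of X "N * \<delta> / 2"]) auto
  show "tr (tr (tr X (unitv i)) (unitv j)) J \<in> S" if "X \<in> U" "i < d" "j < d" "J \<in> Jset" for X i j J
    unfolding S_inner using that unitJ j JSmax_pos
    by (intro inner_tr[of "tr (tr X _) _" "N * \<delta> / 2 + JS + JS"] inner_tr[of "tr X _" "N * \<delta> / 2 + JS"] inner_tr[of X "N * \<delta> / 2"]) auto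
  show "msym d Sig" by (rule Sigsym)
  show "l1 * ip d v v \<le> qform d Sig v" "qform d Sig v \<le> l2 * ip d v v" for v by (rule Sig_ge Sig_le)+
  show "ip d (mv d A v) (mv d A v) \<le> a\<^sup>2 * ip d v v" for v
  proof -
    have "(opnorm d A)\<^sup>2 \<le> a\<^sup>2" using a opnorm_nonneg by (intro power_mono) auto
    then show ?thesis using opnorm_bound[of d A v] ip_self_nonneg[of d v] by (meson mult_right_mono order_trans)
  qed
  show "2 * ip d v (mv d Sig (mv d (mtr A) v)) \<le> - 2 * \<alpha> * qform d Sig v" for v by (rule lyap_ineq)
  show "0 < l1" "0 < l2" "0 < N * \<mu>" "0 < a" "0 < \<alpha>" "0 < d"
    using l1_pos l2_pos N_pos \<mu>_pos a \<alpha>_pos d_pos by auto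
  show "2 * l2 * a\<^sup>2 \<le> \<alpha> * (N * \<mu>) * l1" by (rule n_large)
qed

text \<open>The trace of \<open>Si\<close> times \<open>sigma2\<close>, which measures how fast the
  noise increases \<open>V\<close>.\<close>

definition \<tau> :: real where "\<tau> = (\<Sum>J\<in>Jset. g J c * qform d Si (rv J))"

lemma \<tau>_nonneg: "0 \<le> \<tau>"
  unfolding \<tau>_def using gc_pos Si_nonneg by (intro sum_nonneg mult_nonneg_nonneg) (auto simp: less_imp_le)

lemma V_tr: "V (tr X J) - V X = 2 * ip d (ctr X) (mv d Si (rv J)) + qform d Si (rv J)"
  unfolding V_def ctr_tr by (subst qform_polar[OF Sisym]) simp

lemma drift_V:
  assumes X: "X \<in> S"
  shows "(\<Sum>J\<in>Jset. rt J X * (2 * ip d (ctr X) (mv d Si (rv J)))) = - qform d \<sigma>2 (mv d Si (ctr X))"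
proof -
  have XZ: "X \<in> Zd d" using X unfolding Bt_def by simp
  have "(\<lambda>i. \<Sum>J\<in>Jset. rt J X * rv J i) = mv d A (ctr X)"
  proof
    fix i
    have "(\<Sum>J\<in>Jset. rt J X * rv J i) = N * (\<Sum>J\<in>Jset. g J (\<lambda>i. rv X i / N) * rv J i)"
      unfolding rt_def by (simp add: sum_distrib_left mult_ac)
    also have "\<dots> = N * mv d A (\<lambda>i. rv X i / N - c i) i"
      using fun_cong[OF drift_linear[OF S_ball[OF X]], of i] by simp
    also have "\<dots> = mv d A (\<lambda>i. N * (rv X i / N - c i)) i" by (simp add: mv_scale)
    also have "(\<lambda>i. N * (rv X i / N - c i)) = ctr X" using N_pos by (auto simp: ctr_def field_simps)
    finally show "(\<Sum>J\<in>Jset. rt J X * rv J i) = mv d A (ctr X) i" .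
  qed
  then have "2 * ip d (ctr X) (mv d Si (\<lambda>i. \<Sum>J\<in>Jset. rt J X * rv J i)) = - qform d \<sigma>2 (mv d Si (ctr X))"
    using drift_form[OF ctr_Rd[OF XZ]] by simp
  then show ?thesis unfolding mv_sum ip_sum_right by (simp add: sum_distrib_left mult_ac)
qed

lemma jump_V: "X \<in> S \<Longrightarrow> (\<Sum>J\<in>Jset. rt J X * qform d Si (rv J)) \<le> 3/2 * N * \<tau>"
proof -
  assume X: "X \<in> S"
  have "(\<Sum>J\<in>Jset. rt J X * qform d Si (rv J)) \<le> (\<Sum>J\<in>Jset. (3/2 * N * g J c) * qform d Si (rv J))"
    using rt_upper[OF X] Si_nonneg by (intro sum_mono mult_right_mono) auto
  then show ?thesis unfolding \<tau>_def by (simp add: sum_distrib_left mult_ac)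
qed

lemma V_gen_Rayleigh: "X \<in> S \<Longrightarrow> 2 * \<alpha> * V X \<le> qform d \<sigma>2 (mv d Si (ctr X))"
  using gen_Rayleigh[of "mv d Si (ctr X)"] qform_Sig_Si[OF ctr_Rd, of X] unfolding V_def Bt_def by auto

text \<open>Jumps that leave the ball increase \<open>V\<close>, so suppressing them only decreases the drift.\<close>
lemma gen_V: "X \<in> S \<Longrightarrow> gen S Q V X \<le> - 2 * \<alpha> * V X + 3/2 * N * \<tau>"
proof -
  assume X: "X \<in> S"
  have "gen S Q V X \<le> (\<Sum>J\<in>Jset. rt J X * (V (tr X J) - V X))"
    unfolding gen_jumps[OF X]
  proof (intro sum_mono)
    fix J assume J: "J \<in> Jset"
    have "V X \<le> V (tr X J)" if "tr X J \<notin> S"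
    proof -
      have "nrm X \<le> nrm (tr X J)"
        using X that tr_Zd JZ[OF J] unfolding S_inner inner_def by auto
      then show ?thesis unfolding nrm_sq[symmetric] using snorm_nonneg by (intro power_mono) auto
    qed
    then show "(if tr X J \<in> S then rt J X else 0) * (V (tr X J) - V X) \<le> rt J X * (V (tr X J) - V X)"
      using rt_nonneg[OF X J] by auto
  qed
  also have "\<dots> = - qform d \<sigma>2 (mv d Si (ctr X)) + (\<Sum>J\<in>Jset. rt J X * qform d Si (rv J))"
    unfolding V_tr drift_V[OF X, symmetric] by (simp add: distrib_left sum.distrib)
  also have "\<dots> \<le> - 2 * \<alpha> * V X + 3/2 * N * \<tau>" using V_gen_Rayleigh[OF X] jump_V[OF X] by simp
  finally show ?thesis .
qed

definition Ex :: "(nat \<Rightarrow> int) \<Rightarrow> real" where "Ex X = exp (\<theta> * V X / N)"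

definition cE :: real where "cE = 9/4 * (\<theta> * \<tau>) * exp (9/4 * (\<theta> * \<tau>) / \<alpha>)"

text \<open>Expand \<open>exp (x J) - 1\<close> to second order. The linear terms give the inward
  drift \<open>- qs\<close> and the noise \<open>\<tau>\<close>; the smallness of
  \<open>\<theta>\<close> lets half of the drift absorb the quadratic terms.\<close>

lemma G_Ex:
  assumes XU: "X \<in> U" shows "G Ex X \<le> cE"
proof -
  have X: "X \<in> S" using XU U_S by auto
  note t = \<theta>_facts
  define y where "y = ctr X"
  define qs where "qs = qform d \<sigma>2 (mv d Si y)"
  have qs: "2 * \<alpha> * V X \<le> qs" unfolding qs_def y_def by (rule V_gen_Rayleigh[OF X])
  then have qs0: "0 \<le> qs" using V_nonneg[of X] \<alpha>_pos by (meson less_imp_le mult_nonneg_nonneg order_trans zero_le_numeral)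
  define b where "b J = ip d y (mv d Si (rv J))" for J
  define s where "s J = qform d Si (rv J)" for J
  define x where "x J = \<theta> / N * (2 * b J + s J)" for J
  have s0: "0 \<le> s J" for J unfolding s_def by (rule Si_nonneg)
  have sJ: "s J \<le> JS\<^sup>2" if "J \<in> Jset" for J
    unfolding s_def snorm_power2[symmetric] using snorm_J[OF that] snorm_nonneg by (intro power_mono) auto
  have tJ: "\<theta> / N * JS\<^sup>2 \<le> 1/4"
    using t(4) d_le N_pos by (simp add: field_simps)
  \<comment> \<open>The conditions on \<open>\<theta>\<close> bound the two parts of the exponent by
    \<open>2/9\<close> and \<open>1/4\<close>, so the quadratic bound for \<open>exp\<close>
    applies.\<close>
  have x1: "\<bar>x J\<bar> \<le> 1" if J: "J \<in> Jset" for J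
  proof -
    have "\<bar>b J\<bar> \<le> nrm X * snorm d Sig (rv J)" unfolding b_def y_def by (rule Si_cauchy)
    also have "\<dots> \<le> (N * \<delta>) * JS"
      using X snorm_J[OF J] snorm_nonneg \<delta> unfolding S_inner inner_def by (intro mult_mono) auto
    finally have "\<theta> / N * \<bar>b J\<bar> \<le> \<theta> / N * ((N * \<delta>) * JS)" using t(1) by (intro mult_left_mono) auto
    also have "\<dots> = \<theta> * JS * \<delta>" using N_pos by simp
    also have "\<dots> \<le> \<theta> * JS * (deltastar d Sig \<delta>0 / 3)" using t(1) JSmax_pos \<delta>_le1 by (intro mult_left_mono) auto
    also have "\<dots> = (\<theta> * JS * deltastar d Sig \<delta>0) / 3" by simp
    also have "\<dots> \<le> 1/9" using t(2) by linarith
    finally have b: "\<theta> / N * \<bar>b J\<bar> \<le> 1/9" .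
    have "\<theta> / N * s J \<le> 1/4"
      by (rule order_trans[OF mult_left_mono[OF sJ[OF J]] tJ]) (use t(1) in simp)
    moreover have "\<bar>x J\<bar> \<le> 2 * (\<theta> / N * \<bar>b J\<bar>) + \<theta> / N * s J"
    proof -
      have "\<bar>x J\<bar> = \<theta> / N * \<bar>2 * b J + s J\<bar>" unfolding x_def abs_mult using t(1) by simp
      also have "\<dots> \<le> \<theta> / N * (2 * \<bar>b J\<bar> + s J)"
        using t(1) s0[of J] abs_triangle_ineq[of "2 * b J" "s J"] by (intro mult_left_mono) (auto simp: abs_mult)
      also have "\<dots> = 2 * (\<theta> / N * \<bar>b J\<bar>) + \<theta> / N * s J" by (simp add: distrib_left)
      finally show ?thesis .
    qed
    ultimately show ?thesis using b by linarith
  qed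
  have ExJ: "Ex (tr X J) - Ex X = Ex X * (exp (x J) - 1)" for J
  proof -
    have "\<theta> * V (tr X J) / N = \<theta> * V X / N + x J"
      using V_tr[of X J] unfolding x_def b_def s_def y_def
      by (simp add: add_divide_distrib[symmetric] algebra_simps)
    then show ?thesis unfolding Ex_def by (simp add: exp_add algebra_simps)
  qed
  have GE: "G Ex X = Ex X * (\<Sum>J\<in>Jset. rt J X * (exp (x J) - 1))"
    unfolding G_def ExJ by (simp add: sum_distrib_left mult_ac)
  have "(\<Sum>J\<in>Jset. rt J X * (exp (x J) - 1)) \<le> (\<Sum>J\<in>Jset. rt J X * (x J + (\<theta> / N)\<^sup>2 * (8 * (b J)\<^sup>2 + 2 * JS\<^sup>2 * s J)))"
  proof (intro sum_mono mult_left_mono)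
    fix J assume J: "J \<in> Jset"
    show "0 \<le> rt J X" by (rule rt_nonneg[OF X J])
    have "(2 * b J + s J)\<^sup>2 \<le> 8 * (b J)\<^sup>2 + 2 * (s J)\<^sup>2"
      using zero_le_power2[of "2 * b J - s J"] by (simp add: power2_eq_square algebra_simps)
    also have "(s J)\<^sup>2 \<le> JS\<^sup>2 * s J" unfolding power2_eq_square[of "s J"] using sJ[OF J] s0 by (intro mult_right_mono) auto
    finally have "(x J)\<^sup>2 \<le> (\<theta> / N)\<^sup>2 * (8 * (b J)\<^sup>2 + 2 * JS\<^sup>2 * s J)"
      unfolding x_def power_mult_distrib by (intro mult_left_mono) auto
    then show "exp (x J) - 1 \<le> x J + (\<theta> / N)\<^sup>2 * (8 * (b J)\<^sup>2 + 2 * JS\<^sup>2 * s J)"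
      using exp_quadratic_upper[OF x1[OF J]] by linarith
  qed
  also have "\<dots> = \<theta> / N * ((\<Sum>J\<in>Jset. rt J X * (2 * b J)) + (\<Sum>J\<in>Jset. rt J X * s J))
     + (\<theta> / N)\<^sup>2 * (8 * (\<Sum>J\<in>Jset. rt J X * (b J)\<^sup>2) + 2 * JS\<^sup>2 * (\<Sum>J\<in>Jset. rt J X * s J))"
  proof -
    have "p * (h * (2 * u + v) + h\<^sup>2 * (8 * u\<^sup>2 + 2 * w * v))
      = (h * (p * (2 * u)) + h * (p * v)) + (h\<^sup>2 * (8 * (p * u\<^sup>2)) + h\<^sup>2 * (2 * w * (p * v)))" for p h u v w :: real
      by (simp add: algebra_simps)
    note pt = this
    have "(\<Sum>J\<in>Jset. rt J X * (x J + (\<theta> / N)\<^sup>2 * (8 * (b J)\<^sup>2 + 2 * JS\<^sup>2 * s J)))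
      = (\<Sum>J\<in>Jset. (\<theta> / N * (rt J X * (2 * b J)) + \<theta> / N * (rt J X * s J))
         + ((\<theta> / N)\<^sup>2 * (8 * (rt J X * (b J)\<^sup>2)) + (\<theta> / N)\<^sup>2 * (2 * JS\<^sup>2 * (rt J X * s J))))"
      unfolding x_def by (intro sum.cong refl pt)
    then show ?thesis by (simp only: sum.distrib distrib_left sum_distrib_left)
  qed
  also have "(\<Sum>J\<in>Jset. rt J X * (2 * b J)) = - qs" unfolding b_def qs_def y_def by (rule drift_V[OF X])
  also have "\<theta> / N * (- qs + (\<Sum>J\<in>Jset. rt J X * s J))
     + (\<theta> / N)\<^sup>2 * (8 * (\<Sum>J\<in>Jset. rt J X * (b J)\<^sup>2) + 2 * JS\<^sup>2 * (\<Sum>J\<in>Jset. rt J X * s J))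
    \<le> \<theta> / N * (- qs + 3/2 * N * \<tau>) + (\<theta> / N)\<^sup>2 * (8 * (3/2 * N * qs) + 2 * JS\<^sup>2 * (3/2 * N * \<tau>))"
  proof -
    have 1: "(\<Sum>J\<in>Jset. rt J X * s J) \<le> 3/2 * N * \<tau>" unfolding s_def by (rule jump_V[OF X])
    have 2: "(\<Sum>J\<in>Jset. rt J X * (b J)\<^sup>2) \<le> 3/2 * N * qs"
    proof -
      have bJ: "b J = ip d (mv d Si y) (rv J)" for J
        unfolding b_def by (subst ip_mv_sym[OF Sisym]) (rule ip_commute)
      have "(\<Sum>J\<in>Jset. rt J X * (b J)\<^sup>2) \<le> (\<Sum>J\<in>Jset. (3/2 * N * g J c) * (b J)\<^sup>2)"
        using rt_upper[OF X] by (intro sum_mono mult_right_mono) auto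
      then show ?thesis unfolding qs_def qform_\<sigma>2 bJ by (simp add: sum_distrib_left mult_ac)
    qed
    show ?thesis using t(1) 1 2
      by (intro add_mono mult_left_mono) auto
  qed
  also have "\<dots> = \<theta> / N * (- qs + 12 * \<theta> * qs) + 3/2 * (\<theta> * \<tau>) + 3 * (\<theta> * \<tau>) * (\<theta> / N * JS\<^sup>2)"
    using N_pos by (simp add: field_simps power2_eq_square)
  \<comment> \<open>\<open>12 * \<theta> \<le> 1/2\<close> leaves half of \<open>qs\<close>, which
    is at least \<open>\<alpha> * V X\<close>; by \<open>tJ\<close> the noise coefficient becomes
    \<open>3/2 + 3/4 = 9/4\<close>.\<close>
  also have "\<dots> \<le> \<theta> / N * (- \<alpha> * V X) + 3/2 * (\<theta> * \<tau>) + 3 * (\<theta> * \<tau>) * (1/4)"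
  proof -
    have "\<theta> \<le> real d * \<theta>" using d_pos t(1) by simp
    then have "12 * \<theta> \<le> 1/2" using t(3) by linarith
    then have "12 * \<theta> * qs \<le> 1/2 * qs" using qs0 by (intro mult_right_mono) auto
    then have "- qs + 12 * \<theta> * qs \<le> - \<alpha> * V X" using qs by linarith
    then show ?thesis using t(1) tJ \<tau>_nonneg N_pos by (intro add_mono mult_left_mono) auto
  qed
  also have "\<dots> = 9/4 * (\<theta> * \<tau>) - \<alpha> * (\<theta> * V X / N)" by (simp add: mult_ac)
  finally have "(\<Sum>J\<in>Jset. rt J X * (exp (x J) - 1)) \<le> 9/4 * (\<theta> * \<tau>) - \<alpha> * (\<theta> * V X / N)" .
  then have G1: "G Ex X \<le> Ex X * (9/4 * (\<theta> * \<tau>) - \<alpha> * (\<theta> * V X / N))"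
    unfolding GE by (rule mult_left_mono) (simp add: Ex_def)
  have tt: "0 \<le> \<theta> * \<tau>" using t(1) \<tau>_nonneg by simp
  show ?thesis
  \<comment> \<open>The bracket in \<open>G1\<close> is positive only where the exponent of
    \<open>Ex\<close> is below \<open>9/4 * (\<theta> * \<tau>) / \<alpha>\<close>. This bounds
    \<open>Ex\<close> there and is the origin of \<open>cE\<close>.\<close>
  proof (cases "9/4 * (\<theta> * \<tau>) \<le> \<alpha> * (\<theta> * V X / N)")
    case True
    then have "Ex X * (9/4 * (\<theta> * \<tau>) - \<alpha> * (\<theta> * V X / N)) \<le> 0"
      unfolding Ex_def by (intro mult_nonneg_nonpos) auto
    moreover have "0 \<le> cE" unfolding cE_def using tt by simp
    ultimately show ?thesis using G1 by linarith
  next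
    case False
    then have "\<theta> * V X / N \<le> 9/4 * (\<theta> * \<tau>) / \<alpha>" using \<alpha>_pos by (simp add: field_simps)
    then have "Ex X \<le> exp (9/4 * (\<theta> * \<tau>) / \<alpha>)" unfolding Ex_def by simp
    moreover have "9/4 * (\<theta> * \<tau>) - \<alpha> * (\<theta> * V X / N) \<le> 9/4 * (\<theta> * \<tau>)"
      using \<alpha>_pos t(1) V_nonneg[of X] N_pos by simp
    ultimately have "Ex X * (9/4 * (\<theta> * \<tau>) - \<alpha> * (\<theta> * V X / N)) \<le> exp (9/4 * (\<theta> * \<tau>) / \<alpha>) * (9/4 * (\<theta> * \<tau>))"
      using False by (intro mult_mono) (auto simp: Ex_def)
    then show ?thesis using G1 unfolding cE_def by (simp add: mult_ac)
  qed
qed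

lemma cE_nonneg: "0 \<le> cE"
  unfolding cE_def using \<theta>_facts(1) \<tau>_nonneg by simp

definition Eout :: real where "Eout = exp (\<theta> * N * \<delta>\<^sup>2 / 4)"

lemma Ex_out: "X \<in> S \<Longrightarrow> X \<notin> U \<Longrightarrow> Eout \<le> Ex X"
proof -
  assume "X \<in> S" "X \<notin> U"
  then have "N * \<delta> / 2 \<le> nrm X" unfolding S_inner inner_def by auto
  then have "(N * \<delta> / 2)\<^sup>2 \<le> V X" unfolding nrm_sq[symmetric] using \<delta> by (intro power_mono) auto
  then have "\<theta> / N * (N * \<delta> / 2)\<^sup>2 \<le> \<theta> / N * V X" using \<theta>_facts(1) by (intro mult_left_mono) auto
  then show ?thesis unfolding Eout_def Ex_def using N_pos by (simp add: power2_eq_square field_simps)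
qed

text \<open>The exponents at radii \<open>N * \<delta> / 4\<close> and
  \<open>N * \<delta> / 2\<close> differ by \<open>3/16\<close> of
  \<open>\<theta> * N * \<delta>^2\<close>, which by \<open>\<theta>N\<close> is at least
  \<open>12 * ln N\<close>.\<close>

lemma Ex_ratio:
  assumes X: "X \<in> inner (N * \<delta> / 4)" and t: "0 \<le> t"
  shows "(Ex X + cE * t) / Eout \<le> (1 + cE * t) / N ^ 12"
proof -
  have V: "V X \<le> (N * \<delta> / 4)\<^sup>2" using V_le[OF X] \<delta> by simp
  then have "\<theta> / N * V X \<le> \<theta> / N * (N * \<delta> / 4)\<^sup>2" using \<theta>_facts(1) by (intro mult_left_mono) auto
  then have E: "Ex X \<le> exp (\<theta> * N * \<delta>\<^sup>2 / 16)"
    unfolding Ex_def using N_pos by (simp add: power2_eq_square field_simps)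
  have "0 \<le> \<theta> * N * \<delta>\<^sup>2 / 16" using \<theta>_facts(1) N_pos by simp
  then have one: "1 \<le> exp (\<theta> * N * \<delta>\<^sup>2 / 16)" by (simp only: one_le_exp_iff)
  have "cE * t * 1 \<le> cE * t * exp (\<theta> * N * \<delta>\<^sup>2 / 16)" using cE_nonneg t one by (intro mult_left_mono) auto
  then have "Ex X + cE * t \<le> (1 + cE * t) * exp (\<theta> * N * \<delta>\<^sup>2 / 16)" using E by (simp add: distrib_right)
  then have "(Ex X + cE * t) / Eout \<le> (1 + cE * t) * exp (\<theta> * N * \<delta>\<^sup>2 / 16) / Eout"
    unfolding Eout_def by (intro divide_right_mono) auto
  also have "\<dots> = (1 + cE * t) * exp (- (3/16 * (\<theta> * N * \<delta>\<^sup>2)))"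
  proof -
    have "\<theta> * N * \<delta>\<^sup>2 / 16 - \<theta> * N * \<delta>\<^sup>2 / 4 = - (3/16 * (\<theta> * N * \<delta>\<^sup>2))" by simp
    then have "exp (- (3/16 * (\<theta> * N * \<delta>\<^sup>2))) = exp (\<theta> * N * \<delta>\<^sup>2 / 16) / exp (\<theta> * N * \<delta>\<^sup>2 / 4)"
      by (simp only: exp_diff[symmetric])
    then show ?thesis unfolding Eout_def by simp
  qed
  also have "\<dots> \<le> (1 + cE * t) * exp (- (12 * ln N))"
    using \<theta>N cE_nonneg t by (intro mult_left_mono) (auto simp: mult_ac)
  also have "exp (- (12 * ln N)) = 1 / N ^ 12"
    using N_pos exp_of_nat_mult[of 12 "ln N"] by (simp add: exp_minus field_simps)
  finally show ?thesis by simp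
qed

lemma Ex_nonneg: "0 \<le> Ex X" and Eout_pos: "0 < Eout" unfolding Ex_def Eout_def by auto

context
  fixes f :: "(nat \<Rightarrow> int) \<Rightarrow> real"
  assumes f: "\<And>X. X \<in> S \<Longrightarrow> \<bar>f X\<bar> \<le> 1"
begin

lemma long_time':
  assumes "0 \<le> t" "t \<le> T" "X \<in> S"
  shows "exp (\<alpha> * t) * W (ut f t) X \<le> 4 * real d * l2 + exp (\<alpha> * T) * (4 * real d * l2) * ((Ex X + cE * t) / Eout)"
  by (rule long_time[where E=Ex and Eout=Eout and c=cE])
    (use assms f Ex_nonneg G_Ex Ex_out Eout_pos cE_nonneg in blast)+

lemma short_time':
  assumes "0 \<le> t" "t \<le> T0" "X \<in> S" "(4 * a + 4 * a\<^sup>2 / (N * \<mu>)) * T0 \<le> 1"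
  shows "N * \<mu> / (2 * l2) * t * W (ut f t) X + (N * \<mu>)\<^sup>2 * l1 / (12 * l2) * t\<^sup>2 * Z (ut f t) X
    \<le> 1 + (1 + 2 * (N * \<mu>) * T0 * real d + 16 * ((N * \<mu>)\<^sup>2 * l1 / (12 * l2)) * T0\<^sup>2 * (real d)\<^sup>2) * ((Ex X + cE * t) / Eout)"
  by (rule short_time[where E=Ex and Eout=Eout and c=cE])
    (use assms f Ex_nonneg G_Ex Ex_out Eout_pos cE_nonneg in blast)+

end

end

section \<open>Mixing and smoothing\<close>

text \<open>All rates in units of \<open>\<alpha>\<close>: \<open>k\<close> for the drift matrix,
  \<open>B\<close> and \<open>Bi\<close> for \<open>\<mu>\<close>, \<open>kt\<close> for the noise
  per dimension. The thresholds serve the time growth of the barrier (\<open>N1\<close>), the path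
  argument (\<open>N2\<close>), the return to the centre (\<open>N3\<close>, \<open>N4\<close>) and
  the crude bound for short times (\<open>N5\<close>).\<close>

locale mixing_process = restricted_process +
  fixes k B kt Bi :: real
  assumes ak: "a = k * \<alpha>" "0 \<le> k" and B: "\<alpha> \<le> B * \<mu>" and kt: "\<tau> \<le> real d * kt * \<alpha>" "0 \<le> kt"
    and Bi: "\<mu> \<le> Bi * \<alpha>"
    and N1: "1 + 5 * (kt * exp kt) \<le> N" and N2: "128 * l2 \<le> N" and N3: "512 * (l2 / l1) \<le> N"
    and N4: "exp (l2 / l1 * kt) \<le> N" and N5: "1 + Bi + Bi\<^sup>2 \<le> N"
begin

text \<open>The noise \<open>\<tau>\<close> is of order \<open>d\<close>, but
  \<open>\<theta>\<close> carries a factor \<open>1/d\<close>, so \<open>cE / \<alpha>\<close> is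
  bounded independently of the dimension. The factor \<open>1 + cE * t\<close> then costs two powers
  of \<open>N\<close>.\<close>

lemma Ex_ratio':
  assumes X: "X \<in> inner (N * \<delta> / 4)" and t: "0 \<le> t" "t \<le> 5 * ln N / \<alpha>"
  shows "(Ex X + cE * t) / Eout \<le> 1 / N ^ 10"
proof -
  have th: "9/4 * (\<theta> * \<tau>) \<le> kt * \<alpha>"
  proof -
    have "\<theta> * \<tau> \<le> \<theta> * (real d * kt * \<alpha>)" using kt \<theta>_facts(1) by (intro mult_left_mono) auto
    also have "\<dots> = (real d * \<theta>) * (kt * \<alpha>)" by simp
    also have "\<dots> \<le> 1/64 * (kt * \<alpha>)" using \<theta>_facts(3) kt(2) \<alpha>_pos by (intro mult_right_mono) auto
    finally show ?thesis using kt(2) \<alpha>_pos mult_nonneg_nonneg[of kt \<alpha>] by linarith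
  qed
  then have "9/4 * (\<theta> * \<tau>) / \<alpha> \<le> kt" using \<alpha>_pos by (simp add: field_simps)
  then have "cE \<le> (kt * \<alpha>) * exp kt"
    unfolding cE_def using kt(2) \<alpha>_pos by (intro mult_mono[OF th]) auto
  then have "cE * t \<le> ((kt * \<alpha>) * exp kt) * (5 * ln N / \<alpha>)"
    using t kt(2) \<alpha>_pos by (intro mult_mono) auto
  also have "\<dots> = 5 * (kt * exp kt) * ln N" using \<alpha>_pos by simp
  also have "\<dots> \<le> 5 * (kt * exp kt) * N" using kt(2) ln_le_minus_one[OF N_pos(1)] by (intro mult_left_mono) auto
  finally have "1 + cE * t \<le> (1 + 5 * (kt * exp kt)) * N" using N_pos by (simp add: distrib_right)
  also have "\<dots> \<le> N * N" using N1 by (intro mult_right_mono) auto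
  finally have "(1 + cE * t) / N ^ 12 \<le> (N * N) / N ^ 12" by (intro divide_right_mono) auto
  also have "\<dots> = 1 / N ^ 10" using N_pos by (simp add: eval_nat_numeral)
  finally show ?thesis using Ex_ratio[OF X t(1)] by linarith
qed

text \<open>\<open>exp (- (2 * \<alpha> * t1)) = 1 / N^2\<close> cancels the largest possible value
  of \<open>V\<close>, up to a factor \<open>\<delta>^2\<close>;
  \<open>exp (\<alpha> * t2) = N^5\<close> is the gain in the squared gradient.\<close>

definition t1 :: real where "t1 = ln N / \<alpha>"
definition t2 :: real where "t2 = 5 * ln N / \<alpha>"

lemma t_nonneg: "0 < t1" "0 < t2" unfolding t1_def t2_def using lnN \<alpha>_pos by auto

lemma exp_ln_mult: "exp (real j * ln N) = N ^ j"
  using N_pos by (simp add: exp_of_nat_mult)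

text \<open>\<open>long_time'\<close> with \<open>T = t2\<close>: the weight \<open>N^5\<close>
  meets the barrier error \<open>N^-10\<close>, which therefore stays below the main term.\<close>

lemma gradient_decay:
  assumes f: "\<And>X. X \<in> S \<Longrightarrow> \<bar>f X\<bar> \<le> 1" and X: "X \<in> inner (N * \<delta> / 4)" and j: "j < d"
  shows "(Dj j (ut f t2) X)\<^sup>2 \<le> 8 * real d * (l2 / l1) / N ^ 5"
proof -
  have XS: "X \<in> S" using X inner_mono[of "N * \<delta> / 4" "N * \<delta>"] \<delta> unfolding S_inner by auto
  have at: "\<alpha> * t2 = real 5 * ln N" unfolding t2_def using \<alpha>_pos by simp
  have "exp (\<alpha> * t2) * W (ut f t2) X \<le> 4 * real d * l2 + exp (\<alpha> * t2) * (4 * real d * l2) * ((Ex X + cE * t2) / Eout)"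
    by (rule long_time'[OF f]) (use t_nonneg XS in auto)
  also have "\<dots> \<le> 4 * real d * l2 + exp (\<alpha> * t2) * (4 * real d * l2) * (1 / N ^ 10)"
    using Ex_ratio'[OF X, of t2] t_nonneg l2_pos by (intro add_left_mono mult_left_mono) (auto simp: t2_def)
  also have "\<dots> = 4 * real d * l2 * (1 + 1 / N ^ 5)"
    unfolding at exp_ln_mult using N_pos by (simp add: field_simps eval_nat_numeral)
  also have "\<dots> \<le> 4 * real d * l2 * 2"
    using l2_pos N_pos one_le_power[of N 5] by (intro mult_left_mono) auto
  finally have W: "W (ut f t2) X \<le> 8 * real d * l2 / N ^ 5"
    unfolding at exp_ln_mult using N_pos by (simp add: field_simps)
  have "(Dj j (ut f t2) X)\<^sup>2 \<le> ip d (grd (ut f t2) X) (grd (ut f t2) X)"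
    unfolding ip_def grd_def power2_eq_square using j by (intro member_le_sum[of j]) auto
  also have "\<dots> \<le> W (ut f t2) X / l1" using Sig_ge[of "grd (ut f t2) X"] l1_pos unfolding W_def by (simp add: field_simps)
  also have "\<dots> \<le> (8 * real d * l2 / N ^ 5) / l1" using W l1_pos by (intro divide_right_mono) auto
  finally show ?thesis by (simp add: mult_ac)
qed

definition Zc :: "nat \<Rightarrow> int" where "Zc i = (if i < d then round (N * c i) else 0)"

text \<open>Moving a coordinate by one step towards the integer nearest to \<open>N * c j\<close> does not increase
  its distance from \<open>N * c j\<close>, so the lattice path from \<open>X\<close> to \<open>Zc\<close> stays in the Euclidean ball.\<close>
lemma lattice_path:
  fixes u :: "(nat \<Rightarrow> int) \<Rightarrow> real"
  assumes grad: "\<And>Y j. Y \<in> Zd d \<Longrightarrow> ip d (ctr Y) (ctr Y) \<le> R2 \<Longrightarrow> j < d \<Longrightarrow> \<bar>Dj j u Y\<bar> \<le> K"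
  shows "X \<in> Zd d \<Longrightarrow> ip d (ctr X) (ctr X) \<le> R2 \<Longrightarrow> \<bar>u X - u Zc\<bar> \<le> K * (\<Sum>i<d. \<bar>real_of_int (X i - Zc i)\<bar>)"
proof (induction "nat (\<Sum>i<d. \<bar>X i - Zc i\<bar>)" arbitrary: X rule: less_induct)
  case less
  show ?case
  proof (cases "\<exists>j<d. X j \<noteq> Zc j")
    case False
    have "X i = Zc i" for i
      using False less.prems(1) by (cases "i < d") (auto simp: Zd_def Zc_def)
    then have "X = Zc" by auto
    then show ?thesis by simp
  next
    case True
    then obtain j where j: "j < d" "X j \<noteq> Zc j" by auto
    define e :: int where "e = (if X j > Zc j then -1 else 1)"
    define Y where "Y = X(j := X j + e)"
    have YZ: "Y \<in> Zd d" using less.prems(1) j unfolding Zd_def Y_def by auto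
    have step: "\<bar>Y j - Zc j\<bar> = \<bar>X j - Zc j\<bar> - 1" using j unfolding Y_def e_def by auto
    have split: "(\<Sum>i<d. F (Y i) i) = (\<Sum>i<d. F (X i) i) - F (X j) j + F (Y j) j" for F :: "int \<Rightarrow> nat \<Rightarrow> 'b::ab_group_add"
    proof -
      have "(\<Sum>i<d. F (Y i) i) = F (Y j) j + (\<Sum>i\<in>{..<d} - {j}. F (Y i) i)" using j by (intro sum.remove) auto
      also have "(\<Sum>i\<in>{..<d} - {j}. F (Y i) i) = (\<Sum>i\<in>{..<d} - {j}. F (X i) i)"
        by (intro sum.cong) (auto simp: Y_def)
      also have "\<dots> = (\<Sum>i<d. F (X i) i) - F (X j) j" using j by (subst sum.remove[of "{..<d}" j "\<lambda>i. F (X i) i"]) auto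
      finally show ?thesis by (simp add: algebra_simps)
    qed
    have s1: "(\<Sum>i<d. \<bar>Y i - Zc i\<bar>) = (\<Sum>i<d. \<bar>X i - Zc i\<bar>) - 1"
      using split[of "\<lambda>y i. \<bar>y - Zc i\<bar>"] step by simp
    have s2: "(\<Sum>i<d. \<bar>real_of_int (Y i - Zc i)\<bar>) = (\<Sum>i<d. \<bar>real_of_int (X i - Zc i)\<bar>) - 1"
    proof -
      have "\<bar>real_of_int (Y j - Zc j)\<bar> = \<bar>real_of_int (X j - Zc j)\<bar> - 1"
        using step by (metis of_int_abs of_int_diff of_int_1)
      then show ?thesis using split[of "\<lambda>y i. \<bar>real_of_int (y - Zc i)\<bar>"] by simp
    qed
    have pos: "0 < (\<Sum>i<d. \<bar>X i - Zc i\<bar>)"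
      using j by (intro sum_pos2[of _ j]) auto
    have "(ctr Y j)\<^sup>2 \<le> (ctr X j)\<^sup>2"
    proof -
      define z where "z = N * c j"
      have r: "\<bar>of_int (round z) - z\<bar> \<le> 1/2" by (rule of_int_round_abs_le)
      have Zj: "Zc j = round z" using j by (simp add: Zc_def z_def)
      have "\<bar>real_of_int (X j + e) - z\<bar> \<le> \<bar>real_of_int (X j) - z\<bar>"
      proof (cases "X j > Zc j")
        case True
        then have "real_of_int (X j) \<ge> of_int (round z) + 1" using Zj by linarith
        then show ?thesis using r True unfolding e_def by (simp add: abs_if split: if_splits)
      next
        case False
        then have "real_of_int (X j) \<le> of_int (round z) - 1" using Zj j(2) by linarith
        then show ?thesis using r False unfolding e_def by (simp add: abs_if split: if_splits)
      qed
      then show ?thesis unfolding ctr_def rv_def Y_def z_def[symmetric] by (simp add: abs_le_square_iff)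
    qed
    moreover have "ip d (ctr Y) (ctr Y) = ip d (ctr X) (ctr X) - (ctr X j)\<^sup>2 + (ctr Y j)\<^sup>2"
      using split[of "\<lambda>y i. (real_of_int y - N * c i) * (real_of_int y - N * c i)"]
      unfolding ip_def ctr_def rv_def power2_eq_square by simp
    ultimately have Yb: "ip d (ctr Y) (ctr Y) \<le> R2" using less.prems(2) by linarith
    have "\<bar>u Y - u Zc\<bar> \<le> K * (\<Sum>i<d. \<bar>real_of_int (Y i - Zc i)\<bar>)"
      by (rule less.hyps) (use s1 pos YZ Yb in auto)
    moreover have "\<bar>u X - u Y\<bar> \<le> K"
    proof (cases "X j > Zc j")
      case True
      then have "X = tr Y (unitv j)" unfolding Y_def e_def tr_def unitv_def by auto
      then have "u X - u Y = Dj j u Y" by (simp add: Dj_tr)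
      then show ?thesis using grad[OF YZ Yb j(1)] by simp
    next
      case False
      then have "Y = tr X (unitv j)" unfolding Y_def e_def tr_def unitv_def by auto
      then have "u Y - u X = Dj j u X" by (simp add: Dj_tr)
      then show ?thesis using grad[OF less.prems(1,2) j(1)] by (simp add: abs_minus_commute)
    qed
    ultimately show ?thesis unfolding s2 by (simp add: algebra_simps)
  qed
qed

text \<open>The factor \<open>l1 / l2\<close> makes room for a Euclidean ball between the two
  \<open>Sig\<close>-balls: it contains the sublevel set of \<open>V\<close> and lies within radius
  \<open>N * \<delta> / 4\<close>. Paths of \<open>lattice_path\<close> stay in it and have at most
  \<open>2 * d * sqrt R2\<close> steps.\<close>

lemma oscillation_inner:
  assumes f: "\<And>X. X \<in> S \<Longrightarrow> \<bar>f X\<bar> \<le> 1" and X: "X \<in> Zd d" and VX: "V X \<le> l1 / l2 * (N * \<delta>)\<^sup>2 / 16"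
  shows "\<bar>ut f t2 X - ut f t2 Zc\<bar> \<le> 1/8"
proof -
  define R2 where "R2 = l1 * (N * \<delta>)\<^sup>2 / 16"
  define K where "K = sqrt (8 * real d * (l2 / l1) / N ^ 5)"
  have XR: "ip d (ctr X) (ctr X) \<le> R2"
    using order_trans[OF ip_ctr mult_left_mono[OF VX]] l2_pos l1_pos unfolding R2_def by simp
  have grad: "\<bar>Dj j (ut f t2) Y\<bar> \<le> K" if Y: "Y \<in> Zd d" "ip d (ctr Y) (ctr Y) \<le> R2" "j < d" for Y j
  proof -
    have "V Y \<le> R2 / l1"
      using Si_le[of "ctr Y"] divide_right_mono[OF Y(2), of l1] l1_pos unfolding V_def by linarith
    also have "\<dots> = (N * \<delta> / 4)\<^sup>2" unfolding R2_def using l1_pos by (simp add: power_divide)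
    finally have sq: "(nrm Y)\<^sup>2 \<le> (N * \<delta> / 4)\<^sup>2" unfolding nrm_sq .
    have "nrm Y \<le> N * \<delta> / 4" by (rule power2_le_imp_le[OF sq]) (use \<delta> in simp)
    then have "Y \<in> inner (N * \<delta> / 4)" using Y unfolding inner_def by simp
    from gradient_decay[OF f this Y(3)] show ?thesis
      unfolding K_def by (intro real_le_rsqrt) simp
  qed
  have "\<bar>ut f t2 X - ut f t2 Zc\<bar> \<le> K * (\<Sum>i<d. \<bar>real_of_int (X i - Zc i)\<bar>)"
    by (rule lattice_path[OF grad X XR])
  also have "\<dots> \<le> K * (\<Sum>i<d. 2 * sqrt R2)"
  proof (intro mult_left_mono sum_mono)
    fix i assume "i \<in> {..<d}" then have i: "i < d" by simp
    have "(ctr X i)\<^sup>2 \<le> ip d (ctr X) (ctr X)" unfolding ip_def power2_eq_square using i by (intro member_le_sum) auto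
    then have "(ctr X i)\<^sup>2 \<le> R2" using XR by linarith
    then have c: "\<bar>ctr X i\<bar> \<le> sqrt R2" by (simp add: real_le_rsqrt)
    have "\<bar>N * c i - of_int (round (N * c i))\<bar> \<le> \<bar>N * c i - of_int (X i)\<bar>" by (rule round_diff_minimal)
    moreover have "\<bar>real_of_int (X i - Zc i)\<bar> \<le> \<bar>of_int (X i) - N * c i\<bar> + \<bar>N * c i - of_int (round (N * c i))\<bar>"
      using i by (simp add: Zc_def)
    ultimately show "\<bar>real_of_int (X i - Zc i)\<bar> \<le> 2 * sqrt R2" using c unfolding ctr_def rv_def by linarith
  qed (use N_pos l1_pos l2_pos in \<open>auto simp: K_def\<close>)
  also have "\<dots> = K * (2 * real d * sqrt R2)" by simp
  also have "\<dots> \<le> 1/8"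
  proof (rule power2_le_imp_le)
    have R: "R2 \<le> l1 * N\<^sup>2 / 16"
      unfolding R2_def using \<delta> \<delta>_le1 l1_pos N_pos by (intro divide_right_mono mult_left_mono power_mono) auto
    have R0: "0 \<le> R2" unfolding R2_def using l1_pos by simp
    have K2: "K\<^sup>2 = 8 * real d * (l2 / l1) / N ^ 5" unfolding K_def using l1_pos l2_pos by simp
    have "(K * (2 * real d * sqrt R2))\<^sup>2 = K\<^sup>2 * (4 * (real d)\<^sup>2 * R2)"
      using R0 by (simp add: power_mult_distrib)
    also have "\<dots> \<le> K\<^sup>2 * (4 * (real d)\<^sup>2 * (l1 * N\<^sup>2 / 16))"
      using R by (intro mult_left_mono) auto
    \<comment> \<open>Of the remaining \<open>N^-3\<close>, one power absorbs \<open>d^3\<close>,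
      one is given away, and \<open>N2\<close> makes the last small.\<close>
    also have "\<dots> = 2 * l2 * real d ^ 3 / N ^ 3"
      unfolding K2 using l1_pos N_pos by (simp add: field_simps eval_nat_numeral)
    also have "\<dots> \<le> 2 * l2 * N / N ^ 3"
    proof -
      have "real d ^ 3 \<le> real d ^ 4" using d_pos by (intro power_increasing) auto
      then have "real d ^ 3 \<le> N" using d_le by linarith
      then show ?thesis using l2_pos by (intro divide_right_mono mult_left_mono) auto
    qed
    also have "\<dots> = (2 * l2 / N) / N" using N_pos by (simp add: eval_nat_numeral)
    also have "\<dots> \<le> (2 * l2 / N) / 1" using N_pos l2_pos by (intro divide_left_mono) auto
    also have "\<dots> \<le> (1/8)\<^sup>2" using N2 N_pos by (simp add: field_simps power2_eq_square)
    finally show "(K * (2 * real d * sqrt R2))\<^sup>2 \<le> (1/8)\<^sup>2" .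
  qed simp
  finally show ?thesis .
qed

text \<open>By \<open>gen_V\<close> the solution of the linear equation
  \<open>v' = - 2 \<alpha> v + 2 \<alpha> K\<close> started at \<open>V X\<close> is a
  supersolution; \<open>K\<close> is its stationary level.\<close>

lemma semi_V:
  assumes X: "X \<in> S"
  shows "semi S Q t1 V X \<le> \<delta>\<^sup>2 + 3 * N * \<tau> / (4 * \<alpha>)"
proof -
  define K where "K = 3 * N * \<tau> / (4 * \<alpha>)"
  have K: "2 * \<alpha> * K = 3/2 * N * \<tau>" "0 \<le> K" unfolding K_def using \<alpha>_pos \<tau>_nonneg by auto
  have "semi S Q t1 V X \<le> exp (- (2 * \<alpha> * t1)) * V X + (1 - exp (- (2 * \<alpha> * t1))) * K"
  proof (rule solution_le[where T=t1 and F="\<lambda>t X. exp (- (2 * \<alpha> * t)) * V X + (1 - exp (- (2 * \<alpha> * t))) * K"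
      and F'="\<lambda>t X. exp (- (2 * \<alpha> * t)) * (- 2 * \<alpha> * V X + 2 * \<alpha> * K)"])
    fix t :: real and X assume X: "X \<in> S"
    show "((\<lambda>t. exp (- (2 * \<alpha> * t)) * V X + (1 - exp (- (2 * \<alpha> * t))) * K) has_real_derivative
      exp (- (2 * \<alpha> * t)) * (- 2 * \<alpha> * V X + 2 * \<alpha> * K)) (at t)"
      by (auto intro!: derivative_eq_intros simp: algebra_simps)
    show "gen S Q (\<lambda>X. exp (- (2 * \<alpha> * t)) * V X + (1 - exp (- (2 * \<alpha> * t))) * K) X
       \<le> exp (- (2 * \<alpha> * t)) * (- 2 * \<alpha> * V X + 2 * \<alpha> * K)"
      unfolding gen_add gen_scale gen_const K(1) using gen_V[OF X] by simp
  qed (use X t_nonneg in auto)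
  also have "\<dots> \<le> exp (- (2 * \<alpha> * t1)) * (N * \<delta>)\<^sup>2 + 1 * K"
    using V_le[of X "N * \<delta>"] X \<delta> K unfolding S_inner by (intro add_mono mult_left_mono mult_right_mono) auto
  also have "exp (- (2 * \<alpha> * t1)) = 1 / N ^ 2"
    using exp_ln_mult[of 2] \<alpha>_pos unfolding t1_def by (simp add: exp_minus field_simps)
  also have "1 / N ^ 2 * (N * \<delta>)\<^sup>2 = \<delta>\<^sup>2" using N_pos by (simp add: power_mult_distrib)
  finally show ?thesis unfolding K_def by simp
qed

text \<open>After \<open>t2\<close> the function is within 1/8 of \<open>?m\<close> where
  \<open>V \<le> r2\<close>; elsewhere the trivial distance 2 is at most \<open>2 / r2 * V\<close>.
  Averaging over \<open>t1\<close> is then Markov's inequality: the mean of \<open>V\<close> is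
  small against \<open>r2\<close> by \<open>semi_V\<close>.\<close>

lemma contraction:
  assumes f: "\<And>X. X \<in> S \<Longrightarrow> \<bar>f X\<bar> \<le> 1" and X: "X \<in> S"
  shows "\<bar>semi S Q (t1 + t2) f X - ut f t2 Zc\<bar> \<le> 1/4"
proof -
  define r2 where "r2 = l1 / l2 * (N * \<delta>)\<^sup>2 / 16"
  have r2: "0 < r2" unfolding r2_def using l1_pos l2_pos N_pos \<delta> by simp
  let ?u = "semi S Q t2 f" and ?m = "ut f t2 Zc"
  have m1: "\<bar>?m\<bar> \<le> 1" by (rule ut_abs[OF f]) (use t_nonneg in auto)
  have pt: "\<bar>?u Y - ?m\<bar> \<le> 1/8 + 2 / r2 * V Y" if Y: "Y \<in> S" for Y
  proof (cases "V Y \<le> r2")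
    case True
    then have "\<bar>ut f t2 Y - ?m\<bar> \<le> 1/8"
      using Y f unfolding r2_def by (intro oscillation_inner) (auto simp: Bt_def)
    moreover have "0 \<le> 2 / r2 * V Y" using r2 V_nonneg[of Y] by (intro mult_nonneg_nonneg) auto
    ultimately show ?thesis using Y by (simp add: ut_def)
  next
    case False
    have "\<bar>?u Y\<bar> \<le> 1" by (intro semi_abs_le f) (use t_nonneg Y in auto)
    moreover have "2 \<le> 2 / r2 * V Y" using False r2 by (simp add: field_simps)
    ultimately show ?thesis using m1 by linarith
  qed
  have VX: "2 / r2 * semi S Q t1 V X \<le> 1/8"
  proof -
    have rho: "0 < l2 / l1" using l1_pos l2_pos by simp
    have "2 / r2 * semi S Q t1 V X \<le> 2 / r2 * (\<delta>\<^sup>2 + 3 * N * \<tau> / (4 * \<alpha>))"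
      using semi_V[OF X] r2 by (intro mult_left_mono) auto
    also have "\<dots> = 32 * (l2 / l1) / N\<^sup>2 + 24 * (l2 / l1) * (\<tau> / (\<alpha> * (N * \<delta>\<^sup>2)))"
      unfolding r2_def using l1_pos l2_pos N_pos \<delta> \<alpha>_pos by (simp add: field_simps power2_eq_square)
    finally have main: "2 / r2 * semi S Q t1 V X \<le> 32 * (l2 / l1) / N\<^sup>2 + 24 * (l2 / l1) * (\<tau> / (\<alpha> * (N * \<delta>\<^sup>2)))" .
    have "32 * (l2 / l1) / N\<^sup>2 \<le> 1/16"
    proof -
      have "32 * (l2 / l1) \<le> N / 16" using N3 by simp
      also have "\<dots> \<le> N * N / 16" using N_pos by simp
      finally have "512 * (l2 / l1) \<le> N\<^sup>2" by (simp add: power2_eq_square)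
      moreover have "0 < N\<^sup>2" using N_pos by simp
      ultimately show ?thesis by (subst pos_divide_le_eq) auto
    qed
    \<comment> \<open>Multiply by \<open>\<theta>\<close>: the noise becomes at most
      \<open>kt * \<alpha> / 64\<close>, while \<open>\<theta> * N * \<delta>^2\<close> contains
      \<open>ln N\<close>, which dominates \<open>l2 / l1 * kt\<close> by \<open>N4\<close>.\<close>
    moreover have "24 * (l2 / l1) * (\<tau> / (\<alpha> * (N * \<delta>\<^sup>2))) \<le> 1/16"
    proof -
      have "l2 / l1 * kt \<le> ln N" using N4 N_pos by (simp add: ln_ge_iff)
      have "\<theta> * \<tau> \<le> \<theta> * (real d * kt * \<alpha>)" using kt \<theta>_facts(1) by (intro mult_left_mono) auto
      also have "\<dots> = (real d * \<theta>) * (kt * \<alpha>)" by simp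
      also have "\<dots> \<le> 1/64 * (kt * \<alpha>)" using \<theta>_facts(3) kt(2) \<alpha>_pos by (intro mult_right_mono) auto
      finally have 1: "64 * (\<theta> * \<tau>) \<le> kt * \<alpha>" by simp
      have "64 * (l2 / l1) * (64 * (\<theta> * \<tau>)) \<le> 64 * (l2 / l1) * (kt * \<alpha>)"
        using 1 rho by (intro mult_left_mono) auto
      also have "\<dots> = \<alpha> * (64 * (l2 / l1 * kt))" by simp
      also have "\<dots> \<le> \<alpha> * (64 * ln N)"
        using \<open>l2 / l1 * kt \<le> ln N\<close> \<alpha>_pos by (intro mult_left_mono) auto
      also have "\<dots> \<le> \<alpha> * (\<theta> * N * \<delta>\<^sup>2)" using \<theta>N \<alpha>_pos by (intro mult_left_mono) auto
      finally have "\<theta> * (4096 * (l2 / l1) * \<tau>) \<le> \<theta> * (\<alpha> * (N * \<delta>\<^sup>2))" by (simp add: mult_ac)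
      then have "4096 * (l2 / l1) * \<tau> \<le> \<alpha> * (N * \<delta>\<^sup>2)"
        using mult_left_le_imp_le \<theta>_facts(1) by blast
      moreover have "0 \<le> l2 / l1 * \<tau>" by (rule mult_nonneg_nonneg[OF less_imp_le[OF rho] \<tau>_nonneg])
      ultimately have "16 * (24 * (l2 / l1) * \<tau>) \<le> \<alpha> * (N * \<delta>\<^sup>2)" by linarith
      moreover have "0 < \<alpha> * (N * \<delta>\<^sup>2)" using \<alpha>_pos N_pos \<delta>(1) by (intro mult_pos_pos zero_less_power)
      ultimately have "24 * (l2 / l1) * \<tau> / (\<alpha> * (N * \<delta>\<^sup>2)) \<le> 1/16" by (subst pos_divide_le_eq) auto
      then show ?thesis by simp
    qed
    ultimately show ?thesis using main by linarith
  qed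
  have sp: "semi S Q (t1 + t2) f X = semi S Q t1 ?u X" using t_nonneg X by (intro semi_semi) auto
  have t1: "0 \<le> t1" using t_nonneg by simp
  have bd: "semi S Q t1 (\<lambda>Y. s * (?u Y - ?m)) X \<le> 1/4" if s: "s = 1 \<or> s = -1" for s :: real
  proof -
    have "semi S Q t1 (\<lambda>Y. s * (?u Y - ?m)) X \<le> semi S Q t1 (\<lambda>Y. 2 / r2 * V Y - (- (1/8))) X"
    proof (rule semi_mono[OF t1 X])
      fix Y assume "Y \<in> S"
      then show "s * (?u Y - ?m) \<le> 2 / r2 * V Y - (- (1/8))" using pt[of Y] s by (auto simp: abs_le_iff)
    qed
    also have "\<dots> = 2 / r2 * semi S Q t1 V X - (- (1/8))"
      unfolding semi_diff[of t1 "\<lambda>Y. 2 / r2 * V Y" "\<lambda>_. - (1/8)"] semi_scale using semi_const[OF t1 X] by simp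
    finally show ?thesis using VX by simp
  qed
  have "semi S Q t1 (\<lambda>Y. s * (?u Y - ?m)) X = s * (semi S Q (t1 + t2) f X - ?m)" for s
    unfolding semi_scale semi_diff sp using semi_const[OF t1 X] by simp
  then have "s * (semi S Q (t1 + t2) f X - ?m) \<le> 1/4" if "s = 1 \<or> s = -1" for s
    using bd[OF that] by metis
  from this[of 1] this[of "-1"]
  have "semi S Q (t1 + t2) f X - ?m \<le> 1/4" "- (semi S Q (t1 + t2) f X - ?m) \<le> 1/4"
    by (simp_all only: mult_1 mult_minus1 simp_thms)
  then show ?thesis by (rule abs_leI)
qed

lemma contracting: "x0 \<in> S \<Longrightarrow> contracting_chain S Q x0 (t1 + t2)"
proof unfold_locales
  fix f :: "(nat \<Rightarrow> int) \<Rightarrow> real" and X Y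
  assume f: "\<And>Z. Z \<in> S \<Longrightarrow> \<bar>f Z\<bar> \<le> 1" and "X \<in> S" "Y \<in> S"
  then have "\<bar>semi S Q (t1 + t2) f X - ut f t2 Zc\<bar> \<le> 1/4" "\<bar>semi S Q (t1 + t2) f Y - ut f t2 Zc\<bar> \<le> 1/4"
    using contraction by blast+
  then show "semi S Q (t1 + t2) f X - semi S Q (t1 + t2) f Y \<le> 1/2" by linarith
qed (use t_nonneg in auto)

section \<open>Smoothing up to a fixed time\<close>

definition T0 :: real where "T0 = 1 / ((4 * k + 2) * \<alpha>)"

text \<open>The last fact is the hypothesis of \<open>short_time\<close>. Here \<open>4 * a\<close>
  is \<open>4 * k * \<alpha>\<close>, and \<open>n_large\<close> bounds the quadratic term by
  \<open>2 * \<alpha>\<close>, which is the 2 in the definition of \<open>T0\<close>.\<close>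

lemma T0_facts: "0 < T0" "T0 \<le> 1 / (2 * \<alpha>)" "(4 * a + 4 * a\<^sup>2 / (N * \<mu>)) * T0 \<le> 1"
proof -
  show "0 < T0" unfolding T0_def using ak \<alpha>_pos by (simp add: add_nonneg_pos)
  have "2 * \<alpha> \<le> (4 * k + 2) * \<alpha>" using ak \<alpha>_pos by (intro mult_right_mono) auto
  then show "T0 \<le> 1 / (2 * \<alpha>)" unfolding T0_def using \<alpha>_pos by (intro divide_left_mono) auto
  have NM: "0 < N * \<mu>" using N_pos \<mu>_pos by simp
  have "2 * l2 * a\<^sup>2 \<le> \<alpha> * (N * \<mu>) * l2"
    using n_large l1_le_l2 mult_left_mono[OF l1_le_l2, of "\<alpha> * (N * \<mu>)"] \<alpha>_pos NM by (simp add: order_trans)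
  then have "l2 * (2 * a\<^sup>2) \<le> l2 * (\<alpha> * (N * \<mu>))" by (simp add: mult_ac)
  then have "2 * a\<^sup>2 \<le> \<alpha> * (N * \<mu>)" using l2_pos by simp
  then have "4 * a\<^sup>2 / (N * \<mu>) \<le> 2 * \<alpha>" using NM by (simp add: field_simps)
  then have "4 * a + 4 * a\<^sup>2 / (N * \<mu>) \<le> (4 * k + 2) * \<alpha>" unfolding ak(1) by (simp add: distrib_right)
  then have "(4 * a + 4 * a\<^sup>2 / (N * \<mu>)) * T0 \<le> ((4 * k + 2) * \<alpha>) * T0" using \<open>0 < T0\<close> by (intro mult_right_mono) auto
  also have "\<dots> = 1" unfolding T0_def using ak \<alpha>_pos by (simp add: add_nonneg_pos[THEN less_imp_neq, symmetric])
  finally show "(4 * a + 4 * a\<^sup>2 / (N * \<mu>)) * T0 \<le> 1" .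
qed

text \<open>Away from the boundary the right side of \<open>short_time'\<close> is at most 2.
  Dropping either of the two nonnegative terms on the left bounds the other, and \<open>l1\<close>
  converts \<open>W\<close> to the Euclidean gradient.\<close>

lemma short_bounds:
  assumes f: "\<And>X. X \<in> S \<Longrightarrow> \<bar>f X\<bar> \<le> 1" and X: "X \<in> inner (N * \<delta> / 4)" and t: "0 < t" "t \<le> T0"
    and ij: "i < d" "j < d"
  shows "\<bar>Dj j (ut f t) X\<bar> \<le> 2 * sqrt (l2 / l1 / (N * \<mu>)) / sqrt t"
    and "\<bar>Dj i (Dj j (ut f t)) X\<bar> \<le> sqrt (24 * (l2 / l1)) / (N * \<mu>) / t"
proof -
  have XS: "X \<in> S" using X inner_mono[of "N * \<delta> / 4" "N * \<delta>"] \<delta> unfolding S_inner by auto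
  have NM: "0 < N * \<mu>" using N_pos \<mu>_pos by simp
  define b where "b = (N * \<mu>)\<^sup>2 * l1 / (12 * l2)"
  have b: "0 < b" unfolding b_def using N_pos \<mu>_pos l1_pos l2_pos by (intro divide_pos_pos mult_pos_pos zero_less_power) auto
  let ?M = "1 + 2 * (N * \<mu>) * T0 * real d + 16 * b * T0\<^sup>2 * (real d)\<^sup>2"
  have "T0 \<le> 5 * ln N / \<alpha>"
  proof -
    have "1 / (2 * \<alpha>) \<le> 5 * ln N / \<alpha>" using lnN \<alpha>_pos by (simp add: field_simps)
    then show ?thesis using T0_facts(2) by linarith
  qed
  then have ratio: "(Ex X + cE * t) / Eout \<le> 1 / N ^ 10" using t by (intro Ex_ratio'[OF X]) auto
  have Bi0: "0 \<le> Bi" using Bi \<mu>_pos \<alpha>_pos by (metis less_imp_le less_le_trans zero_less_mult_pos2)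
  have "\<mu> * T0 \<le> \<mu> * (1 / (2 * \<alpha>))" using T0_facts(2) \<mu>_pos by (intro mult_left_mono) auto
  also have "\<dots> \<le> (Bi * \<alpha>) * (1 / (2 * \<alpha>))" using Bi \<alpha>_pos by (intro mult_right_mono) auto
  also have "\<dots> = Bi / 2" using \<alpha>_pos by simp
  finally have mT: "\<mu> * T0 \<le> Bi / 2" .
  have mT0: "0 \<le> \<mu> * T0" using \<mu>_pos T0_facts by simp
  \<comment> \<open>The crude bound is polynomial: with \<open>d \<le> N\<close> and
    \<open>\<mu> * T0 \<le> Bi / 2\<close> it is at most \<open>N^5\<close>, well within the power
    supplied by the barrier.\<close>
  have M: "?M \<le> N ^ 10"
  proof -
    have "2 * (N * \<mu>) * T0 * real d = 2 * N * (\<mu> * T0) * real d" by simp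
    also have "\<dots> \<le> 2 * N * (Bi / 2) * N" using mT mT0 d_le Bi0 by (intro mult_mono) auto
    also have "\<dots> = Bi * N ^ 2" by (simp add: power2_eq_square)
    also have "\<dots> \<le> Bi * N ^ 4" using Bi0 N_pos by (intro mult_left_mono power_increasing) auto
    finally have 1: "2 * (N * \<mu>) * T0 * real d \<le> Bi * N ^ 4" .
    have "16 * b * T0\<^sup>2 * (real d)\<^sup>2 = 4/3 * (l1 / l2) * (N\<^sup>2 * (\<mu> * T0)\<^sup>2 * (real d)\<^sup>2)"
      unfolding b_def by (simp add: power_mult_distrib mult_ac)
    also have "\<dots> \<le> 4/3 * 1 * (N\<^sup>2 * (Bi / 2)\<^sup>2 * N\<^sup>2)"
      using l1_le_l2 l1_pos l2_pos mT mT0 d_le by (intro mult_mono power_mono) auto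
    also have "\<dots> = 1/3 * Bi\<^sup>2 * N ^ 4" by (simp add: power2_eq_square eval_nat_numeral)
    also have "\<dots> \<le> Bi\<^sup>2 * N ^ 4" by simp
    finally have 2: "16 * b * T0\<^sup>2 * (real d)\<^sup>2 \<le> Bi\<^sup>2 * N ^ 4" .
    have "1 \<le> N ^ 4" using N_pos by (intro one_le_power) auto
    then have "?M \<le> (1 + Bi + Bi\<^sup>2) * N ^ 4" using 1 2 by (simp add: algebra_simps)
    also have "\<dots> \<le> N * N ^ 4" using N5 by (intro mult_right_mono) auto
    also have "\<dots> = N ^ 5" by (simp add: eval_nat_numeral)
    also have "\<dots> \<le> N ^ 10" using N_pos by (intro power_increasing) auto
    finally show ?thesis .
  qed
  have M0: "0 \<le> ?M" using NM T0_facts(1) b by (intro add_nonneg_nonneg) auto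
  have "(N * \<mu>) / (2 * l2) * t * W (ut f t) X + b * t\<^sup>2 * Z (ut f t) X \<le> 1 + ?M * ((Ex X + cE * t) / Eout)"
    unfolding b_def by (rule short_time'[OF f]) (use t XS T0_facts in auto)
  also have "\<dots> \<le> 1 + ?M * (1 / N ^ 10)" using ratio M0 by (intro add_left_mono mult_left_mono) auto
  also have "\<dots> \<le> 2" using M N_pos by (simp add: field_simps)
  finally have sum2: "(N * \<mu>) / (2 * l2) * t * W (ut f t) X + b * t\<^sup>2 * Z (ut f t) X \<le> 2" .
  have w0: "0 \<le> (N * \<mu>) / (2 * l2) * t * W (ut f t) X" and z0: "0 \<le> b * t\<^sup>2 * Z (ut f t) X"
    using NM l2_pos t b W_nonneg Z_nonneg by (auto intro!: mult_nonneg_nonneg divide_nonneg_pos)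
  have "(N * \<mu>) / (2 * l2) * t * W (ut f t) X \<le> 2" using sum2 z0 by linarith
  then have W: "W (ut f t) X \<le> 4 * l2 / (N * \<mu> * t)" using NM l2_pos t by (simp add: field_simps)
  have "(Dj j (ut f t) X)\<^sup>2 \<le> ip d (grd (ut f t) X) (grd (ut f t) X)"
    unfolding ip_def grd_def power2_eq_square using ij by (intro member_le_sum[of j]) auto
  also have "\<dots> \<le> W (ut f t) X / l1" using Sig_ge[of "grd (ut f t) X"] l1_pos unfolding W_def by (simp add: field_simps)
  also have "\<dots> \<le> (4 * l2 / (N * \<mu> * t)) / l1" using W l1_pos by (intro divide_right_mono) auto
  also have "\<dots> = (2 * sqrt (l2 / l1 / (N * \<mu>)) / sqrt t)\<^sup>2"
    using l1_pos l2_pos NM t by (simp add: power_mult_distrib power_divide)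
  finally have "\<bar>Dj j (ut f t) X\<bar>\<^sup>2 \<le> (2 * sqrt (l2 / l1 / (N * \<mu>)) / sqrt t)\<^sup>2" by (simp only: power2_abs)
  then show "\<bar>Dj j (ut f t) X\<bar> \<le> 2 * sqrt (l2 / l1 / (N * \<mu>)) / sqrt t"
    by (rule power2_le_imp_le) (use l1_pos l2_pos NM t in simp)
  have "b * t\<^sup>2 * Z (ut f t) X \<le> 2" using sum2 w0 by linarith
  then have Z: "Z (ut f t) X \<le> 2 / (b * t\<^sup>2)" using b t by (simp add: field_simps)
  have "(Dj i (Dj j (ut f t)) X)\<^sup>2 \<le> (\<Sum>j<d. (Dj i (Dj j (ut f t)) X)\<^sup>2)"
    using ij by (intro member_le_sum[of j "{..<d}" "\<lambda>j. (Dj i (Dj j (ut f t)) X)\<^sup>2"]) auto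
  also have "\<dots> \<le> Z (ut f t) X"
    unfolding Z_def using ij
    by (intro member_le_sum[of i "{..<d}" "\<lambda>i. \<Sum>j<d. (Dj i (Dj j (ut f t)) X)\<^sup>2"]) (auto intro: sum_nonneg)
  also have "\<dots> \<le> 2 / (b * t\<^sup>2)" by (rule Z)
  also have "\<dots> = (sqrt (24 * (l2 / l1)) / (N * \<mu>) / t)\<^sup>2"
    unfolding b_def using l1_pos l2_pos NM t by (simp add: power_divide power_mult_distrib field_simps)
  finally have "\<bar>Dj i (Dj j (ut f t)) X\<bar>\<^sup>2 \<le> (sqrt (24 * (l2 / l1)) / (N * \<mu>) / t)\<^sup>2" by (simp only: power2_abs)
  then show "\<bar>Dj i (Dj j (ut f t)) X\<bar> \<le> sqrt (24 * (l2 / l1)) / (N * \<mu>) / t"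
    by (rule power2_le_imp_le) (use l1_pos l2_pos NM t in simp)
qed

end

section \<open>The solution of the Stein equation\<close>

context mixing_process
begin

definition solB :: "(nat \<Rightarrow> int) set \<Rightarrow> (nat \<Rightarrow> int) \<Rightarrow> real" where
  "solB Bs = hB d Jset g c Sig n \<delta> Bs"

lemma inner_S: "inner (N * \<delta> / 4) \<subseteq> S"
  unfolding S_inner using \<delta> by (intro inner_mono) auto

lemma inner_U: "inner (N * \<delta> / 4) \<subseteq> U"
  using \<delta> by (intro inner_mono) auto

text \<open>Any \<open>x0\<close> in \<open>S\<close> may serve as base point. The state inserted in
  \<open>probB\<close> lies in \<open>S\<close>, so the sum there is the semigroup applied to the
  indicator of \<open>Bs\<close>.\<close>

lemma solB_stein:
  assumes "x0 \<in> S" "Y \<in> S"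
  shows "solB Bs Y = contracting_chain.stein S Q x0 (t1 + t2) (\<lambda>Y. if Y \<in> Bs then 1 else 0) Y"
proof -
  interpret cc: contracting_chain S Q x0 "t1 + t2" by (rule contracting[OF assms(1)])
  have sum: "(\<Sum>Y\<in>Bs \<inter> S. F Y) = (\<Sum>Y\<in>S. F Y * (if Y \<in> Bs then 1 else 0))" for F :: "(nat \<Rightarrow> int) \<Rightarrow> real"
    by (subst Int_commute, subst sum.inter_restrict[OF finS]) (intro sum.cong, auto)
  have "probB d Jset g c Sig n \<delta> Bs t Y = semi S Q t (\<lambda>Y. if Y \<in> Bs then 1 else 0) Y" for t
    unfolding probB_def semi_def insert_absorb[OF assms(2)] sum ..
  moreover have "PiB d Jset g c Sig n \<delta> Bs = cc.eq_mean (\<lambda>Y. if Y \<in> Bs then 1 else 0)"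
    unfolding PiB_def sum cc.eq_mean_def cc.equil_eq ..
  ultimately show ?thesis unfolding solB_def hB_def cc.stein_def by simp
qed

lemma T_sum: "3 * (t1 + t2) = 18 * ln N / \<alpha>"
  unfolding t1_def t2_def by (simp add: field_simps)

lemma solB_bound: "X \<in> S \<Longrightarrow> \<bar>solB Bs X\<bar> \<le> 18 * ln N / \<alpha>"
proof -
  assume X: "X \<in> S"
  interpret cc: contracting_chain S Q X "t1 + t2" by (rule contracting[OF X])
  show ?thesis unfolding solB_stein[OF X X] T_sum[symmetric] by (rule cc.stein_bound) (use X in auto)
qed

lemma T0_scaled: "0 < T0 / N" "T0 / N \<le> T0" "T0 / N \<le> 1 / (N * \<alpha>)"
proof -
  show "0 < T0 / N" "T0 / N \<le> T0" using T0_facts(1) N_pos by (auto simp: field_simps)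
  have "1 / (2 * \<alpha>) \<le> 1 / \<alpha>" using \<alpha>_pos by (simp add: field_simps)
  then have "T0 \<le> 1 / \<alpha>" using T0_facts(2) by linarith
  then have "T0 / N \<le> (1 / \<alpha>) / N" using N_pos by (intro divide_right_mono) auto
  then show "T0 / N \<le> 1 / (N * \<alpha>)" by (simp add: mult.commute)
qed

lemma ut_S: "Y \<in> S \<Longrightarrow> ut f t Y = semi S Q t f Y" unfolding ut_def by simp

text \<open>\<open>stein_functional\<close> with weights 1 and -1 and cut-off \<open>T0 / N\<close>.
  The bound \<open>2 * r / sqrt t\<close> integrates without a logarithm; the one in the conclusion
  comes from the mixing time.\<close>

lemma solB_diff1:
  assumes X: "X \<in> inner (N * \<delta> / 4)" and j: "j < d"
  defines "r \<equiv> sqrt (l2 / l1 / (N * \<mu>))"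
  shows "\<bar>Dj j (solB Bs) X\<bar> \<le> 2 * (T0 / N) + 4 * r * sqrt T0 + 2 * r / sqrt T0 * (18 * ln N / \<alpha>)"
proof -
  let ?p = "tr X (unitv j)"
  have XS: "X \<in> S" and pS: "?p \<in> S" using X j inner_S inner_U U1 by auto
  interpret cc: contracting_chain S Q X "t1 + t2" by (rule contracting[OF XS])
  have r: "0 \<le> r" unfolding r_def using l1_pos l2_pos N_pos \<mu>_pos by simp
  define f where "f = (\<lambda>Y. if Y \<in> Bs then 1 else 0 :: real)"
  have two: "(\<Sum>i\<in>{..<2::nat}. [1, -1] ! i * F ([?p, X] ! i)) = F ?p - F X" for F :: "(nat \<Rightarrow> int) \<Rightarrow> real"
    by (simp add: numeral_2_eq_2)
  have "\<bar>\<Sum>i\<in>{..<2::nat}. [1, -1] ! i * cc.stein f ([?p, X] ! i)\<bar>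
     \<le> 2 * (T0 / N) + (4 * r * sqrt T0 - 4 * r * sqrt (T0 / N)) + 2 * r / sqrt T0 * (3 * (t1 + t2))"
  proof (rule cc.stein_functional[where \<beta>="\<lambda>t. 2 * r / sqrt t"])
    fix i assume "i \<in> {..<2::nat}"
    then show "[?p, X] ! i \<in> S" using XS pS by (auto simp: less_2_cases_iff)
  next
    show "(\<Sum>i\<in>{..<2::nat}. [1, -1] ! i) = (0::real)" by (simp add: numeral_2_eq_2)
  next
    fix h :: "(nat \<Rightarrow> int) \<Rightarrow> real" and t assume h: "\<And>X. X \<in> S \<Longrightarrow> \<bar>h X\<bar> \<le> 1" and t: "0 \<le> (t::real)"
    have "\<bar>semi S Q t h ?p\<bar> \<le> 1" "\<bar>semi S Q t h X\<bar> \<le> 1" using h t XS pS by (auto intro: semi_abs_le)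
    then show "\<bar>\<Sum>i\<in>{..<2::nat}. [1, -1] ! i * semi S Q t h ([?p, X] ! i)\<bar> \<le> 2" unfolding two by linarith
  next
    fix h :: "(nat \<Rightarrow> int) \<Rightarrow> real" and t assume h: "\<And>X. X \<in> S \<Longrightarrow> \<bar>h X\<bar> \<le> 1" and t: "T0 / N \<le> t" "t \<le> T0"
    have "\<bar>Dj j (ut h t) X\<bar> \<le> 2 * r / sqrt t"
      unfolding r_def by (rule short_bounds(1)[OF h X _ t(2) j j]) (use t T0_scaled in auto)
    then show "\<bar>\<Sum>i\<in>{..<2::nat}. [1, -1] ! i * semi S Q t h ([?p, X] ! i)\<bar> \<le> 2 * r / sqrt t"
      unfolding two by (simp add: Dj_tr ut_S XS pS)
  next
    show "((\<lambda>t. 2 * r / sqrt t) has_integral (4 * r * sqrt T0 - 4 * r * sqrt (T0 / N))) {T0 / N..T0}"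
    proof (rule fundamental_theorem_of_calculus[OF T0_scaled(2)])
      fix t assume "t \<in> {T0 / N..T0}"
      then have "t > 0" using T0_scaled by auto
      then have "((\<lambda>t. 4 * r * sqrt t) has_real_derivative 2 * r / sqrt t) (at t)"
        by (auto intro!: derivative_eq_intros simp: field_simps)
      then show "((\<lambda>t. 4 * r * sqrt t) has_vector_derivative 2 * r / sqrt t) (at t within {T0 / N..T0})"
        by (simp add: has_real_derivative_iff_has_vector_derivative has_vector_derivative_at_within)
    qed
  qed (use T0_scaled in \<open>auto simp: f_def\<close>)
  moreover have "0 \<le> 4 * r * sqrt (T0 / N)" using r T0_scaled by simp
  ultimately show ?thesis
    unfolding two Dj_tr solB_stein[OF XS XS] solB_stein[OF XS pS] f_def[symmetric] T_sum by linarith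
qed

text \<open>The four weights form a second difference. Integrating \<open>r / t\<close> from
  \<open>T0 / N\<close> to \<open>T0\<close> gives exactly \<open>r * ln N\<close>, while the
  trivial bound 4 before \<open>T0 / N\<close> contributes only order \<open>1 / N\<close>.\<close>

lemma solB_diff2:
  assumes X: "X \<in> inner (N * \<delta> / 4)" and j: "i < d" "j < d"
  defines "r \<equiv> sqrt (24 * (l2 / l1)) / (N * \<mu>)"
  shows "\<bar>Dj i (Dj j (solB Bs)) X\<bar> \<le> 4 * (T0 / N) + r * ln N + r / T0 * (18 * ln N / \<alpha>)"
proof -
  let ?a = "tr (tr X (unitv i)) (unitv j)" and ?b = "tr X (unitv i)" and ?c = "tr X (unitv j)"
  have XS: "X \<in> S" and aS: "?a \<in> S" and bS: "?b \<in> S" and cS: "?c \<in> S"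
    using X j inner_S inner_U U1 U2 by auto
  interpret cc: contracting_chain S Q X "t1 + t2" by (rule contracting[OF XS])
  define f where "f = (\<lambda>Y. if Y \<in> Bs then 1 else 0 :: real)"
  let ?w = "[1, -1, -1, 1 :: real]" and ?x = "[?a, ?b, ?c, X]"
  have four: "(\<Sum>i\<in>{..<4::nat}. ?w ! i * F (?x ! i)) = F ?a - F ?b - (F ?c - F X)" for F :: "(nat \<Rightarrow> int) \<Rightarrow> real"
    by (simp add: eval_nat_numeral)
  have D: "Dj i (Dj j F) X = F ?a - F ?b - (F ?c - F X)" for F unfolding Dj_tr ..
  have "\<bar>\<Sum>i\<in>{..<4::nat}. ?w ! i * cc.stein f (?x ! i)\<bar>
     \<le> 4 * (T0 / N) + (r * ln T0 - r * ln (T0 / N)) + r / T0 * (3 * (t1 + t2))"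
  proof (rule cc.stein_functional[where \<beta>="\<lambda>t. r / t"])
    fix i assume "i \<in> {..<4::nat}"
    then have "i = 0 \<or> i = 1 \<or> i = 2 \<or> i = 3" by auto
    then show "?x ! i \<in> S" using XS aS bS cS by (auto simp: eval_nat_numeral)
  next
    show "(\<Sum>i\<in>{..<4::nat}. ?w ! i) = (0::real)" by (simp add: eval_nat_numeral)
  next
    fix h :: "(nat \<Rightarrow> int) \<Rightarrow> real" and t assume h: "\<And>X. X \<in> S \<Longrightarrow> \<bar>h X\<bar> \<le> 1" and t: "0 \<le> (t::real)"
    have "\<bar>semi S Q t h ?a\<bar> \<le> 1" "\<bar>semi S Q t h ?b\<bar> \<le> 1" "\<bar>semi S Q t h ?c\<bar> \<le> 1" "\<bar>semi S Q t h X\<bar> \<le> 1"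
      using h t XS aS bS cS by (auto intro: semi_abs_le)
    then show "\<bar>\<Sum>i\<in>{..<4::nat}. ?w ! i * semi S Q t h (?x ! i)\<bar> \<le> 4" unfolding four by linarith
  next
    fix h :: "(nat \<Rightarrow> int) \<Rightarrow> real" and t assume h: "\<And>X. X \<in> S \<Longrightarrow> \<bar>h X\<bar> \<le> 1" and t: "T0 / N \<le> t" "t \<le> T0"
    have "\<bar>Dj i (Dj j (ut h t)) X\<bar> \<le> r / t"
      unfolding r_def by (rule short_bounds(2)[OF h X _ t(2) j]) (use t T0_scaled in auto)
    then show "\<bar>\<Sum>i\<in>{..<4::nat}. ?w ! i * semi S Q t h (?x ! i)\<bar> \<le> r / t"
      unfolding four by (simp add: D ut_S XS aS bS cS)
  next
    show "((\<lambda>t. r / t) has_integral (r * ln T0 - r * ln (T0 / N))) {T0 / N..T0}"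
    proof (rule fundamental_theorem_of_calculus[OF T0_scaled(2)])
      fix t assume "t \<in> {T0 / N..T0}"
      then have "t > 0" using T0_scaled by auto
      then have "((\<lambda>t. r * ln t) has_real_derivative r / t) (at t)"
        by (auto intro!: derivative_eq_intros)
      then show "((\<lambda>t. r * ln t) has_vector_derivative r / t) (at t within {T0 / N..T0})"
        by (simp add: has_real_derivative_iff_has_vector_derivative has_vector_derivative_at_within)
    qed
  qed (use T0_scaled in \<open>auto simp: f_def\<close>)
  moreover have "r * ln T0 - r * ln (T0 / N) = r * ln N"
    using T0_facts(1) N_pos by (simp add: ln_div algebra_simps)
  ultimately show ?thesis
    unfolding four D solB_stein[OF XS XS] solB_stein[OF XS aS] solB_stein[OF XS bS] solB_stein[OF XS cS]
      f_def[symmetric] T_sum by linarith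
qed

lemma d_powr_ge: "0 \<le> e \<Longrightarrow> 1 \<le> real d powr e"
  using d_pos by (intro ge_one_powr_ge_zero) auto

text \<open>Rewrites the three contributions in units of \<open>\<alpha>\<close>, through
  \<open>\<alpha> \<le> B * \<mu>\<close>. The 40 is \<open>4 + 2 * 18\<close>: smoothing up to
  \<open>T0\<close>, and mixing after it.\<close>

lemma final_diff1:
  assumes X: "X \<in> inner (N * \<delta> / 4)" and j: "j < d"
  shows "\<bar>Dj j (solB Bs) X\<bar>
    \<le> (2 + 40 * sqrt (l2 / l1 * (4 * k + 2) * B)) * real d powr (1/4) * N powr (-1/2) * ln N / \<alpha>"
proof -
  define \<rho> where "\<rho> = l2 / l1"
  define D where "D = 4 * k + 2"
  define r where "r = sqrt (\<rho> / (N * \<mu>))"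
  define s where "s = sqrt (\<rho> * D * B)"
  have \<rho>: "0 < \<rho>" unfolding \<rho>_def using l1_pos l2_pos by simp
  have D: "1 \<le> D" unfolding D_def using ak by simp
  have T0: "T0 = 1 / (D * \<alpha>)" unfolding T0_def D_def ..
  have B0: "0 < B" using B \<alpha>_pos \<mu>_pos by (metis less_le_trans zero_less_mult_pos2)
  have NM: "0 < N * \<mu>" using N_pos \<mu>_pos by simp
  have pN: "N powr (-1/2) = 1 / sqrt N" using N_pos by (simp add: powr_minus powr_half_sqrt field_simps)
  have 1: "2 * (T0 / N) \<le> 2 * (1 / sqrt N) * ln N / \<alpha>"
  proof -
    have "sqrt N * 1 \<le> sqrt N * sqrt N" using N_pos by (intro mult_left_mono) auto
    then have "sqrt N \<le> N" by simp
    then have "1 / N \<le> 1 / sqrt N" using N_pos by (intro divide_left_mono) auto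
    then have "1 / N * 1 \<le> 1 / sqrt N * ln N" using lnN by (intro mult_mono) auto
    then have "1 / N / \<alpha> \<le> 1 / sqrt N * ln N / \<alpha>" using \<alpha>_pos by (intro divide_right_mono) auto
    then show ?thesis using T0_scaled(3) by simp
  qed
  have 2: "r * sqrt T0 \<le> s / sqrt N / \<alpha>"
  proof (rule power2_le_imp_le)
    have "\<alpha> \<le> B * \<mu> * 1" using B by simp
    also have "\<dots> \<le> B * \<mu> * (D * D)"
      using D B0 \<mu>_pos mult_mono[OF D D] by (intro mult_left_mono) auto
    finally have "\<rho> * \<alpha> \<le> \<rho> * (B * \<mu> * (D * D))" using \<rho> by (intro mult_left_mono) auto
    then have "\<rho> / (N * \<mu>) * (1 / (D * \<alpha>)) \<le> \<rho> * D * B / N / \<alpha>\<^sup>2"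
      using N_pos \<mu>_pos D \<alpha>_pos by (simp add: field_simps power2_eq_square)
    then show "(r * sqrt T0)\<^sup>2 \<le> (s / sqrt N / \<alpha>)\<^sup>2"
      unfolding r_def s_def T0 using \<rho> D B0 NM N_pos \<alpha>_pos by (simp add: power_mult_distrib power_divide)
    show "0 \<le> s / sqrt N / \<alpha>" unfolding s_def using \<rho> D B0 N_pos \<alpha>_pos by simp
  qed
  have 3: "r / sqrt T0 \<le> s / sqrt N"
  proof (rule power2_le_imp_le)
    have "\<rho> * D * \<alpha> \<le> \<rho> * D * (B * \<mu>)" using B \<rho> D by (intro mult_left_mono) auto
    then have "\<rho> / (N * \<mu>) / (1 / (D * \<alpha>)) \<le> \<rho> * D * B / N"
      using N_pos \<mu>_pos D \<alpha>_pos by (simp add: field_simps)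
    then show "(r / sqrt T0)\<^sup>2 \<le> (s / sqrt N)\<^sup>2"
      unfolding r_def s_def T0 using \<rho> D B0 NM N_pos \<alpha>_pos by (simp add: power_divide)
    show "0 \<le> s / sqrt N" unfolding s_def using \<rho> D B0 N_pos by simp
  qed
  have s0: "0 \<le> s" unfolding s_def using \<rho> D B0 by simp
  have "4 * (r * sqrt T0) \<le> 4 * (s / sqrt N / \<alpha>) * ln N"
  proof -
    have "0 \<le> 4 * (s / sqrt N / \<alpha>)" using s0 N_pos \<alpha>_pos by simp
    then have "4 * (s / sqrt N / \<alpha>) * 1 \<le> 4 * (s / sqrt N / \<alpha>) * ln N" using lnN by (intro mult_left_mono) auto
    then show ?thesis using 2 by linarith
  qed
  note 4 = this
  have 5: "2 * (r / sqrt T0) * (18 * ln N / \<alpha>) \<le> 2 * (s / sqrt N) * (18 * ln N / \<alpha>)"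
    using 3 lnN \<alpha>_pos by (intro mult_right_mono mult_left_mono) auto
  have "2 * (T0 / N) + 4 * r * sqrt T0 + 2 * r / sqrt T0 * (18 * ln N / \<alpha>)
     \<le> 2 * (1 / sqrt N) * ln N / \<alpha> + 4 * (s / sqrt N / \<alpha>) * ln N + 2 * (s / sqrt N) * (18 * ln N / \<alpha>)"
  proof -
    have "4 * r * sqrt T0 = 4 * (r * sqrt T0)" "2 * r / sqrt T0 = 2 * (r / sqrt T0)" by simp_all
    then show ?thesis using 1 4 5 by (simp only:)
  qed
  also have "\<dots> = (2 + 40 * s) * 1 * (1 / sqrt N) * ln N / \<alpha>"
    by (simp add: add_divide_distrib[symmetric] algebra_simps)
  \<comment> \<open>The power of \<open>d\<close> enters only here, as a factor at least 1.\<close>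
  also have "\<dots> \<le> (2 + 40 * s) * real d powr (1/4) * (1 / sqrt N) * ln N / \<alpha>"
    using s0 lnN \<alpha>_pos N_pos d_powr_ge[of "1/4"]
    by (intro divide_right_mono mult_right_mono mult_left_mono) auto
  finally show ?thesis
    using solB_diff1[OF X j, of Bs] unfolding pN r_def s_def D_def \<rho>_def by linarith
qed

lemma final_diff2:
  assumes X: "X \<in> inner (N * \<delta> / 4)" and j: "i < d" "j < d"
  shows "\<bar>Dj i (Dj j (solB Bs)) X\<bar>
    \<le> (4 + sqrt (24 * (l2 / l1)) * B + 18 * sqrt (24 * (l2 / l1)) * (4 * k + 2) * B) * real d powr (1/2) * ln N / (N * \<alpha>)"
proof -
  define p where "p = sqrt (24 * (l2 / l1))"
  define D where "D = 4 * k + 2"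
  define r where "r = p / (N * \<mu>)"
  have p: "0 \<le> p" unfolding p_def using l1_pos l2_pos by simp
  have D: "1 \<le> D" unfolding D_def using ak by simp
  have T0: "T0 = 1 / (D * \<alpha>)" unfolding T0_def D_def ..
  have B0: "0 < B" using B \<alpha>_pos \<mu>_pos by (metis less_le_trans zero_less_mult_pos2)
  have 1: "4 * (T0 / N) \<le> 4 * ln N / (N * \<alpha>)"
  proof -
    have "4 * (1 / (N * \<alpha>)) \<le> 4 * (ln N / (N * \<alpha>))"
      using lnN N_pos \<alpha>_pos by (intro mult_left_mono divide_right_mono) auto
    then show ?thesis using T0_scaled(3) by simp
  qed
  have r1: "r \<le> p * B / (N * \<alpha>)"
  proof -
    have "p * \<alpha> \<le> p * (B * \<mu>)" using B p by (intro mult_left_mono) auto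
    then show ?thesis unfolding r_def using N_pos \<mu>_pos \<alpha>_pos by (simp add: field_simps)
  qed
  then have 2: "r * ln N \<le> p * B / (N * \<alpha>) * ln N" using lnN by (intro mult_right_mono) auto
  have "r / T0 = r * (D * \<alpha>)" unfolding T0 by simp
  also have "\<dots> \<le> p * B / (N * \<alpha>) * (D * \<alpha>)" using r1 D \<alpha>_pos by (intro mult_right_mono) auto
  also have "\<dots> = p * B * D / N" using \<alpha>_pos by simp
  finally have 3: "r / T0 * (18 * ln N / \<alpha>) \<le> p * B * D / N * (18 * ln N / \<alpha>)"
    using lnN \<alpha>_pos by (intro mult_right_mono) auto
  have "4 * (T0 / N) + r * ln N + r / T0 * (18 * ln N / \<alpha>)
     \<le> 4 * ln N / (N * \<alpha>) + p * B / (N * \<alpha>) * ln N + p * B * D / N * (18 * ln N / \<alpha>)"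
    using 1 2 3 by linarith
  also have "\<dots> = (4 + p * B + 18 * p * D * B) * 1 * ln N / (N * \<alpha>)"
    using N_pos \<alpha>_pos by (simp add: field_simps)
  also have "\<dots> \<le> (4 + p * B + 18 * p * D * B) * real d powr (1/2) * ln N / (N * \<alpha>)"
    using p B0 D lnN \<alpha>_pos N_pos d_powr_ge[of "1/2"]
    by (intro divide_right_mono mult_right_mono mult_left_mono) auto
  finally show ?thesis
    using solB_diff2[OF X j, of Bs] unfolding r_def p_def D_def by linarith
qed

end

section \<open>The constants as continuous functions of the parameters\<close>

lemma vec14:
  fixes x1 :: real
  shows "(vector [x1,x2,x3,x4,x5,x6,x7,x8,x9,x10,x11,x12,x13,x14] :: real ^ 14) $ 6 = x6"
    "(vector [x1,x2,x3,x4,x5,x6,x7,x8,x9,x10,x11,x12,x13,x14] :: real ^ 14) $ 7 = x7"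
    "(vector [x1,x2,x3,x4,x5,x6,x7,x8,x9,x10,x11,x12,x13,x14] :: real ^ 14) $ 9 = x9"
    "(vector [x1,x2,x3,x4,x5,x6,x7,x8,x9,x10,x11,x12,x13,x14] :: real ^ 14) $ 10 = x10"
    "(vector [x1,x2,x3,x4,x5,x6,x7,x8,x9,x10,x11,x12,x13,x14] :: real ^ 14) $ 12 = x12"
    "(vector [x1,x2,x3,x4,x5,x6,x7,x8,x9,x10,x11,x12,x13,x14] :: real ^ 14) $ 13 = x13"
  unfolding vector_def by simp_all

text \<open>Components of \<open>vector\<close> count from 1 and list entries from 0, so component 6
  is entry 5. These three are the denominators of the constants below.\<close>

lemma param_dom_pos:
  assumes "p \<in> param_dom"
  shows "0 < p $ 6" "0 < p $ 9" "0 < p $ 13"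
proof -
  obtain l where l: "p = vector l" "length l = 14" "\<forall>k<14. k \<noteq> 1 \<and> k \<noteq> 2 \<longrightarrow> 0 < l ! k"
    using assms unfolding param_dom_def by auto
  define x where "x k = l ! k" for k
  have "l = map x [0..<14]" using l(2) by (intro nth_equalityI) (auto simp: x_def)
  also have "\<dots> = [x 0, x 1, x 2, x 3, x 4, x 5, x 6, x 7, x 8, x 9, x 10, x 11, x 12, x 13]"
    by (simp add: upt_rec numeral_eq_Suc)
  finally have "p = vector [x 0, x 1, x 2, x 3, x 4, x 5, x 6, x 7, x 8, x 9, x 10, x 11, x 12, x 13]"
    using l(1) by simp
  then have "p $ 6 = x 5" "p $ 9 = x 8" "p $ 13 = x 12" by (simp_all only: vec14)
  then show "0 < p $ 6" "0 < p $ 9" "0 < p $ 13" using l(3) by (simp_all add: x_def)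
qed

text \<open>\<open>p $ 6, p $ 7\<close> are the extreme eigenvalues of \<open>\<sigma>\<^sup>2 / \<Lambda>\<close>, \<open>p $ 9, p $ 10\<close> those of \<open>\<Sigma>\<close>,
  \<open>p $ 12 = \<parallel>A\<parallel> / \<Lambda>\<close> and \<open>p $ 13 = \<Lambda> / \<mu>\<close>. In terms of these, \<open>cA\<close> bounds \<open>\<parallel>A\<parallel> / \<alpha>\<^sub>1\<close>, \<open>cB\<close> bounds
  \<open>\<alpha>\<^sub>1 / \<mu>\<close>, \<open>cT\<close> bounds \<open>tr (\<Sigma>\<^sup>-\<^sup>1 \<sigma>\<^sup>2) / (d \<alpha>\<^sub>1)\<close> and \<open>cI\<close> bounds \<open>\<mu> / \<alpha>\<^sub>1\<close>.\<close>
definition cR :: "real ^ 14 \<Rightarrow> real" where "cR p = p $ 10 / p $ 9"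
definition cA :: "real ^ 14 \<Rightarrow> real" where "cA p = 2 * p $ 12 * p $ 10 / p $ 6 + 1"
definition cB :: "real ^ 14 \<Rightarrow> real" where "cB p = p $ 7 * p $ 13 / (2 * p $ 9)"
definition cT :: "real ^ 14 \<Rightarrow> real" where "cT p = 2 * p $ 10 / (p $ 9 * p $ 6)"
definition cI :: "real ^ 14 \<Rightarrow> real" where "cI p = 2 * p $ 10 / (p $ 13 * p $ 6)"

text \<open>A sum rather than a maximum of the thresholds: on actual parameters all summands are
  nonnegative, so each is below \<open>Nc\<close>. The first one yields \<open>n_large\<close>, the
  others \<open>N1\<close> to \<open>N5\<close>.\<close>

definition Nc :: "real ^ 14 \<Rightarrow> real" where
  "Nc p = 2 * cR p * (cA p)\<^sup>2 * cB p + (1 + 5 * (cT p * exp (cT p))) + 128 * p $ 10 + 512 * cR p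
     + exp (cR p * cT p) + (1 + cI p + (cI p)\<^sup>2)"
definition K1 :: "real ^ 14 \<Rightarrow> real" where
  "K1 p = 2 + 40 * sqrt (cR p * (4 * cA p + 2) * cB p)"
definition K2 :: "real ^ 14 \<Rightarrow> real" where
  "K2 p = 4 + sqrt (24 * cR p) * cB p + 18 * sqrt (24 * cR p) * (4 * cA p + 2) * cB p"

lemma in_K_constants: "in_K Nc" "in_K K1" "in_K K2"
proof -
  have nz: "\<forall>p\<in>param_dom. p $ 6 \<noteq> 0" "\<forall>p\<in>param_dom. p $ 9 \<noteq> 0" "\<forall>p\<in>param_dom. p $ 13 \<noteq> 0"
    using param_dom_pos by force+
  have "continuous_on param_dom cR" "continuous_on param_dom cA" "continuous_on param_dom cB"
    "continuous_on param_dom cT" "continuous_on param_dom cI"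
    unfolding cR_def cA_def cB_def cT_def cI_def
    by (intro continuous_intros continuous_on_component; use nz in simp)+
  note c = this
  show "in_K Nc" "in_K K1" "in_K K2"
    unfolding in_K_def Nc_def K1_def K2_def by (intro continuous_intros continuous_on_component c)+
qed

section \<open>Comparison of the rates with \<open>alpha1\<close>\<close>

context elementary_process
begin

abbreviation "p \<equiv> params d Jset g c \<delta>0 Sig"
abbreviation "\<sigma>\<Lambda> \<equiv> mscale (1 / \<Lambda>) \<sigma>2"

lemma p_components: "p $ 6 = lmin d \<sigma>\<Lambda>" "p $ 7 = lmax d \<sigma>\<Lambda>" "p $ 9 = l1" "p $ 10 = l2"
    "p $ 12 = opnorm d A / \<Lambda>" "p $ 13 = \<Lambda> / \<mu>"
  unfolding params_def Spp_def append.simps by (simp_all only: vec14)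

lemma qform_scaled: "qform d \<sigma>2 v = \<Lambda> * qform d \<sigma>\<Lambda> v"
  unfolding qform_def mscale_def using \<Lambda>_pos by (simp add: sum_distrib_left)

lemma scaled_Md: "\<sigma>\<Lambda> \<in> Md d" and scaled_sym: "msym d \<sigma>\<Lambda>" and scaled_pd: "posdef d \<sigma>\<Lambda>"
proof -
  show "\<sigma>\<Lambda> \<in> Md d" using \<sigma>2M unfolding Md_def mscale_def by auto
  show "msym d \<sigma>\<Lambda>" using \<sigma>2sym unfolding msym_def mscale_def by auto
  then show "posdef d \<sigma>\<Lambda>"
    using \<sigma>2pd \<Lambda>_pos unfolding posdef_def qform_scaled by (simp add: zero_less_mult_iff)
qed

lemma smin_pos: "0 < p $ 6" "0 < p $ 7"
  using posdef_lmin_pos[OF scaled_Md scaled_pd d_pos] unfolding p_components by auto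

lemma \<sigma>2_bounds: "\<Lambda> * (p $ 6) * ip d v v \<le> qform d \<sigma>2 v" "qform d \<sigma>2 v \<le> \<Lambda> * (p $ 7) * ip d v v"
proof -
  have "p $ 6 * ip d v v \<le> qform d \<sigma>\<Lambda> v"
    unfolding p_components by (rule qform_ip_all[where P="\<lambda>a b. lmin d \<sigma>\<Lambda> * b \<le> a"]) (rule Rayleigh(1)[OF scaled_Md scaled_sym])
  moreover have "qform d \<sigma>\<Lambda> v \<le> p $ 7 * ip d v v"
    unfolding p_components by (rule qform_ip_all[where P="\<lambda>a b. a \<le> lmax d \<sigma>\<Lambda> * b"]) (rule Rayleigh(2)[OF scaled_Md scaled_sym])
  ultimately show "\<Lambda> * (p $ 6) * ip d v v \<le> qform d \<sigma>2 v" "qform d \<sigma>2 v \<le> \<Lambda> * (p $ 7) * ip d v v"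
    unfolding qform_scaled mult.assoc using \<Lambda>_pos by (auto intro: mult_left_mono)
qed

text \<open>Evaluated at a minimiser of the generalised Rayleigh quotient, where both forms compare
  with the Euclidean one.\<close>

lemma \<alpha>_lower: "\<Lambda> * p $ 6 \<le> 2 * l2 * \<alpha>"
proof -
  obtain v where v: "v \<in> Rd d" "\<exists>i<d. v i \<noteq> 0" "qform d \<sigma>2 v = 2 * \<alpha> * qform d Sig v"
    using gen_Rayleigh_attained by blast
  have ip: "0 < ip d v v" using v(2) ip_eq_0_iff[of d v] ip_self_nonneg[of d v] by fastforce
  have "\<Lambda> * p $ 6 * ip d v v \<le> 2 * \<alpha> * qform d Sig v" using \<sigma>2_bounds(1)[of v] v(3) by simp
  also have "\<dots> \<le> 2 * \<alpha> * (l2 * ip d v v)" using Sig_le \<alpha>_pos by (intro mult_left_mono) auto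
  finally have "(\<Lambda> * p $ 6) * ip d v v \<le> (2 * l2 * \<alpha>) * ip d v v" by (simp add: mult_ac)
  then show ?thesis using ip by (simp only: mult_le_cancel_right_pos)
qed

text \<open>A minimum is bounded by the quotient at any vector; the first unit vector will
  do.\<close>

lemma \<alpha>_upper: "2 * l1 * \<alpha> \<le> \<Lambda> * p $ 7"
proof -
  let ?v = "unitv 0 :: nat \<Rightarrow> real"
  have ip: "ip d ?v ?v = 1" using d_pos by (simp add: ip_unitv) (simp add: unitv_def)
  have "2 * \<alpha> * (l1 * ip d ?v ?v) \<le> 2 * \<alpha> * qform d Sig ?v" using Sig_ge \<alpha>_pos by (intro mult_left_mono) auto
  also have "\<dots> \<le> \<Lambda> * p $ 7 * ip d ?v ?v" using gen_Rayleigh \<sigma>2_bounds(2) order_trans by blast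
  finally show ?thesis unfolding ip by (simp add: mult_ac)
qed

text \<open>The summand 1 in \<open>cA\<close> ensures \<open>1 \<le> cA p\<close>, so that
  \<open>cA p * \<alpha>\<close> can serve as the positive bound \<open>a\<close> even though
  \<open>opnorm\<close> is only known to be nonnegative.\<close>

lemma constants_pos: "0 < cR p" "1 \<le> cA p" "0 < cB p" "0 < cT p" "0 < cI p"
  unfolding cR_def cA_def cB_def cT_def cI_def
  using smin_pos l1_pos l2_pos \<Lambda>_pos \<mu>_pos opnorm_nonneg[of d A] by (auto simp: p_components(3-6))

lemma opnorm_le: "opnorm d A \<le> cA p * \<alpha>"
proof -
  have "opnorm d A = opnorm d A / \<Lambda> / p $ 6 * (\<Lambda> * p $ 6)" using \<Lambda>_pos smin_pos by simp
  also have "\<dots> \<le> opnorm d A / \<Lambda> / p $ 6 * (2 * l2 * \<alpha>)"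
    using \<alpha>_lower opnorm_nonneg[of d A] \<Lambda>_pos smin_pos by (intro mult_left_mono) auto
  also have "\<dots> \<le> cA p * \<alpha>" unfolding cA_def p_components(4,5) using \<alpha>_pos by (simp add: field_simps)
  finally show ?thesis .
qed

lemma \<alpha>_le_cB: "\<alpha> \<le> cB p * \<mu>"
  using \<alpha>_upper l1_pos \<mu>_pos unfolding cB_def p_components(3,6) by (simp add: field_simps)

lemma \<mu>_le_cI: "\<mu> \<le> cI p * \<alpha>"
proof -
  have "\<mu> = \<mu> / (\<Lambda> * p $ 6) * (\<Lambda> * p $ 6)" using \<Lambda>_pos smin_pos by simp
  also have "\<dots> \<le> \<mu> / (\<Lambda> * p $ 6) * (2 * l2 * \<alpha>)"
    using \<alpha>_lower \<mu>_pos \<Lambda>_pos smin_pos by (intro mult_left_mono) auto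
  also have "\<dots> = cI p * \<alpha>" unfolding cI_def p_components(4,6) using \<mu>_pos \<Lambda>_pos by simp
  finally show ?thesis .
qed

lemma trace_le_cT: "(\<Sum>J\<in>Jset. g J c * qform d Si (rv J)) \<le> real d * cT p * \<alpha>"
proof -
  have "\<Lambda> / l1 = (\<Lambda> * p $ 6) / (l1 * p $ 6)" using smin_pos by simp
  also have "\<dots> \<le> (2 * l2 * \<alpha>) / (l1 * p $ 6)"
    using \<alpha>_lower l1_pos smin_pos by (intro divide_right_mono) auto
  also have "\<dots> = cT p * \<alpha>" unfolding cT_def p_components(3,4) by simp
  finally have "real d * (\<Lambda> / l1) \<le> real d * (cT p * \<alpha>)" by (intro mult_left_mono) auto
  then show ?thesis using trace_bound by (simp add: mult_ac)
qed

lemma mixing: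
  assumes \<delta>: "0 < \<delta>" "\<delta> \<le> min 3 (\<delta>0 / sqrt l2) / 3" and dn: "d ^ 4 \<le> n"
    and n: "Nc p \<le> real n" and psi: "psi_inv d Jset g c \<delta>0 Sig (\<delta> / 2) \<le> n"
  shows "mixing_process d Jset g c \<delta>0 Sig n \<delta> (cA p * \<alpha>) (cA p) (cB p) (cT p) (cI p)"
proof -
  note cp = constants_pos
  have pn: "4 \<le> n" "psi d Jset g c \<delta>0 Sig n \<le> \<delta> / 2" using psi_inv_le[OF _ psi] \<delta> by auto
  have parts: "0 \<le> 2 * cR p * (cA p)\<^sup>2 * cB p" "0 \<le> 5 * (cT p * exp (cT p))" "0 \<le> 128 * p $ 10" "0 \<le> 512 * cR p"
    "0 \<le> exp (cR p * cT p)" "0 \<le> cI p" "0 \<le> (cI p)\<^sup>2"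
    using cp l2_pos unfolding p_components by (auto intro!: mult_nonneg_nonneg)
  have large: "2 * cR p * (cA p)\<^sup>2 * cB p \<le> real n" "1 + 5 * (cT p * exp (cT p)) \<le> real n" "128 * l2 \<le> real n"
    "512 * cR p \<le> real n" "exp (cR p * cT p) \<le> real n" "1 + cI p + (cI p)\<^sup>2 \<le> real n"
    using n parts unfolding Nc_def p_components by linarith+
  interpret restricted_process d Jset g c \<delta>0 Sig n \<delta> "cA p * \<alpha>"
  proof
    show "0 < cA p * \<alpha>" using cp \<alpha>_pos by simp
    \<comment> \<open>The first summand of \<open>Nc\<close> is built for this: replacing one
      \<open>\<alpha>\<close> by \<open>cB p * \<mu>\<close> leaves exactly that summand times
      \<open>\<mu> * \<alpha> * l1\<close>.\<close>
    have "2 * l2 * (cA p * \<alpha>)\<^sup>2 = (2 * cR p * (cA p)\<^sup>2) * \<alpha> * (\<alpha> * l1)"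
      unfolding cR_def p_components using l1_pos by (simp add: power_mult_distrib power2_eq_square)
    also have "\<dots> \<le> (2 * cR p * (cA p)\<^sup>2) * (cB p * \<mu>) * (\<alpha> * l1)"
      using \<alpha>_le_cB cp \<alpha>_pos l1_pos by (intro mult_right_mono mult_left_mono) auto
    also have "\<dots> = (2 * cR p * (cA p)\<^sup>2 * cB p) * (\<mu> * (\<alpha> * l1))" by simp
    also have "\<dots> \<le> real n * (\<mu> * (\<alpha> * l1))"
      using large(1) \<mu>_pos \<alpha>_pos l1_pos by (intro mult_right_mono) auto
    finally show "2 * l2 * (cA p * \<alpha>)\<^sup>2 \<le> \<alpha> * (real n * \<mu>) * l1" by (simp add: mult_ac)
  qed (use \<delta> dn pn opnorm_le in auto)
  show ?thesis
    by unfold_locales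
      (use large cp \<alpha>_le_cB \<mu>_le_cI trace_le_cT in \<open>auto simp: \<tau>_def cR_def p_components(3,4)\<close>)
qed

end

theorem theorem4p1:
  shows "\<exists>Nc K1 K2 :: real ^ 14 \<Rightarrow> real. in_K Nc \<and> in_K K1 \<and> in_K K2 \<and>
    (\<forall>d Jset g c \<delta>0 Sig. elementary d Jset g c \<delta>0 \<and> lyap_sol d Jset g c Sig \<longrightarrow>
      (let p = params d Jset g c \<delta>0 Sig;
           \<kappa>0 = (1536::real);
           \<alpha>1 = alpha1 d Jset g c Sig;
           \<delta>1 = min 3 (\<delta>0 / sqrt (lmax d Sig))
       in \<forall>B \<delta> n X. B \<subseteq> Zd d \<and> 0 < \<delta> \<and> \<delta> \<le> \<delta>1 / 3 \<and> d ^ 4 \<le> n \<and>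
            Nc p \<le> real n \<and> psi_inv d Jset g c \<delta>0 Sig (\<delta> / 2) \<le> n \<and>
            X \<in> Zd d \<and> snorm d Sig (\<lambda>i. rv X i - real n * c i) \<le> real n * \<delta> / 4 \<longrightarrow>
         (let h = hB d Jset g c Sig n \<delta> B in
            \<bar>h X\<bar> \<le> \<kappa>0 * ln (real n) / \<alpha>1 \<and>
            (\<forall>j<d. \<bar>Dj j h X\<bar> \<le> K1 p * real d powr (1/4) * real n powr (-1/2) * ln (real n) / \<alpha>1) \<and>
            (\<forall>j<d. \<forall>k<d. \<bar>Dj j (Dj k h) X\<bar> \<le> K2 p * real d powr (1/2) * ln (real n) / (real n * \<alpha>1)))))"
proof (rule exI[of _ Nc], rule exI[of _ K1], rule exI[of _ K2], unfold Let_def, intro conjI in_K_constants allI impI)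
  fix d Jset g c \<delta>0 Sig B \<delta> n X
  assume el: "elementary d Jset g c \<delta>0 \<and> lyap_sol d Jset g c Sig"
    and H: "B \<subseteq> Zd d \<and> 0 < \<delta> \<and> \<delta> \<le> min 3 (\<delta>0 / sqrt (lmax d Sig)) / 3 \<and> d ^ 4 \<le> n \<and>
            Nc (params d Jset g c \<delta>0 Sig) \<le> real n \<and> psi_inv d Jset g c \<delta>0 Sig (\<delta> / 2) \<le> n \<and>
            X \<in> Zd d \<and> snorm d Sig (\<lambda>i. rv X i - real n * c i) \<le> real n * \<delta> / 4"
  interpret ep: elementary_process d Jset g c \<delta>0 Sig using el by unfold_locales auto
  interpret mp: mixing_process d Jset g c \<delta>0 Sig n \<delta> "cA ep.p * ep.\<alpha>" "cA ep.p" "cB ep.p" "cT ep.p" "cI ep.p"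
    using H by (intro ep.mixing) auto
  have X: "X \<in> mp.inner (real n * \<delta> / 4)"
    using H unfolding mp.inner_def mp.ctr_def by auto
  have "\<bar>mp.solB B X\<bar> \<le> 18 * ln (real n) / ep.\<alpha>" using mp.solB_bound X mp.inner_S by blast
  \<comment> \<open>The 18 is three times the mixing time in units of
    \<open>ln n / \<alpha>\<close>, which is \<open>1 + 5\<close>.\<close>
  also have "\<dots> \<le> 1536 * ln (real n) / ep.\<alpha>"
    using mp.lnN ep.\<alpha>_pos by (intro divide_right_mono mult_right_mono) auto
  finally show "\<bar>hB d Jset g c Sig n \<delta> B X\<bar> \<le> 1536 * ln (real n) / ep.\<alpha>" unfolding mp.solB_def .
  fix j assume j: "j < d"
  show "\<bar>Dj j (hB d Jset g c Sig n \<delta> B) X\<bar>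
      \<le> K1 ep.p * real d powr (1/4) * real n powr (-1/2) * ln (real n) / ep.\<alpha>"
    using mp.final_diff1[OF X j, of B] unfolding mp.solB_def K1_def cR_def ep.p_components .
  fix k assume k: "k < d"
  show "\<bar>Dj j (Dj k (hB d Jset g c Sig n \<delta> B)) X\<bar>
      \<le> K2 ep.p * real d powr (1/2) * ln (real n) / (real n * ep.\<alpha>)"
    using mp.final_diff2[OF X j k, of B] unfolding mp.solB_def K2_def cR_def ep.p_components .
qed

end
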